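(* Let $U\subset\mathbb S$ be a patch, let $r>1$ be fixed, and let $$\mathcal A_U^{(r)}:\ \mathcal H_+^{(r)}(\mathbb S)\times\mathcal H_-(\mathbb S)\to L^2(U)^3,\qquad \mathcal A_U^{(r)}(\mathbf f_+,\mathbf f_-)=(\mathbf f_++\mathbf f_-)|_U .$$ Then $\mathcal A_U^{(r)}$ has only the trivial null space: $\ker(\mathcal A_U^{(r)})=\{(0,0)\}$.
   Context: $\mathbb{S}=\{x\in\mathbb R^3:|x|=1\}$ is the unit sphere, with outward unit normal $\eta(x)=x$ and surface gradient $\nabla_{\mathbb S}$; $\mathbb S_r=\{|x|=r\}$ and $\mathbb B_r=\{|x|<r\}$ in $\mathbb R^3$. A patch $U$ is a non-empty open subregion of $\mathbb{S}$ with connected Lipschitz boundary such that $V=\mathbb{S}\setminus\overline U$ is non-empty. Let $\{Y_{n,k}\}_{n\ge 0,\,|k|\le n}$ be an orthonormal basis of $L^2(\mathbb{S})$ of scalar spherical harmonics ($Y_{n,k}$ of degree $n$) and set $$\mathbf G^{\mathrm{ext}}_{n,k}=\nabla_{\mathbb S}Y_{n,k}+n\,\eta Y_{n,k},\qquad \mathbf G^{\mathrm{int}}_{n,k}=\nabla_{\mathbb S}Y_{n,k}-(n+1)\,\eta Y_{n,k}.$$ The Hardy spaces are the closed subspaces of $L^2(\mathbb S)^3$ $$\mathcal H_+(\mathbb S)=\overline{\mathrm{span}\{\mathbf G^{\mathrm{ext}}_{n,k}:n\ge1,|k|\le n\}}^{L^2(\mathbb S)^3},\qquad \mathcal H_-(\mathbb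 S)=\overline{\mathrm{span}\{\mathbf G^{\mathrm{int}}_{n,k}:n\ge0,|k|\le n\}}^{L^2(\mathbb S)^3}.$$ Equivalently, $\mathcal H_+(\mathbb S)$ (resp. $\mathcal H_-(\mathbb S)$) consists of the nontangential boundary limits $\nabla u|_{\mathbb S}$ of gradients of functions $u$ harmonic in the open unit ball (resp. harmonic in the complement of the closed unit ball with $u(x)\to0$ as $|x|\to\infty$) such that the nontangential maximal function of $\nabla u$ on $\mathbb S$, taken from the respective side, is square-integrable. For $r>1$, the external-source altitude class is $$\mathcal H_+^{(r)}(\mathbb S)=\{\nabla u|_{\mathbb S}:\ \Delta u=0\text{ in }\mathbb B_r,\ \|(\nabla u)_+^M\|_{L^2(\mathbb S_r)^3}<\infty,\ u|_{\mathbb S_r}\in H^1(\mathbb S_r)\}\subset\mathcal H_+(\mathbb S),$$ where $(\nabla u)^M_+$ denotes the nontangential maximal function of $\nabla u$ on $\mathbb S_r$ taken from inside $\mathbb B_r$, and $u|_{\mathbb S_r}$ the boundary trace. *)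

theory Defs
  imports "HOL-Analysis.Analysis"
begin

definition L2_fun :: "'a measure \<Rightarrow> ('a \<Rightarrow> 'b::euclidean_space) set" where
  "L2_fun M = {f \<in> borel_measurable M. integrable M (\<lambda>x. (norm (f x))\<^sup>2)}"

definition L2_norm :: "'a measure \<Rightarrow> ('a \<Rightarrow> 'b::euclidean_space) \<Rightarrow> real" where
  "L2_norm M f = sqrt (LINT x|M. (norm (f x))\<^sup>2)"

definition L2_eq :: "'a measure \<Rightarrow> (('a \<Rightarrow> 'b::euclidean_space) \<times> ('a \<Rightarrow> 'b)) set" where
  "L2_eq M = {(f, g). f \<in> L2_fun M \<and> g \<in> L2_fun M \<and> (AE x in M. f x = g x)}"

text \<open>The element of \<open>L\<^sup>2(M)\<close> represented by \<open>f\<close>.\<close>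

definition L2_class :: "'a measure \<Rightarrow> ('a \<Rightarrow> 'b::euclidean_space) \<Rightarrow> ('a \<Rightarrow> 'b) set" where
  "L2_class M f = L2_eq M `` {f}"

text \<open>Representatives of the elements of the \<open>L\<^sup>2\<close>-closure of the linear span of a family
  of square-integrable functions.\<close>

definition L2_closed_span ::
  "'a measure \<Rightarrow> 'i set \<Rightarrow> ('i \<Rightarrow> 'a \<Rightarrow> 'b::euclidean_space) \<Rightarrow> ('a \<Rightarrow> 'b) set" where
  "L2_closed_span M I G =
     {f \<in> L2_fun M. \<forall>\<epsilon>>0. \<exists>F c. finite F \<and> F \<subseteq> I \<and>
        L2_norm M (\<lambda>x. f x - (\<Sum>i\<in>F. c i *\<^sub>R G i x)) < \<epsilon>}"

definition grad :: "(real^3 \<Rightarrow> real) \<Rightarrow> real^3 \<Rightarrow> real^3" where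
  "grad f x = (THE D. GDERIV f x :> D)"

definition laplacian :: "(real^3 \<Rightarrow> real) \<Rightarrow> real^3 \<Rightarrow> real" where
  "laplacian f x = (\<Sum>i\<in>UNIV. grad (\<lambda>y. grad f y $ i) x $ i)"

text \<open>\<open>k\<close>-fold continuous differentiability; only meaningful on open sets.\<close>

fun Ck_on :: "nat \<Rightarrow> (real^3) set \<Rightarrow> (real^3 \<Rightarrow> real) \<Rightarrow> bool" where
  "Ck_on 0 S f = continuous_on S f"
| "Ck_on (Suc k) S f =
     ((\<forall>x\<in>S. f differentiable (at x)) \<and> (\<forall>i. Ck_on k S (\<lambda>x. grad f x $ i)))"

definition harmonic_on :: "(real^3) set \<Rightarrow> (real^3 \<Rightarrow> real) \<Rightarrow> bool" where
  "harmonic_on S u \<longleftrightarrow> Ck_on 2 S u \<and> (\<forall>x\<in>S. laplacian u x = 0)"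

text \<open>Surface measure on the sphere of radius \<open>r\<close>, whose underlying space is that sphere. The
  area of \<open>A\<close> is \<open>3 / r\<close> times the volume of the solid cone over \<open>A\<close> with apex \<open>0\<close>.\<close>

definition surface_measure :: "real \<Rightarrow> (real^3) measure" where
  "surface_measure r = scale_measure (ennreal (3 / r))
     (distr (restrict_space lborel (ball 0 r - {0})) (restrict_space borel (sphere 0 r))
        (\<lambda>x. (r / norm x) *\<^sub>R x))"

definition radial_ext :: "real \<Rightarrow> (real^3 \<Rightarrow> real) \<Rightarrow> real^3 \<Rightarrow> real" where
  "radial_ext r f x = f ((r / norm x) *\<^sub>R x)"

text \<open>The radially constant extension has no normal derivative, so its Euclidean gradient at a
  point of the sphere is the surface gradient. It depends only on \<open>f\<close> on the sphere.\<close>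

definition surface_grad :: "real \<Rightarrow> (real^3 \<Rightarrow> real) \<Rightarrow> real^3 \<Rightarrow> real^3" where
  "surface_grad r f x = grad (radial_ext r f) x"

definition smooth_on_sphere :: "real \<Rightarrow> (real^3 \<Rightarrow> real) \<Rightarrow> bool" where
  "smooth_on_sphere r f \<longleftrightarrow> (\<forall>k. Ck_on k (- {0}) (radial_ext r f))"

text \<open>The Sobolev space \<open>H\<^sup>1\<close> of the sphere of radius \<open>r\<close> (representatives), as the completion of
  the smooth functions in the norm that combines a function and its surface gradient.\<close>

definition H1_sphere :: "real \<Rightarrow> (real^3 \<Rightarrow> real) set" where
  "H1_sphere r =
     {g \<in> L2_fun (surface_measure r). \<exists>\<phi> D. (\<forall>j. smooth_on_sphere r (\<phi> j)) \<and>
        D \<in> L2_fun (surface_measure r) \<and>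
        (\<lambda>j. L2_norm (surface_measure r) (\<lambda>x. \<phi> j x - g x)) \<longlonglongrightarrow> 0 \<and>
        (\<lambda>j. L2_norm (surface_measure r) (\<lambda>x. surface_grad r (\<phi> j) x - D x)) \<longlonglongrightarrow> 0}"

text \<open>For \<open>U\<close> inside the unit sphere, which is closed, this is the boundary relative to the sphere.\<close>

definition sphere_boundary :: "(real^3) set \<Rightarrow> (real^3) set" where
  "sphere_boundary U = closure U \<inter> closure (sphere 0 1 - U)"

text \<open>Near \<open>p\<close> the orthogonal projection onto the tangent plane at \<open>p\<close>, with orthonormal
  coordinates \<open>(x \<bullet> a, x \<bullet> b)\<close>, is a chart of the sphere; in it \<open>U\<close> must lie locally on one side
  of a Lipschitz graph.\<close>

definition lipschitz_boundary :: "(real^3) set \<Rightarrow> bool" where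
  "lipschitz_boundary U \<longleftrightarrow>
     (\<forall>p\<in>sphere_boundary U. \<exists>a b h L \<delta>.
        norm a = 1 \<and> norm b = 1 \<and> a \<bullet> b = 0 \<and> a \<bullet> p = 0 \<and> b \<bullet> p = 0 \<and>
        L-lipschitz_on (UNIV :: real set) (h :: real \<Rightarrow> real) \<and> \<delta> > 0 \<and>
        (\<forall>x\<in>sphere 0 1 \<inter> ball p \<delta>. x \<in> U \<longleftrightarrow> x \<bullet> b > h (x \<bullet> a)))"

definition patch :: "(real^3) set \<Rightarrow> bool" where
  "patch U \<longleftrightarrow> U \<noteq> {} \<and> openin (top_of_set (sphere 0 1)) U \<and> connected U \<and>
     connected (sphere_boundary U) \<and> lipschitz_boundary U \<and> sphere 0 1 - closure U \<noteq> {}"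

definition spherical_harmonic :: "nat \<Rightarrow> (real^3 \<Rightarrow> real) \<Rightarrow> bool" where
  "spherical_harmonic n f \<longleftrightarrow>
     (\<exists>p. real_polynomial_function p \<and> (\<forall>t x. p (t *\<^sub>R x) = t ^ n * p x) \<and>
        harmonic_on UNIV p \<and> (\<forall>x\<in>sphere 0 1. f x = p x))"

definition sh_index :: "(nat \<times> int) set" where
  "sh_index = {(n, k). \<bar>k\<bar> \<le> int n}"

definition sh_orthonormal_basis :: "(nat \<Rightarrow> int \<Rightarrow> real^3 \<Rightarrow> real) \<Rightarrow> bool" where
  "sh_orthonormal_basis Y \<longleftrightarrow>
     (\<forall>(n, k)\<in>sh_index. spherical_harmonic n (Y n k)) \<and>
     (\<forall>(n, k)\<in>sh_index. \<forall>(m, l)\<in>sh_index.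
        (LINT x|surface_measure 1. Y n k x * Y m l x) = (if (n, k) = (m, l) then 1 else 0)) \<and>
     L2_closed_span (surface_measure 1) sh_index (\<lambda>(n, k). Y n k) = L2_fun (surface_measure 1)"

definition G_int :: "(nat \<Rightarrow> int \<Rightarrow> real^3 \<Rightarrow> real) \<Rightarrow> nat \<Rightarrow> int \<Rightarrow> real^3 \<Rightarrow> real^3" where
  "G_int Y n k x = surface_grad 1 (Y n k) x - ((real n + 1) * Y n k x) *\<^sub>R x"

definition hardy_minus ::
  "(nat \<Rightarrow> int \<Rightarrow> real^3 \<Rightarrow> real) \<Rightarrow> (real^3 \<Rightarrow> real^3) set set" where
  "hardy_minus Y = L2_class (surface_measure 1) `
     L2_closed_span (surface_measure 1) sh_index (\<lambda>(n, k). G_int Y n k)"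

text \<open>Interior nontangential approach region with aperture parameter \<open>\<alpha> > 0\<close>: for \<open>norm x < r\<close>,
  \<open>r - norm x\<close> is the distance from \<open>x\<close> to the sphere of radius \<open>r\<close>.\<close>

definition nt_region :: "real \<Rightarrow> real \<Rightarrow> real^3 \<Rightarrow> (real^3) set" where
  "nt_region \<alpha> r y = {x \<in> ball 0 r. dist x y < (1 + \<alpha>) * (r - norm x)}"

definition nt_maximal ::
  "real \<Rightarrow> real \<Rightarrow> (real^3 \<Rightarrow> real^3) \<Rightarrow> real^3 \<Rightarrow> ennreal" where
  "nt_maximal \<alpha> r f y = (SUP x\<in>nt_region \<alpha> r y. ennreal (norm (f x)))"

text \<open>The boundary trace of \<open>u\<close> is understood as its nontangential limit almost everywhere.\<close>

definition has_nt_trace ::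
  "real \<Rightarrow> real \<Rightarrow> (real^3 \<Rightarrow> real) \<Rightarrow> (real^3 \<Rightarrow> real) \<Rightarrow> bool" where
  "has_nt_trace \<alpha> r u g \<longleftrightarrow>
     (AE y in surface_measure r. (u \<longlongrightarrow> g y) (at y within nt_region \<alpha> r y))"

definition altitude_class :: "real \<Rightarrow> real \<Rightarrow> (real^3 \<Rightarrow> real^3) set set" where
  "altitude_class \<alpha> r =
     {L2_class (surface_measure 1) (grad u) | u.
        harmonic_on (ball 0 r) u \<and>
        (\<integral>\<^sup>+ y. (nt_maximal \<alpha> r (grad u) y)\<^sup>2 \<partial>surface_measure r) < \<infinity> \<and>
        (\<exists>g\<in>H1_sphere r. has_nt_trace \<alpha> r u g)}"

text \<open>The union over representatives is the usual way to define an operation on classes; the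
  result does not depend on the representatives.\<close>

definition A_op ::
  "(real^3) set \<Rightarrow> (real^3 \<Rightarrow> real^3) set \<times> (real^3 \<Rightarrow> real^3) set \<Rightarrow> (real^3 \<Rightarrow> real^3) set"
where
  "A_op U = (\<lambda>(Fp, Fm). \<Union>fp\<in>Fp. \<Union>fm\<in>Fm.
     L2_class (restrict_space (surface_measure 1) U) (\<lambda>x. fp x + fm x))"

definition A_kernel ::
  "(nat \<Rightarrow> int \<Rightarrow> real^3 \<Rightarrow> real) \<Rightarrow> real \<Rightarrow> real \<Rightarrow> (real^3) set \<Rightarrow>
   ((real^3 \<Rightarrow> real^3) set \<times> (real^3 \<Rightarrow> real^3) set) set"
where
  "A_kernel Y \<alpha> r U =
     {F \<in> altitude_class \<alpha> r \<times> hardy_minus Y.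
        A_op U F = L2_class (restrict_space (surface_measure 1) U) (\<lambda>x. 0)}"

end

theory Submission
  imports Defs "HOL-Complex_Analysis.Conformal_Mappings"
begin

text \<open>
  For a field \<open>f\<close> on the unit sphere put \<open>\<Psi>[f](y) = \<integral> f(x) \<bullet> \<nabla>\<^sub>x (1 / |x - y|) dx\<close>. Since
  \<open>\<H>\<^sub>+\<close> and \<open>\<H>\<^sub>-\<close> are orthogonal, \<open>\<Psi>[\<nabla>u]\<close> vanishes inside the ball and \<open>\<Psi>[f\<^sub>-]\<close>
  vanishes outside; outside, \<open>\<Psi>[\<nabla>u]\<close> is the Kelvin transform of a multiple of \<open>x \<bullet> \<nabla>u\<close>, which is
  harmonic in \<open>|y| > 1 / r\<close>. If \<open>g = \<nabla>u + f\<^sub>-\<close> vanishes on \<open>U\<close>, then \<open>\<Psi>[g]\<close> is harmonic across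
  \<open>U\<close>, so it extends this Kelvin transform to an entire harmonic function that vanishes at infinity.
  By Liouville \<open>x \<bullet> \<nabla>u = 0\<close>, hence \<open>\<nabla>u = 0\<close>; and \<open>\<Psi>[f\<^sub>-] = 0\<close> inside the ball says that \<open>f\<^sub>-\<close> is
  orthogonal to \<open>\<H>\<^sub>-\<close>.

  The divergence theorem is avoided: integration by parts on the sphere comes from rotation
  invariance, and \<open>\<Sum> (e\<^sub>k \<times> x \<bullet> \<nabla>)\<^sup>2 = |x|\<^sup>2 \<Delta> - E\<^sup>2 - E\<close> with \<open>E = x \<bullet> \<nabla>\<close> turns the Laplace-Beltrami
  operator into radial derivatives. Liouville's theorem and unique continuation are used only along
  complexified lines, where they are facts about holomorphic functions of one variable.
\<close>

section \<open>The surface measure\<close>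

text \<open>As a function of \<open>x\<close>, the kernel of \<open>\<Psi>\<close> is the gradient
  of a function harmonic near the closed ball if \<open>|y| > 1\<close>, and of an exterior harmonic
  function vanishing at infinity if \<open>|y| < 1\<close>. This is why orthogonality kills one
  potential on each side.

  The obstacle is that \<open>f\<^sub>-\<close> is only a limit in the mean of smooth fields and has
  no usable boundary values. A pairing with a kernel continuous on the sphere survives such limits;
  so the claims about \<open>f\<^sub>-\<close> are verified on the generators, and its own potential
  is evaluated off the sphere only.

  The strict inequality \<open>r > 1\<close> creates the overlap \<open>1 / r < |y| < 1\<close>,
  where both the inner potential and the Kelvin transform are defined. They are known to agree just
  outside \<open>U\<close>; continued through a point of \<open>U\<close> along a complexified ray,
  the agreement spreads over an annulus, and so they glue to one single-valued function.

  The potentials are computed from one identity: the Poisson kernel is \<open>2 E + 1\<close>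
  applied to the Newtonian kernel. \<open>E\<close> is symmetric for the pairing of functions
  harmonic in balls about \<open>0\<close>, so it can be moved onto \<open>u\<close>.\<close>

lemmas lint_cong = Bochner_Integration.integral_cong
  and lint_sum = Bochner_Integration.integral_sum
  and lint_bound = Bochner_Integration.integrable_bound

abbreviation \<mu> :: "(real^3) measure" where "\<mu> \<equiv> surface_measure 1"

abbreviation punctured_ball :: "(real^3) set" where "punctured_ball \<equiv> ball 0 1 - {0}"

lemma space_surface [simp]: "space \<mu> = sphere 0 1"
  by (auto simp: surface_measure_def space_restrict_space space_scale_measure)

lemma sets_surface: "sets \<mu> = sets (restrict_space borel (sphere 0 1))"
  by (simp add: surface_measure_def)

lemma measurable_surface_eq: "measurable \<mu> N = measurable (restrict_space borel (sphere 0 1)) N"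
  by (rule measurable_cong_sets) (simp_all add: sets_surface)

lemma radial_projection_measurable:
  "(\<lambda>x::real^3. (1 / norm x) *\<^sub>R x) \<in>
     restrict_space lborel punctured_ball \<rightarrow>\<^sub>M restrict_space borel (sphere 0 1)"
proof (rule measurable_restrict_space2)
  show "(\<lambda>x::real^3. (1 / norm x) *\<^sub>R x) \<in> space (restrict_space lborel punctured_ball) \<rightarrow> sphere 0 1"
    by (auto simp: space_restrict_space)
  show "(\<lambda>x::real^3. (1 / norm x) *\<^sub>R x) \<in> restrict_space lborel punctured_ball \<rightarrow>\<^sub>M borel"
    by (rule measurable_restrict_space1) simp
qed

definition solid_cone :: "(real^3) set \<Rightarrow> (real^3) set" where
  "solid_cone A = {x \<in> punctured_ball. (1 / norm x) *\<^sub>R x \<in> A}"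

lemma emeasure_surface:
  assumes "A \<in> sets \<mu>"
  shows "emeasure \<mu> A = 3 * emeasure lborel (solid_cone A)"
proof -
  have A: "A \<in> sets (restrict_space borel (sphere 0 1))"
    using assms by (simp add: sets_surface)
  have eq: "(\<lambda>x::real^3. (1 / norm x) *\<^sub>R x) -` A \<inter> space (restrict_space lborel punctured_ball) = solid_cone A"
    by (auto simp: solid_cone_def space_restrict_space)
  have "emeasure \<mu> A = 3 * emeasure (restrict_space lborel punctured_ball) (solid_cone A)"
    using A by (simp add: surface_measure_def emeasure_distr[OF radial_projection_measurable A] eq del: space_restrict_space space_restrict_space2)
  also have "emeasure (restrict_space lborel punctured_ball) (solid_cone A) = emeasure lborel (solid_cone A)"
    by (rule emeasure_restrict_space) (auto simp: solid_cone_def)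
  finally show ?thesis .
qed

lemma solid_cone_sets:
  assumes "A \<in> sets \<mu>"
  shows "solid_cone A \<in> sets borel"
proof -
  have A: "A \<in> sets (restrict_space borel (sphere 0 1))"
    using assms by (simp add: sets_surface)
  have eq: "(\<lambda>x::real^3. (1 / norm x) *\<^sub>R x) -` A \<inter> space (restrict_space lborel punctured_ball) = solid_cone A"
    by (auto simp: solid_cone_def space_restrict_space)
  have "solid_cone A \<in> sets (restrict_space lborel punctured_ball)"
    using measurable_sets[OF radial_projection_measurable A] eq by simp
  then show ?thesis
    by (subst (asm) sets_restrict_space_iff) auto
qed

lemma sphere_sets_surface [simp]: "sphere 0 1 \<in> sets \<mu>"
  using sets.top[of \<mu>] by simp

lemma solid_cone_sphere: "solid_cone (sphere 0 1) = punctured_ball"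
  by (auto simp: solid_cone_def)

lemma emeasure_lborel_punctured_ball: "emeasure lborel punctured_ball < \<infinity>"
proof -
  have "emeasure lborel punctured_ball \<le> emeasure lborel (ball (0::real^3) 1)"
    by (intro emeasure_mono) auto
  also have "\<dots> < \<infinity>"
    by (rule emeasure_bounded_finite) simp
  finally show ?thesis .
qed

lemma finite_measure_surface: "finite_measure \<mu>"
proof
  show "emeasure \<mu> (space \<mu>) \<noteq> \<infinity>"
    using emeasure_lborel_punctured_ball
    by (simp add: emeasure_surface solid_cone_sphere ennreal_mult_eq_top_iff)
qed

interpretation surface: finite_measure \<mu>
  by (rule finite_measure_surface)

text \<open>Kept as an abstract positive constant: it is the normalising factor of the Poisson
  integral.\<close>

definition area :: real where "area = measure \<mu> (sphere 0 1)"

lemma area_pos: "area > 0"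
proof -
  have "emeasure lborel punctured_ball = emeasure lborel (ball (0::real^3) 1)"
    by (rule emeasure_Diff_null_set) auto
  also have "\<dots> = ennreal (measure lborel (ball (0::real^3) 1))"
    by (rule emeasure_eq_ennreal_measure) (use emeasure_bounded_finite[of "ball (0::real^3) 1"] in auto)
  also have "\<dots> > 0"
    using content_ball_pos[of 1 "0::real^3"] by simp
  finally have "emeasure \<mu> (sphere 0 1) > 0"
    by (simp add: emeasure_surface solid_cone_sphere ennreal_zero_less_mult_iff)
  then show ?thesis
    unfolding area_def using surface.emeasure_eq_measure[of "sphere 0 1"] by simp
qed

text \<open>Boundedness makes both measures finite, so that the invariance of the real-valued
  \<open>measure lebesgue\<close> can be transferred to \<open>emeasure lborel\<close>.\<close>

lemma orthogonal_vimage_lborel: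
  fixes T :: "real^'n::{finite,wellorder} \<Rightarrow> real^'n::{finite,wellorder}"
  assumes T: "orthogonal_transformation T" and A: "A \<in> sets borel" "bounded A"
  shows "emeasure lborel (T -` A) = emeasure lborel A"
proof -
  have lin: "linear T" and bij: "bij T"
    using T orthogonal_transformation_linear orthogonal_transformation_bij by auto
  have B: "T -` A \<in> sets borel"
    using measurable_sets[OF borel_measurable_continuous_onI[OF linear_continuous_on[OF linear_conv_bounded_linear[THEN iffD1, OF lin]]] A(1)]
    by simp
  have bd: "bounded (T -` A)"
    using A(2) orthogonal_transformation_norm[OF T] by (force simp: bounded_iff)
  have im: "T ` (T -` A) = A"
    using bij by (simp add: bij_is_surj surj_image_vimage_eq)
  have lm: "C \<in> sets borel \<Longrightarrow> bounded C \<Longrightarrow> C \<in> lmeasurable" for C :: "(real^'n::{finite,wellorder}) set"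
    by (rule bounded_set_imp_lmeasurable) auto
  have *: "emeasure lborel C = ennreal (measure lebesgue C)" if "C \<in> sets borel" "bounded C" for C :: "(real^'n::{finite,wellorder}) set"
  proof -
    have "emeasure lborel C = ennreal (measure lborel C)"
      by (rule emeasure_eq_ennreal_measure) (use emeasure_bounded_finite[OF that(2)] in auto)
    then show ?thesis
      using that by (simp add: measure_completion)
  qed
  have "measure lebesgue (T ` (T -` A)) = measure lebesgue (T -` A)"
    by (rule measure_orthogonal_image[OF T lm[OF B bd]])
  then show ?thesis
    using *[OF B bd] *[OF A] im by simp
qed

text \<open>\<open>T\<close> preserves norms and commutes with the radial projection, so the solid
  cone over a preimage is the preimage of the solid cone, and invariance of volume applies.\<close>

lemma distr_surface_orthogonal:
  assumes T: "orthogonal_transformation (T :: real^3 \<Rightarrow> real^3)"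
  shows "T \<in> \<mu> \<rightarrow>\<^sub>M \<mu>" and "distr \<mu> \<mu> T = \<mu>"
proof -
  have lin: "linear T"
    using T by (rule orthogonal_transformation_linear)
  have nT: "norm (T x) = norm x" for x
    using T by (rule orthogonal_transformation_norm)
  have cont: "continuous_on S T" for S
    by (rule linear_continuous_on[OF linear_conv_bounded_linear[THEN iffD1, OF lin]])
  have "T \<in> restrict_space borel (sphere 0 1) \<rightarrow>\<^sub>M restrict_space borel (sphere 0 1)"
    by (rule measurable_restrict_space2)
      (auto simp: space_restrict_space nT intro!: borel_measurable_continuous_on_restrict cont)
  then show M: "T \<in> \<mu> \<rightarrow>\<^sub>M \<mu>"
    by (subst measurable_cong_sets[OF sets_surface sets_surface])
  show "distr \<mu> \<mu> T = \<mu>"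
  proof (rule measure_eqI)
    fix A assume "A \<in> sets (distr \<mu> \<mu> T)"
    then have A: "A \<in> sets \<mu>" by simp
    have solid_cone_eq: "solid_cone (T -` A \<inter> space \<mu>) = T -` solid_cone A"
      using T by (auto simp: solid_cone_def nT linear_scale[OF lin] linear_0[OF lin]
        orthogonal_transformation_def norm_eq_zero[of "T _", symmetric] simp del: norm_eq_zero)
    have bd: "bounded (solid_cone A)"
      by (rule bounded_subset[of "ball 0 1"]) (auto simp: solid_cone_def)
    have "emeasure (distr \<mu> \<mu> T) A = 3 * emeasure lborel (T -` solid_cone A)"
      using A M by (simp add: emeasure_distr emeasure_surface measurable_sets solid_cone_eq del: space_surface)
    also have "\<dots> = 3 * emeasure lborel (solid_cone A)"
      using orthogonal_vimage_lborel[OF T solid_cone_sets[OF A] bd] by simp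
    finally show "emeasure (distr \<mu> \<mu> T) A = emeasure \<mu> A"
      using A by (simp add: emeasure_surface)
  qed simp
qed

lemma integral_surface_orthogonal:
  fixes f :: "real^3 \<Rightarrow> real"
  assumes "orthogonal_transformation (T :: real^3 \<Rightarrow> real^3)" "f \<in> borel_measurable \<mu>"
  shows "(LINT x|\<mu>. f (T x)) = (LINT x|\<mu>. f x)"
proof -
  have "(LINT x|\<mu>. f x) = (LINT x|distr \<mu> \<mu> T. f x)"
    using distr_surface_orthogonal[OF assms(1)] by simp
  also have "\<dots> = (LINT x|\<mu>. f (T x))"
    by (rule integral_distr[OF distr_surface_orthogonal(1)[OF assms(1)] assms(2)])
  finally show ?thesis by simp
qed

lemma continuous_measurable_surface:
  fixes f :: "real^3 \<Rightarrow> 'b::topological_space"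
  assumes "continuous_on (sphere 0 1) f"
  shows "f \<in> borel_measurable \<mu>"
  using borel_measurable_continuous_on_restrict[OF assms] by (simp add: measurable_surface_eq)

lemma surface_integrable:
  fixes f :: "real^3 \<Rightarrow> 'b::euclidean_space"
  assumes "continuous_on (sphere 0 1) f"
  shows "integrable \<mu> f"
proof -
  have "bounded (f ` sphere 0 1)"
    by (intro compact_imp_bounded compact_continuous_image assms compact_sphere)
  then obtain B where "\<And>x. x \<in> sphere 0 1 \<Longrightarrow> norm (f x) \<le> B"
    unfolding bounded_iff by (metis imageI)
  then show ?thesis
    by (intro surface.integrable_const_bound[where B=B] continuous_measurable_surface[OF assms]) auto
qed

section \<open>Differentiation under the integral; rotations\<close>

text \<open>Dominated convergence for difference quotients along sequences, the mean value
  inequality on the convex ball giving the dominating function. The general field serves both radial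
  derivatives (real) and holomorphy of line integrals (complex).\<close>

lemma has_field_derivative_integral:
  fixes f f' :: "'k::{real_normed_field,banach,second_countable_topology} \<Rightarrow> 'a \<Rightarrow> 'k"
  assumes e: "e > 0"
    and int: "\<And>t. t \<in> ball t0 e \<Longrightarrow> integrable M (f t)"
    and der: "\<And>t x. t \<in> ball t0 e \<Longrightarrow> x \<in> space M \<Longrightarrow>
      ((\<lambda>s. f s x) has_field_derivative f' t x) (at t)"
    and bound: "\<And>t x. t \<in> ball t0 e \<Longrightarrow> x \<in> space M \<Longrightarrow> norm (f' t x) \<le> G x"
    and G: "integrable M G"
    and meas: "f' t0 \<in> borel_measurable M"
  shows "((\<lambda>t. LINT x|M. f t x) has_field_derivative (LINT x|M. f' t0 x)) (at t0)"
  unfolding has_field_derivative_iff tendsto_at_iff_sequentially comp_def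
proof (intro allI impI)
  fix X :: "nat \<Rightarrow> 'k"
  assume X: "\<forall>i. X i \<in> UNIV - {t0}" "X \<longlonglongrightarrow> t0"
  have t0: "t0 \<in> ball t0 e" using e by simp
  have "\<forall>\<^sub>F i in sequentially. X i \<in> ball t0 e"
    using X(2) e by (metis (no_types) centre_in_ball open_ball tendsto_def)
  then obtain N where N: "\<And>i. i \<ge> N \<Longrightarrow> X i \<in> ball t0 e"
    by (auto simp: eventually_sequentially)
  define Z where "Z i = X (i + N)" for i
  have Z: "Z i \<in> ball t0 e" "Z i \<noteq> t0" for i
    using N[of "i + N"] X(1) by (auto simp: Z_def)
  have Zlim: "Z \<longlonglongrightarrow> t0"
    unfolding Z_def using X(2) by (rule LIMSEQ_ignore_initial_segment)
  have "(\<lambda>i. LINT x|M. (f (Z i) x - f t0 x) / (Z i - t0)) \<longlonglongrightarrow> (LINT x|M. f' t0 x)"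
  proof (rule integral_dominated_convergence[where w=G, OF meas _ G])
    show "(\<lambda>x. (f (Z i) x - f t0 x) / (Z i - t0)) \<in> borel_measurable M" for i
      using int[OF Z(1)] int[OF t0] by measurable
    show "AE x in M. (\<lambda>i. (f (Z i) x - f t0 x) / (Z i - t0)) \<longlonglongrightarrow> f' t0 x"
    proof (rule AE_I2)
      fix x assume x: "x \<in> space M"
      from der[OF t0 x] show "(\<lambda>i. (f (Z i) x - f t0 x) / (Z i - t0)) \<longlonglongrightarrow> f' t0 x"
        unfolding has_field_derivative_iff tendsto_at_iff_sequentially comp_def
        using Z Zlim by blast
    qed
    show "AE x in M. norm ((f (Z i) x - f t0 x) / (Z i - t0)) \<le> G x" for i
    proof (rule AE_I2)
      fix x assume x: "x \<in> space M"
      have "norm (f (Z i) x - f t0 x) \<le> G x * norm (Z i - t0)"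
        by (rule field_differentiable_bound[where S="ball t0 e" and f'="\<lambda>t. f' t x"])
          (use der bound x t0 Z in \<open>auto intro: has_field_derivative_at_within\<close>)
      then show "norm ((f (Z i) x - f t0 x) / (Z i - t0)) \<le> G x"
        using Z(2)[of i] by (simp add: norm_divide divide_simps)
    qed
  qed
  then have "(\<lambda>i. ((LINT x|M. f (Z i) x) - (LINT x|M. f t0 x)) / (Z i - t0)) \<longlonglongrightarrow> (LINT x|M. f' t0 x)"
    using int[OF Z(1)] int[OF t0] by simp
  then show "(\<lambda>i. ((LINT x|M. f (X i) x) - (LINT x|M. f t0 x)) / (X i - t0)) \<longlonglongrightarrow> (LINT x|M. f' t0 x)"
    unfolding Z_def by (rule LIMSEQ_offset)
qed

text \<open>The kernel \<open>f\<close> may be singular on the sphere outside \<open>K\<close>; the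
  density \<open>h\<close> vanishes there, so the bound of \<open>f\<close> on the compact set
  \<open>K\<close> suffices.\<close>

lemma surface_integrable_weighted:
  fixes h :: "real^3 \<Rightarrow> real" and f :: "real^3 \<Rightarrow> 'b::euclidean_space"
  assumes K: "compact K" "K \<subseteq> sphere 0 1"
    and h: "integrable \<mu> h" "\<And>x. x \<in> sphere 0 1 - K \<Longrightarrow> h x = 0"
    and f: "continuous_on K f"
  shows "integrable \<mu> (\<lambda>x. h x *\<^sub>R f x)"
proof -
  have "bounded (f ` K)"
    by (intro compact_imp_bounded compact_continuous_image f K)
  then obtain B where B: "\<And>x. x \<in> K \<Longrightarrow> norm (f x) \<le> B"
    unfolding bounded_iff by (metis imageI)
  have "(\<lambda>x. indicator K x *\<^sub>R f x) \<in> borel_measurable borel"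
    by (rule borel_measurable_continuous_on_indicator) (use K f in \<open>auto intro: borel_compact\<close>)
  then have m: "(\<lambda>x. indicator K x *\<^sub>R f x) \<in> borel_measurable \<mu>"
    unfolding measurable_surface_eq by (rule measurable_restrict_space1)
  have "integrable \<mu> (\<lambda>x. h x *\<^sub>R (indicator K x *\<^sub>R f x))"
  proof (rule lint_bound[where f="\<lambda>x. B * h x"])
    show "integrable \<mu> (\<lambda>x. B * h x)" using h by simp
    show "(\<lambda>x. h x *\<^sub>R (indicator K x *\<^sub>R f x)) \<in> borel_measurable \<mu>"
      using m h(1) by measurable
    show "AE x in \<mu>. norm (h x *\<^sub>R (indicator K x *\<^sub>R f x)) \<le> norm (B * h x)"
    proof (rule AE_I2)
      fix x
      have "norm (f x) \<le> \<bar>B\<bar>" if "x \<in> K" using B[OF that] by simp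
      then show "norm (h x *\<^sub>R (indicator K x *\<^sub>R f x)) \<le> norm (B * h x)"
        by (auto simp: indicator_def abs_mult mult.commute[of "\<bar>B\<bar>"] intro: mult_left_mono)
    qed
  qed
  then show ?thesis
    by (rule Bochner_Integration.integrable_cong[THEN iffD1, rotated 2]) (use h(2) in \<open>auto simp: indicator_def\<close>)
qed

text \<open>The derivative of the kernel is bounded on the compact set
  \<open>cball t0 e \<times> K\<close>. The weight \<open>h\<close> may be merely integrable, which
  admits potentials of square-integrable fields.\<close>

lemma surface_has_field_derivative:
  fixes f f' :: "'k::{real_normed_field,euclidean_space} \<Rightarrow> real^3 \<Rightarrow> 'k"
  assumes T: "open T" "t0 \<in> T" and K: "compact K" "K \<subseteq> sphere 0 1"
    and h: "integrable \<mu> h" "\<And>x. x \<in> sphere 0 1 - K \<Longrightarrow> h x = 0"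
    and der: "\<And>t x. t \<in> T \<Longrightarrow> x \<in> K \<Longrightarrow> ((\<lambda>s. f s x) has_field_derivative f' t x) (at t)"
    and f: "\<And>t. t \<in> T \<Longrightarrow> continuous_on K (f t)"
    and f': "continuous_on (T \<times> K) (\<lambda>(t, x). f' t x)"
  shows "((\<lambda>t. LINT x|\<mu>. h x *\<^sub>R f t x) has_field_derivative (LINT x|\<mu>. h x *\<^sub>R f' t0 x)) (at t0)"
proof -
  obtain e where e: "e > 0" "cball t0 e \<subseteq> T"
    using T open_contains_cball by blast
  have "bounded ((\<lambda>(t, x). f' t x) ` (cball t0 e \<times> K))"
    by (intro compact_imp_bounded compact_continuous_image compact_Times K compact_cball
        continuous_on_subset[OF f']) (use e in auto)
  then obtain B where B: "\<And>t x. t \<in> cball t0 e \<Longrightarrow> x \<in> K \<Longrightarrow> norm (f' t x) \<le> B"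
    unfolding bounded_iff by force
  show ?thesis
  proof (rule has_field_derivative_integral[where e=e and G="\<lambda>x. \<bar>h x\<bar> * B"])
    show "integrable \<mu> (\<lambda>x. h x *\<^sub>R f t x)" if "t \<in> ball t0 e" for t
      by (rule surface_integrable_weighted[OF K h f]) (use that e in auto)
    show "((\<lambda>s. h x *\<^sub>R f s x) has_field_derivative h x *\<^sub>R f' t x) (at t)"
      if "t \<in> ball t0 e" "x \<in> space \<mu>" for t x
    proof (cases "x \<in> K")
      case True
      then have "((\<lambda>s. f s x) has_field_derivative f' t x) (at t)"
        by (rule der[rotated]) (use that e in auto)
      from has_derivative_scaleR_right[OF this[unfolded has_field_derivative_def], of "h x"]
      have "((\<lambda>s. h x *\<^sub>R f s x) has_derivative (\<lambda>y. (h x *\<^sub>R f' t x) * y)) (at t)"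
        by simp
      then show ?thesis
        by (simp only: has_field_derivative_def)
    qed (use h that in auto)
    show "norm (h x *\<^sub>R f' t x) \<le> \<bar>h x\<bar> * B" if "t \<in> ball t0 e" "x \<in> space \<mu>" for t x
    proof (cases "x \<in> K")
      case True
      then show ?thesis using B[of t x] that by (auto intro!: mult_left_mono)
    qed (use h that in auto)
    have "continuous_on K (\<lambda>x. (\<lambda>(t, x). f' t x) (t0, x))"
      by (rule continuous_on_compose2[OF f']) (use T in \<open>auto intro!: continuous_intros\<close>)
    then have "continuous_on K (f' t0)" by simp
    then show "(\<lambda>x. h x *\<^sub>R f' t0 x) \<in> borel_measurable \<mu>"
      by (intro borel_measurable_integrable surface_integrable_weighted[OF K h])
  qed (use e h in auto)
qed

lemma surface_DERIV:
  fixes f f' :: "real \<Rightarrow> real^3 \<Rightarrow> real"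
  assumes T: "open T" "t0 \<in> T"
    and der: "\<And>t x. t \<in> T \<Longrightarrow> norm x = 1 \<Longrightarrow> ((\<lambda>s. f s x) has_real_derivative f' t x) (at t)"
    and f: "\<And>t. t \<in> T \<Longrightarrow> continuous_on (sphere 0 1) (f t)"
    and f': "continuous_on (T \<times> sphere 0 1) (\<lambda>(t, x). f' t x)"
  shows "((\<lambda>t. LINT x|\<mu>. f t x) has_real_derivative (LINT x|\<mu>. f' t0 x)) (at t0)"
  using surface_has_field_derivative[OF T compact_sphere order_refl, of "\<lambda>_. 1" f f'] der f f'
  by simp

section \<open>Gradients and derivatives along curves\<close>

lemma has_derivative_inner_vec:
  fixes f :: "real^3 \<Rightarrow> real"
  assumes "f differentiable (at x)"
  obtains D where "(f has_derivative (\<lambda>h. h \<bullet> D)) (at x)"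
proof -
  from assms obtain f' where f': "(f has_derivative f') (at x)"
    by (auto simp: differentiable_def)
  have "f' h = h \<bullet> (\<chi> i. f' (axis i 1))" for h
  proof -
    have lin: "linear f'" using f' by (rule has_derivative_linear)
    have "f' (\<Sum>i\<in>UNIV. h $ i *\<^sub>R axis i 1) = f' h"
      using basis_expansion[of h] by (simp only: scalar_mult_eq_scaleR)
    then have "f' h = f' (\<Sum>i\<in>UNIV. h $ i *\<^sub>R axis i 1)" by (rule sym)
    also have "\<dots> = (\<Sum>i\<in>UNIV. h $ i * f' (axis i 1))"
      by (simp add: linear_sum[OF lin] linear_scale[OF lin])
    finally show ?thesis by (simp add: inner_vec_def)
  qed
  then have "f' = (\<lambda>h. h \<bullet> (\<chi> i. f' (axis i 1)))" by (rule ext)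
  with f' that show ?thesis by metis
qed

lemma grad_eqI:
  assumes "(f has_derivative (\<lambda>h. h \<bullet> D)) (at x)"
  shows "grad f x = D"
  unfolding grad_def
proof (rule the_equality)
  show "GDERIV f x :> D" using assms by (simp add: gderiv_def)
  fix D' assume "GDERIV f x :> D'"
  then have "(\<lambda>h. h \<bullet> D') = (\<lambda>h. h \<bullet> D)"
    using has_derivative_unique[OF _ assms] by (simp add: gderiv_def)
  then have "h \<bullet> (D' - D) = 0" for h
    by (metis inner_diff_right right_minus_eq)
  then show "D' = D" by (metis inner_eq_zero_iff right_minus_eq)
qed

lemma has_derivative_grad:
  assumes "f differentiable (at x)"
  shows "(f has_derivative (\<lambda>h. h \<bullet> grad f x)) (at x)"
proof -
  obtain D where D: "(f has_derivative (\<lambda>h. h \<bullet> D)) (at x)"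
    using has_derivative_inner_vec[OF assms] .
  then show ?thesis
    using grad_eqI[OF D] by simp
qed

lemma DERIV_along_curve:
  assumes "(g has_vector_derivative v) (at t)" "f differentiable (at (g t))"
  shows "((\<lambda>t. f (g t)) has_real_derivative v \<bullet> grad f (g t)) (at t)"
proof -
  have "((\<lambda>t. f (g t)) has_derivative (\<lambda>h. (h *\<^sub>R v) \<bullet> grad f (g t))) (at t)"
    using has_derivative_compose[OF assms(1)[unfolded has_vector_derivative_def]
        has_derivative_grad[OF assms(2)]] .
  then have "((\<lambda>t. f (g t)) has_derivative (\<lambda>h. (v \<bullet> grad f (g t)) * h)) (at t)"
    by (simp add: mult.commute)
  then show ?thesis
    by (simp only: has_field_derivative_def)
qed

text \<open>One order of smoothness below \<open>Ck_on 2\<close>: the class in which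
  \<open>euler u\<close> and \<open>rot_deriv e u\<close> lie when \<open>u\<close> satisfies
  \<open>Ck_on 2\<close>.\<close>

definition C1_on :: "(real^3) set \<Rightarrow> (real^3 \<Rightarrow> real) \<Rightarrow> bool" where
  "C1_on S f \<longleftrightarrow> (\<forall>x\<in>S. f differentiable (at x)) \<and> continuous_on S (grad f)"

lemma C1_onD:
  assumes "C1_on S f"
  shows "x \<in> S \<Longrightarrow> f differentiable (at x)" "continuous_on S (grad f)" "continuous_on S f"
proof -
  have diff: "f differentiable (at x)" if "x \<in> S" for x
    using assms that by (simp add: C1_on_def)
  then show "x \<in> S \<Longrightarrow> f differentiable (at x)" .
  show "continuous_on S (grad f)"
    using assms by (simp add: C1_on_def)
  show "continuous_on S f"
    by (intro continuous_at_imp_continuous_on ballI differentiable_imp_continuous_within diff)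
qed

lemma continuous_on_vec_componentwise:
  fixes f :: "'a::topological_space \<Rightarrow> real^3"
  assumes "\<And>i. continuous_on S (\<lambda>x. f x $ i)"
  shows "continuous_on S f"
  using continuous_on_vec_lambda[of S "\<lambda>i x. f x $ i"] assms by simp

text \<open>Rodrigues' formula for the rotation by \<theta> about a unit axis
  \<open>e\<close>.\<close>

definition rotation :: "real^3 \<Rightarrow> real \<Rightarrow> real^3 \<Rightarrow> real^3" where
  "rotation e \<theta> x = cos \<theta> *\<^sub>R x + sin \<theta> *\<^sub>R cross3 e x + ((1 - cos \<theta>) * (e \<bullet> x)) *\<^sub>R e"

lemma orthogonal_transformation_rotation:
  assumes e: "norm e = 1"
  shows "orthogonal_transformation (rotation e \<theta>)"
  unfolding orthogonal_transformation
proof (intro conjI allI)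
  show "linear (rotation e \<theta>)"
    by (rule linearI)
      (simp_all add: rotation_def cross_add_right cross_mult_right inner_add_right distrib_left
        scaleR_add_right scaleR_add_left mult.left_commute mult.commute)
  fix x
  have ee: "e \<bullet> e = 1" using e by (simp add: dot_square_norm)
  have cr: "cross3 e x \<bullet> cross3 e x = x \<bullet> x - (e \<bullet> x)\<^sup>2"
    using norm_cross[of e x] e by (simp add: power2_norm_eq_inner)
  have orth: "x \<bullet> cross3 e x = 0" "cross3 e x \<bullet> x = 0" "e \<bullet> cross3 e x = 0" "cross3 e x \<bullet> e = 0"
    by (simp_all add: dot_cross_self)
  have "rotation e \<theta> x \<bullet> rotation e \<theta> x = (cos \<theta>)\<^sup>2 * (x \<bullet> x) + (sin \<theta>)\<^sup>2 * (cross3 e x \<bullet> cross3 e x)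
     + (1 - cos \<theta>)\<^sup>2 * (e \<bullet> x)\<^sup>2 + 2 * cos \<theta> * (1 - cos \<theta>) * (e \<bullet> x)\<^sup>2"
    unfolding rotation_def inner_add_left inner_add_right inner_scaleR_left inner_scaleR_right orth ee
      inner_commute[of x e] by algebra
  also have "\<dots> = ((sin \<theta>)\<^sup>2 + (cos \<theta>)\<^sup>2) * (x \<bullet> x) + (1 - ((sin \<theta>)\<^sup>2 + (cos \<theta>)\<^sup>2)) * (e \<bullet> x)\<^sup>2"
    unfolding cr by (simp only: power2_eq_square) algebra
  also have "\<dots> = x \<bullet> x" by simp
  finally show "norm (rotation e \<theta> x) = norm x" by (simp add: norm_eq_sqrt_inner)
qed

lemma has_vector_derivative_rotation:
  "((\<lambda>\<theta>. rotation e \<theta> x) has_vector_derivative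
     (- sin \<theta>) *\<^sub>R x + cos \<theta> *\<^sub>R cross3 e x + (sin \<theta> * (e \<bullet> x)) *\<^sub>R e) (at \<theta>)"
proof -
  have "((\<lambda>\<theta>. cos \<theta> *\<^sub>R x) has_vector_derivative (- sin \<theta>) *\<^sub>R x) (at \<theta>)"
    "((\<lambda>\<theta>. sin \<theta> *\<^sub>R cross3 e x) has_vector_derivative cos \<theta> *\<^sub>R cross3 e x) (at \<theta>)"
    "((\<lambda>\<theta>. ((1 - cos \<theta>) * (e \<bullet> x)) *\<^sub>R e) has_vector_derivative (sin \<theta> * (e \<bullet> x)) *\<^sub>R e) (at \<theta>)"
    by (auto intro!: has_vector_derivative_scaleR[THEN has_vector_derivative_eq_rhs] derivative_eq_intros)
  then show ?thesis
    unfolding rotation_def by (intro has_vector_derivative_add)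
qed

declare continuous_on_cross [continuous_intros]

text \<open>The integral of \<open>f\<close> over the rotated sphere does not depend on the angle,
  so its derivative at angle \<open>0\<close> vanishes. Since \<open>cross3 e x\<close> is a
  divergence-free tangent field, this takes the place of the divergence theorem on the
  sphere.\<close>

lemma integral_rotation_field:
  assumes e: "norm e = 1" and W: "open W" "sphere 0 1 \<subseteq> W" and f: "C1_on W f"
  shows "(LINT x|\<mu>. cross3 e x \<bullet> grad f x) = 0"
proof -
  let ?R' = "\<lambda>\<theta> x. (- sin \<theta>) *\<^sub>R x + cos \<theta> *\<^sub>R cross3 e x + (sin \<theta> * (e \<bullet> x)) *\<^sub>R e"
  have inW: "rotation e \<theta> x \<in> W" if "norm x = 1" for \<theta> x
    using orthogonal_transformation_norm[OF orthogonal_transformation_rotation[OF e]] W that by auto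
  have "((\<lambda>\<theta>. LINT x|\<mu>. f (rotation e \<theta> x)) has_real_derivative
     (LINT x|\<mu>. ?R' 0 x \<bullet> grad f (rotation e 0 x))) (at 0)"
  proof (rule surface_DERIV[where T=UNIV])
    show "((\<lambda>s. f (rotation e s x)) has_real_derivative ?R' t x \<bullet> grad f (rotation e t x)) (at t)"
      if "norm x = 1" for t x
      by (rule DERIV_along_curve[OF has_vector_derivative_rotation C1_onD(1)[OF f inW[OF that]]])
    show "continuous_on (sphere 0 1) (\<lambda>x. f (rotation e t x))" for t
    proof (rule continuous_on_compose2[OF C1_onD(3)[OF f]])
      show "continuous_on (sphere 0 1) (rotation e t)"
        unfolding rotation_def by (intro continuous_intros)
    qed (use inW in auto)
    have "continuous_on (UNIV \<times> sphere 0 1) (\<lambda>z. grad f (rotation e (fst z) (snd z)))"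
    proof (rule continuous_on_compose2[OF C1_onD(2)[OF f]])
      show "continuous_on (UNIV \<times> sphere 0 1) (\<lambda>z. rotation e (fst z) (snd z))"
        unfolding rotation_def by (intro continuous_intros)
    qed (use inW in auto)
    then show "continuous_on (UNIV \<times> sphere 0 1) (\<lambda>(t, x). ?R' t x \<bullet> grad f (rotation e t x))"
      unfolding case_prod_beta by (intro continuous_intros)
  qed simp_all
  moreover have "(LINT x|\<mu>. f (rotation e \<theta> x)) = (LINT x|\<mu>. f x)" for \<theta>
    by (rule integral_surface_orthogonal[OF orthogonal_transformation_rotation[OF e]])
      (rule continuous_measurable_surface, rule continuous_on_subset[OF C1_onD(3)[OF f] W(2)])
  ultimately have "((\<lambda>\<theta>. LINT x|\<mu>. f x) has_real_derivative
     (LINT x|\<mu>. cross3 e x \<bullet> grad f x)) (at 0)"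
    by (simp add: rotation_def)
  then show ?thesis
    by (rule DERIV_unique[OF _ DERIV_const])
qed

section \<open>Integration by parts on the sphere\<close>

definition euler :: "(real^3 \<Rightarrow> real) \<Rightarrow> real^3 \<Rightarrow> real" where
  "euler f z = z \<bullet> grad f z"

text \<open>The derivative along rotations about \<open>e\<close>, that is, a component of the
  angular momentum operator up to a constant.\<close>

definition rot_deriv :: "real^3 \<Rightarrow> (real^3 \<Rightarrow> real) \<Rightarrow> real^3 \<Rightarrow> real" where
  "rot_deriv e f z = cross3 e z \<bullet> grad f z"

definition hess :: "(real^3 \<Rightarrow> real) \<Rightarrow> real^3 \<Rightarrow> 3 \<Rightarrow> real^3" where
  "hess f z i = grad (\<lambda>y. grad f y $ i) z"

lemma C2_onD:
  assumes "Ck_on 2 S f"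
  shows "x \<in> S \<Longrightarrow> f differentiable (at x)"
    and "x \<in> S \<Longrightarrow> (\<lambda>y. grad f y $ i) differentiable (at x)"
    and "continuous_on S (\<lambda>x. hess f x i)"
  using assms by (auto simp: eval_nat_numeral hess_def intro!: continuous_on_vec_componentwise)

lemma C2_imp_C1:
  assumes "Ck_on 2 S f"
  shows "C1_on S f"
  unfolding C1_on_def
proof (intro conjI ballI)
  show "continuous_on S (grad f)"
    by (intro continuous_on_vec_componentwise continuous_at_imp_continuous_on ballI
        differentiable_imp_continuous_within C2_onD(2)[OF assms])
qed (rule C2_onD(1)[OF assms])

lemma C1_onI:
  assumes "\<And>x. x \<in> S \<Longrightarrow> (f has_derivative (\<lambda>h. h \<bullet> F x)) (at x)" "continuous_on S F"
  shows "C1_on S f"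
  unfolding C1_on_def
proof (intro conjI ballI)
  show "f differentiable (at x)" if "x \<in> S" for x
    using assms(1)[OF that] by (auto simp: differentiable_def)
  show "continuous_on S (grad f)"
    using continuous_on_eq[OF assms(2)] grad_eqI[OF assms(1)] by simp
qed

text \<open>Common source of the derivatives of \<open>euler\<close> (\<open>A\<close> the identity)
  and of \<open>rot_deriv e\<close> (\<open>A = cross3 e\<close>).\<close>

lemma has_derivative_linear_inner_grad:
  assumes f: "Ck_on 2 S f" and z: "z \<in> S" and A: "bounded_linear (A :: real^3 \<Rightarrow> real^3)"
  shows "((\<lambda>z. A z \<bullet> grad f z) has_derivative
    (\<lambda>h. A h \<bullet> grad f z + h \<bullet> (\<Sum>i\<in>UNIV. (A z $ i) *\<^sub>R hess f z i))) (at z)"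
proof -
  have 1: "((\<lambda>z. A z $ i) has_derivative (\<lambda>h. A h $ i)) (at z)" for i
    by (rule bounded_linear_imp_has_derivative)
      (rule bounded_linear_compose[OF bounded_linear_vec_nth A])
  have 2: "((\<lambda>z. grad f z $ i) has_derivative (\<lambda>h. h \<bullet> hess f z i)) (at z)" for i
    unfolding hess_def by (rule has_derivative_grad[OF C2_onD(2)[OF f z]])
  have "((\<lambda>z. \<Sum>i\<in>UNIV. A z $ i * grad f z $ i) has_derivative
    (\<lambda>h. \<Sum>i\<in>UNIV. A z $ i * (h \<bullet> hess f z i) + A h $ i * grad f z $ i)) (at z)"
    by (intro has_derivative_sum has_derivative_mult 1 2)
  moreover have "(\<Sum>i\<in>UNIV. A z $ i * (h \<bullet> hess f z i) + A h $ i * grad f z $ i)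
      = A h \<bullet> grad f z + h \<bullet> (\<Sum>i\<in>UNIV. (A z $ i) *\<^sub>R hess f z i)" for h
    by (simp add: sum.distrib inner_sum_right inner_vec_def[of "A h"])
  ultimately show ?thesis
    by (simp add: inner_vec_def[of "A _"])
qed

lemma bounded_linear_cross3: "bounded_linear (cross3 e)"
  by (rule linear_conv_bounded_linear[THEN iffD1]) (rule linearI, simp_all add: cross_add_right cross_mult_right)

lemma euler_has_derivative:
  assumes f: "Ck_on 2 S f" and z: "z \<in> S"
  shows "(euler f has_derivative
    (\<lambda>h. h \<bullet> (grad f z + (\<Sum>i\<in>UNIV. (z $ i) *\<^sub>R hess f z i)))) (at z)"
  using has_derivative_linear_inner_grad[OF f z bounded_linear_ident]
  by (simp add: euler_def[abs_def] inner_add_right)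

lemma rot_deriv_has_derivative:
  assumes f: "Ck_on 2 S f" and z: "z \<in> S"
  shows "(rot_deriv e f has_derivative
    (\<lambda>h. h \<bullet> (cross3 (grad f z) e + (\<Sum>i\<in>UNIV. (cross3 e z $ i) *\<^sub>R hess f z i)))) (at z)"
proof -
  have "cross3 e h \<bullet> g = h \<bullet> cross3 g e" for g h
    by (simp add: cross3_simps)
  then have "(\<lambda>h. cross3 e h \<bullet> grad f z + h \<bullet> v) = (\<lambda>h. h \<bullet> (cross3 (grad f z) e + v))" for v
    by (simp add: fun_eq_iff inner_add_right)
  then show ?thesis
    using has_derivative_linear_inner_grad[OF f z bounded_linear_cross3, of e]
    by (simp only: rot_deriv_def[abs_def])
qed

lemma C1_euler:
  assumes f: "Ck_on 2 S f"
  shows "C1_on S (euler f)"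
  by (rule C1_onI, rule euler_has_derivative[OF f])
    (intro continuous_intros C1_onD(2)[OF C2_imp_C1[OF f]] C2_onD(3)[OF f] | assumption)+

lemma C1_rot_deriv:
  assumes f: "Ck_on 2 S f"
  shows "C1_on S (rot_deriv e f)"
  by (rule C1_onI, rule rot_deriv_has_derivative[OF f])
    (intro continuous_intros C1_onD(2)[OF C2_imp_C1[OF f]] C2_onD(3)[OF f] | assumption)+

lemma continuous_euler: "C1_on S f \<Longrightarrow> continuous_on S (euler f)"
  unfolding euler_def by (intro continuous_intros C1_onD)

lemma continuous_rot_deriv: "C1_on S f \<Longrightarrow> continuous_on S (rot_deriv e f)"
  unfolding rot_deriv_def by (intro continuous_intros C1_onD)

lemma axis3_components:
  "axis 1 (1::real) = (vector [1, 0, 0] :: real^3)"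
  "axis 2 (1::real) = (vector [0, 1, 0] :: real^3)"
  "axis 3 (1::real) = (vector [0, 0, 1] :: real^3)"
  by (simp_all add: vec_eq_iff axis_def forall_3)

text \<open>On the unit sphere the right-hand side is the inner product of the tangential parts of
  \<open>v\<close> and \<open>w\<close>: the three rotation fields form a tight frame of every
  tangent plane.\<close>

lemma sum_cross_axis_inner:
  "(\<Sum>k\<in>UNIV. (cross3 (axis k 1) z \<bullet> v) * (cross3 (axis k 1) z \<bullet> w)) = (z \<bullet> z) * (v \<bullet> w) - (z \<bullet> v) * (z \<bullet> w)"
  unfolding sum_3 axis3_components by (simp add: cross3_simps)

text \<open>The second-order coefficients sum to
  \<open>|z|\<^sup>2 \<delta>\<^sub>i\<^sub>j - z\<^sub>i z\<^sub>j\<close>. Differentiating the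
  coefficients \<open>e\<^sub>k \<times> z\<close> adds \<open>- 2 E\<close>, and \<open>z\<^sub>i
  z\<^sub>j \<partial>\<^sub>i \<partial>\<^sub>j = E\<^sup>2 - E\<close>. For harmonic
  \<open>f\<close> only \<open>- (E\<^sup>2 + E)\<close> remains.\<close>

lemma sum_rot_deriv_rot_deriv:
  assumes f: "Ck_on 2 S f" and z: "z \<in> S"
  shows "(\<Sum>k\<in>UNIV. rot_deriv (axis k 1) (rot_deriv (axis k 1) f) z)
    = (z \<bullet> z) * laplacian f z - euler (euler f) z - euler f z"
proof -
  define g H where "g = grad f z" and "H = hess f z"
  have gr: "grad (rot_deriv e f) z = cross3 g e + (\<Sum>i\<in>UNIV. (cross3 e z $ i) *\<^sub>R H i)" for e
    unfolding g_def H_def by (rule grad_eqI[OF rot_deriv_has_derivative[OF f z]])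
  have ge: "grad (euler f) z = g + (\<Sum>i\<in>UNIV. (z $ i) *\<^sub>R H i)"
    unfolding g_def H_def by (rule grad_eqI[OF euler_has_derivative[OF f z]])
  have lap: "laplacian f z = (\<Sum>i\<in>UNIV. H i $ i)"
    by (simp add: laplacian_def H_def hess_def)
  show ?thesis
    unfolding rot_deriv_def[of _ "rot_deriv _ f"] euler_def[of "euler f"] gr ge lap euler_def[of f] g_def[symmetric]
    unfolding sum_3 axis3_components by (simp add: cross3_simps)
qed

lemma sphere_scaled:
  assumes "continuous_on A F" "\<And>x. norm x = 1 \<Longrightarrow> s *\<^sub>R x \<in> A"
  shows "continuous_on (sphere 0 1) (\<lambda>x. F (s *\<^sub>R x))"
  by (rule continuous_on_compose2[OF assms(1)]) (use assms(2) in \<open>auto intro!: continuous_intros\<close>)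

text \<open>Rotations commute with dilations, so each factor can live on a sphere of its own radius;
  the product of the two dilated functions is fed to \<open>integral_rotation_field\<close>. The
  independent radii are what the radial arguments below vary.\<close>

lemma rot_deriv_by_parts:
  assumes e: "norm e = 1" and A: "open A" "\<And>x. norm x = 1 \<Longrightarrow> s *\<^sub>R x \<in> A" "C1_on A a"
    and C: "open C" "\<And>x. norm x = 1 \<Longrightarrow> t *\<^sub>R x \<in> C" "C1_on C c"
  shows "(LINT x|\<mu>. rot_deriv e a (s *\<^sub>R x) * c (t *\<^sub>R x))
    = - (LINT x|\<mu>. a (s *\<^sub>R x) * rot_deriv e c (t *\<^sub>R x))"
proof -
  define W where "W = (\<lambda>x. s *\<^sub>R x) -` A \<inter> (\<lambda>x. t *\<^sub>R x) -` C"
  have W: "open W"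
    unfolding W_def by (intro open_Int open_vimage A C continuous_intros)
  have SW: "sphere 0 1 \<subseteq> W"
    using A C by (auto simp: W_def)
  let ?F = "\<lambda>x. (c (t *\<^sub>R x) * s) *\<^sub>R grad a (s *\<^sub>R x) + (a (s *\<^sub>R x) * t) *\<^sub>R grad c (t *\<^sub>R x)"
  have sc: "((\<lambda>x. g (r *\<^sub>R x)) has_derivative (\<lambda>h. h \<bullet> (r *\<^sub>R grad g (r *\<^sub>R x)))) (at x)"
    if "g differentiable (at (r *\<^sub>R x))" for g r x
    using has_derivative_compose[OF has_derivative_scaleR_right[OF has_derivative_ident, of r]
        has_derivative_grad[OF that]] by simp
  have der: "((\<lambda>x. a (s *\<^sub>R x) * c (t *\<^sub>R x)) has_derivative (\<lambda>h. h \<bullet> ?F x)) (at x)" if "x \<in> W" for x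
  proof -
    have "s *\<^sub>R x \<in> A" "t *\<^sub>R x \<in> C" using that by (auto simp: W_def)
    then show ?thesis
      using has_derivative_mult[OF sc sc] C1_onD(1)[OF A(3)] C1_onD(1)[OF C(3)]
      by (fastforce simp: inner_add_right algebra_simps)
  qed
  have contW: "continuous_on W (\<lambda>x. s *\<^sub>R x)" "continuous_on W (\<lambda>x. t *\<^sub>R x)"
    "(\<lambda>x. s *\<^sub>R x) ` W \<subseteq> A" "(\<lambda>x. t *\<^sub>R x) ` W \<subseteq> C"
    by (auto intro!: continuous_intros simp: W_def)
  have C1: "C1_on W (\<lambda>x. a (s *\<^sub>R x) * c (t *\<^sub>R x))"
    by (rule C1_onI, rule der, assumption)
      (intro continuous_intros continuous_on_compose2[OF C1_onD(2)[OF A(3)] contW(1,3)]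
        continuous_on_compose2[OF C1_onD(3)[OF A(3)] contW(1,3)]
        continuous_on_compose2[OF C1_onD(2)[OF C(3)] contW(2,4)]
        continuous_on_compose2[OF C1_onD(3)[OF C(3)] contW(2,4)])
  have eq: "cross3 e x \<bullet> grad (\<lambda>x. a (s *\<^sub>R x) * c (t *\<^sub>R x)) x
      = rot_deriv e a (s *\<^sub>R x) * c (t *\<^sub>R x) + a (s *\<^sub>R x) * rot_deriv e c (t *\<^sub>R x)" if "norm x = 1" for x
    using grad_eqI[OF der, of x] SW that
    by (auto simp: rot_deriv_def cross_mult_right inner_add_right)
  note cont = sphere_scaled[OF continuous_rot_deriv[OF A(3)] A(2)] sphere_scaled[OF C1_onD(3)[OF A(3)] A(2)]
    sphere_scaled[OF continuous_rot_deriv[OF C(3)] C(2)] sphere_scaled[OF C1_onD(3)[OF C(3)] C(2)]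
  have i: "integrable \<mu> (\<lambda>x. rot_deriv e a (s *\<^sub>R x) * c (t *\<^sub>R x))"
    by (rule surface_integrable[OF continuous_on_mult[OF cont(1) cont(4)]])
  have i': "integrable \<mu> (\<lambda>x. a (s *\<^sub>R x) * rot_deriv e c (t *\<^sub>R x))"
    by (rule surface_integrable[OF continuous_on_mult[OF cont(2) cont(3)]])
  have "0 = (LINT x|\<mu>. rot_deriv e a (s *\<^sub>R x) * c (t *\<^sub>R x) + a (s *\<^sub>R x) * rot_deriv e c (t *\<^sub>R x))"
    unfolding integral_rotation_field[OF e W SW C1, symmetric]
    by (rule lint_cong) (simp_all add: eq)
  then show ?thesis
    using i i' by simp
qed

text \<open>On harmonic functions \<open>- (E\<^sup>2 + E)\<close> is a sum of squares of rotational
  derivatives, and each square changes sides by two integrations by parts.\<close>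

lemma laplace_beltrami_selfadjoint:
  assumes A: "open A" "\<And>x. norm x = 1 \<Longrightarrow> s *\<^sub>R x \<in> A" "harmonic_on A a"
    and C: "open C" "\<And>x. norm x = 1 \<Longrightarrow> t *\<^sub>R x \<in> C" "harmonic_on C c"
  shows "(LINT x|\<mu>. (euler (euler a) (s *\<^sub>R x) + euler a (s *\<^sub>R x)) * c (t *\<^sub>R x))
    = (LINT x|\<mu>. a (s *\<^sub>R x) * (euler (euler c) (t *\<^sub>R x) + euler c (t *\<^sub>R x)))"
proof -
  have a: "Ck_on 2 A a" "\<And>x. x \<in> A \<Longrightarrow> laplacian a x = 0" and c: "Ck_on 2 C c" "\<And>x. x \<in> C \<Longrightarrow> laplacian c x = 0"
    using A C by (auto simp: harmonic_on_def)
  note [simp] = C1_rot_deriv[OF a(1)] C1_rot_deriv[OF c(1)] C2_imp_C1[OF a(1)] C2_imp_C1[OF c(1)]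
  have part: "(LINT x|\<mu>. rot_deriv e (rot_deriv e a) (s *\<^sub>R x) * c (t *\<^sub>R x))
      = (LINT x|\<mu>. a (s *\<^sub>R x) * rot_deriv e (rot_deriv e c) (t *\<^sub>R x))" if "norm e = 1" for e
    using rot_deriv_by_parts[OF that A(1,2) _ C(1,2), of "rot_deriv e a" c]
      rot_deriv_by_parts[OF that A(1,2) _ C(1,2), of a "rot_deriv e c"] by simp
  have i: "integrable \<mu> (\<lambda>x. rot_deriv e (rot_deriv e a) (s *\<^sub>R x) * c (t *\<^sub>R x))"
    "integrable \<mu> (\<lambda>x. a (s *\<^sub>R x) * rot_deriv e (rot_deriv e c) (t *\<^sub>R x))" for e
    by (intro surface_integrable continuous_intros sphere_scaled[OF _ A(2)]
        sphere_scaled[OF _ C(2)] continuous_rot_deriv C1_onD(3); simp)+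
  have "(LINT x|\<mu>. (euler (euler a) (s *\<^sub>R x) + euler a (s *\<^sub>R x)) * c (t *\<^sub>R x))
      = (LINT x|\<mu>. - (\<Sum>k\<in>UNIV. rot_deriv (axis k 1) (rot_deriv (axis k 1) a) (s *\<^sub>R x) * c (t *\<^sub>R x)))"
    by (rule lint_cong)
      (simp_all add: sum_distrib_right[symmetric] sum_rot_deriv_rot_deriv[OF a(1) A(2)] a(2)[OF A(2)],
        simp_all add: algebra_simps)
  also have "\<dots> = - (\<Sum>k\<in>UNIV. (LINT x|\<mu>. rot_deriv (axis k 1) (rot_deriv (axis k 1) a) (s *\<^sub>R x) * c (t *\<^sub>R x)))"
    using i by (simp add: lint_sum)
  also have "\<dots> = - (\<Sum>k\<in>UNIV. (LINT x|\<mu>. a (s *\<^sub>R x) * rot_deriv (axis k 1) (rot_deriv (axis k 1) c) (t *\<^sub>R x)))"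
    by (simp add: part)
  also have "\<dots> = (LINT x|\<mu>. - (\<Sum>k\<in>UNIV. a (s *\<^sub>R x) * rot_deriv (axis k 1) (rot_deriv (axis k 1) c) (t *\<^sub>R x)))"
    using i by (simp add: lint_sum)
  also have "\<dots> = (LINT x|\<mu>. a (s *\<^sub>R x) * (euler (euler c) (t *\<^sub>R x) + euler c (t *\<^sub>R x)))"
    by (rule lint_cong)
      (simp_all add: sum_distrib_left[symmetric] sum_rot_deriv_rot_deriv[OF c(1) C(2)] c(2)[OF C(2)],
        simp_all add: algebra_simps)
  finally show ?thesis .
qed

text \<open>Green's identity on the sphere: \<open>euler a * euler c\<close> is the normal part of
  the inner product, and the tangential part is integrated by parts once, leaving \<open>c\<close>
  undifferentiated.\<close>

lemma integral_grad_inner_grad: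
  assumes A: "open A" "sphere 0 1 \<subseteq> A" "harmonic_on A a"
    and C: "open C" "sphere 0 1 \<subseteq> C" "C1_on C c"
  shows "(LINT x|\<mu>. grad a x \<bullet> grad c x)
    = (LINT x|\<mu>. euler a x * euler c x + (euler (euler a) x + euler a x) * c x)"
proof -
  have a: "Ck_on 2 A a" "\<And>x. norm x = 1 \<Longrightarrow> laplacian a x = 0"
    using A by (auto simp: harmonic_on_def)
  have AS: "\<And>x. norm x = 1 \<Longrightarrow> 1 *\<^sub>R x \<in> A" and CS: "\<And>x. norm x = 1 \<Longrightarrow> 1 *\<^sub>R x \<in> C"
    using A(2) C(2) by auto
  have part: "(LINT x|\<mu>. rot_deriv e (rot_deriv e a) x * c x)
      = - (LINT x|\<mu>. rot_deriv e a x * rot_deriv e c x)" if "norm e = 1" for e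
    using rot_deriv_by_parts[OF that A(1) AS C1_rot_deriv[OF a(1)] C(1) CS C(3), of e] by simp
  have S: "continuous_on (sphere 0 1) F" if "continuous_on A F \<or> continuous_on C F" for F :: "real^3 \<Rightarrow> 'b::topological_space"
    using that continuous_on_subset A(2) C(2) by blast
  have i: "integrable \<mu> (\<lambda>x. rot_deriv e (rot_deriv e a) x * c x)"
    "integrable \<mu> (\<lambda>x. rot_deriv e a x * rot_deriv e c x)" for e
    by (intro surface_integrable continuous_on_mult S;
        simp add: continuous_rot_deriv C1_onD(3)[OF C(3)] C(3) C1_rot_deriv[OF a(1)] C2_imp_C1[OF a(1)])+
  have i': "integrable \<mu> (\<lambda>x. grad a x \<bullet> grad c x)" "integrable \<mu> (\<lambda>x. euler a x * euler c x)"
    by (intro surface_integrable continuous_intros S;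
        simp add: continuous_euler C1_onD(2)[OF C(3)] C(3) C1_onD(2) C2_imp_C1[OF a(1)])+
  have "(LINT x|\<mu>. grad a x \<bullet> grad c x - euler a x * euler c x)
      = (LINT x|\<mu>. (\<Sum>k\<in>UNIV. rot_deriv (axis k 1) a x * rot_deriv (axis k 1) c x))"
    by (rule lint_cong)
      (simp_all add: rot_deriv_def sum_cross_axis_inner euler_def dot_square_norm)
  also have "\<dots> = (\<Sum>k\<in>UNIV. (LINT x|\<mu>. rot_deriv (axis k 1) a x * rot_deriv (axis k 1) c x))"
    using i by (simp add: lint_sum)
  also have "\<dots> = - (\<Sum>k\<in>UNIV. (LINT x|\<mu>. rot_deriv (axis k 1) (rot_deriv (axis k 1) a) x * c x))"
    by (simp add: part sum_negf)
  also have "\<dots> = (LINT x|\<mu>. - (\<Sum>k\<in>UNIV. rot_deriv (axis k 1) (rot_deriv (axis k 1) a) x * c x))"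
    using i by (simp add: lint_sum)
  also have "\<dots> = (LINT x|\<mu>. (euler (euler a) x + euler a x) * c x)"
    by (rule lint_cong)
      (simp_all add: sum_distrib_right[symmetric] sum_rot_deriv_rot_deriv[OF a(1) AS[unfolded scaleR_one]] a(2),
        simp_all add: algebra_simps)
  finally have *: "(LINT x|\<mu>. grad a x \<bullet> grad c x - euler a x * euler c x)
      = (LINT x|\<mu>. (euler (euler a) x + euler a x) * c x)" .
  have "integrable \<mu> (\<lambda>x. (euler (euler a) x + euler a x) * c x)"
    by (intro surface_integrable continuous_on_mult continuous_on_add S;
        simp add: continuous_euler C1_onD(3)[OF C(3)] C1_euler[OF a(1)] C2_imp_C1[OF a(1)])
  then show ?thesis
    using * i' by simp
qed

section \<open>Pairings of harmonic functions\<close>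

lemma surface_integral_bound:
  fixes f :: "real^3 \<Rightarrow> real"
  assumes "\<And>x. norm x = 1 \<Longrightarrow> \<bar>f x\<bar> \<le> B"
  shows "\<bar>LINT x|\<mu>. f x\<bar> \<le> B * area"
proof (cases "integrable \<mu> f")
  case True
  have "\<bar>LINT x|\<mu>. f x\<bar> \<le> (LINT x|\<mu>. \<bar>f x\<bar>)"
    by (rule integral_abs_bound)
  also have "\<dots> \<le> (LINT x|\<mu>. B)"
    by (rule integral_mono) (use True assms in auto)
  also have "\<dots> = B * area"
    by (simp add: area_def)
  finally show ?thesis .
next
  case False
  \<comment> \<open>The integral is \<open>0\<close> by convention in this case; the sign of
    \<open>B\<close> is read off at one unit vector.\<close>
  have "0 \<le> B"
    using order_trans[OF abs_ge_zero assms[of "axis 1 1"]] by simp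
  then show ?thesis
    using False area_pos by (simp add: not_integrable_integral_eq)
qed

lemma harmonic_on_subset: "harmonic_on S u \<Longrightarrow> T \<subseteq> S \<Longrightarrow> harmonic_on T u"
  by (simp add: harmonic_on_def eval_nat_numeral) (meson continuous_on_subset subsetD)

lemma harmonic_onD:
  assumes "harmonic_on S u"
  shows "Ck_on 2 S u" "C1_on S u" "C1_on S (euler u)"
  using assms by (auto simp: harmonic_on_def C2_imp_C1 C1_euler)

lemma DERIV_dilation:
  assumes "f differentiable (at (g l *\<^sub>R x))" "(g has_real_derivative g') (at l)" "g l \<noteq> 0"
  shows "((\<lambda>l. f (g l *\<^sub>R x)) has_real_derivative euler f (g l *\<^sub>R x) * (g' / g l)) (at l)"
proof -
  have "((\<lambda>l. g l *\<^sub>R x) has_vector_derivative g' *\<^sub>R x) (at l)"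
    using has_vector_derivative_scaleR[OF assms(2) has_vector_derivative_const[of x]] by simp
  from DERIV_along_curve[OF this assms(1)] show ?thesis
    using assms(3) by (simp add: euler_def field_simps)
qed

lemma pairing_DERIV:
  assumes a: "C1_on (ball 0 R) a" and s: "0 < s" "s < R" and w: "continuous_on (sphere 0 1) w"
  shows "((\<lambda>s. LINT x|\<mu>. a (s *\<^sub>R x) * w x) has_real_derivative
    (LINT x|\<mu>. euler a (s *\<^sub>R x) * w x) / s) (at s)"
proof -
  have "((\<lambda>s. LINT x|\<mu>. a (s *\<^sub>R x) * w x) has_real_derivative
    (LINT x|\<mu>. euler a (s *\<^sub>R x) * w x / s)) (at s)"
  proof (rule surface_DERIV[where T="{0<..<R}"])
    show "((\<lambda>s. a (s *\<^sub>R x) * w x) has_real_derivative euler a (t *\<^sub>R x) * w x / t) (at t)"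
      if "t \<in> {0<..<R}" "norm x = 1" for t x
      using DERIV_cmult_right[OF DERIV_dilation[OF C1_onD(1)[OF a] DERIV_ident], of t x "w x"] that
      by simp
    show "continuous_on (sphere 0 1) (\<lambda>x. a (t *\<^sub>R x) * w x)" if "t \<in> {0<..<R}" for t
      using that by (intro continuous_on_mult w sphere_scaled[OF C1_onD(3)[OF a]]) auto
    have "continuous_on ({0<..<R} \<times> sphere 0 1) (\<lambda>z. euler a (fst z *\<^sub>R snd z))"
      by (rule continuous_on_compose2[OF continuous_euler[OF a]]) (auto intro!: continuous_intros)
    moreover have "continuous_on ({0<..<R} \<times> sphere 0 1) (\<lambda>z. w (snd z))"
      by (rule continuous_on_compose2[OF w]) (auto intro!: continuous_intros)
    ultimately show "continuous_on ({0<..<R} \<times> sphere 0 1) (\<lambda>(t, x). euler a (t *\<^sub>R x) * w x / t)"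
      unfolding case_prod_beta by (intro continuous_intros) auto
  qed (use s in auto)
  then show ?thesis by simp
qed

text \<open>On homogeneous harmonics of degrees \<open>m \<noteq> n\<close> this is orthogonality. In general, the
  antisymmetric form \<open>W(l)\<close> below satisfies \<open>(l W(l))' = 0\<close> by self-adjointness and stays bounded
  as \<open>l\<close> tends to \<open>0\<close>.\<close>

lemma euler_symmetric:
  assumes a: "harmonic_on (ball 0 R1) a" and b: "harmonic_on (ball 0 R2) b"
    and s: "0 < s" "s < R1" and t: "0 < t" "t < R2"
  shows "(LINT x|\<mu>. euler a (s *\<^sub>R x) * b (t *\<^sub>R x)) = (LINT x|\<mu>. a (s *\<^sub>R x) * euler b (t *\<^sub>R x))"
proof -
  define W where "W l x = euler a ((l * s) *\<^sub>R x) * b ((l * t) *\<^sub>R x) - a ((l * s) *\<^sub>R x) * euler b ((l * t) *\<^sub>R x)" for l x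
  \<comment> \<open>This is the derivative of \<open>l * W l x\<close> in \<open>l\<close>: every
    \<open>euler\<close> comes with \<open>1 / l\<close>, which the factor \<open>l\<close> absorbs,
    and the two products \<open>euler a * euler b\<close> cancel.\<close>
  define W' where "W' l x = (euler (euler a) ((l * s) *\<^sub>R x) + euler a ((l * s) *\<^sub>R x)) * b ((l * t) *\<^sub>R x)
    - a ((l * s) *\<^sub>R x) * (euler (euler b) ((l * t) *\<^sub>R x) + euler b ((l * t) *\<^sub>R x))" for l x
  \<comment> \<open>Both radii are dilated by the same factor; \<open>M > 1\<close> is the largest
    one that keeps both points inside their balls.\<close>
  define M where "M = min (R1 / s) (R2 / t)"
  have M: "1 < M" using s t by (simp add: M_def)
  have in1: "(l * s) *\<^sub>R x \<in> ball 0 R1" "(l * t) *\<^sub>R x \<in> ball 0 R2" if "\<bar>l\<bar> < M" "norm x = 1" for l and x :: "real^3"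
    using that s t by (auto simp: M_def abs_mult pos_less_divide_eq)
  note Ca = harmonic_onD[OF a] and Cb = harmonic_onD[OF b]
  have comp': "continuous_on ({-M<..<M} \<times> sphere 0 1) (\<lambda>z. F ((fst z * r) *\<^sub>R snd z))"
    if F: "continuous_on (ball 0 q) F" and in_q: "\<And>l (x::real^3). \<bar>l\<bar> < M \<Longrightarrow> norm x = 1 \<Longrightarrow> (l * r) *\<^sub>R x \<in> ball 0 q"
    for F :: "real^3 \<Rightarrow> real" and q r
  proof (rule continuous_on_compose2[OF F])
    show "(\<lambda>z. (fst z * r) *\<^sub>R snd z) ` ({- M<..<M} \<times> sphere (0::real^3) 1) \<subseteq> ball 0 q"
      by (intro image_subsetI in_q) auto
  qed (intro continuous_intros)
  have comp: "continuous_on ({-M<..<M} \<times> sphere 0 1) (\<lambda>z. F ((fst z * r) *\<^sub>R snd z))"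
    if "continuous_on (ball 0 R1) F \<and> r = s \<or> continuous_on (ball 0 R2) F \<and> r = t" for F :: "real^3 \<Rightarrow> real" and r
    using that comp'[OF _ in1(1)] comp'[OF _ in1(2)] by blast
  note cont = C1_onD(3)[OF Ca(2)] C1_onD(3)[OF Cb(2)] C1_onD(3)[OF Ca(3)] C1_onD(3)[OF Cb(3)]
    continuous_euler[OF Ca(3)] continuous_euler[OF Cb(3)]
  have contW: "continuous_on ({-M<..<M} \<times> sphere 0 1) (\<lambda>z. W (fst z) (snd z))"
    unfolding W_def by (intro continuous_on_diff continuous_on_mult comp; simp add: cont)
  have contW': "continuous_on ({-M<..<M} \<times> sphere 0 1) (\<lambda>z. W' (fst z) (snd z))"
    unfolding W'_def by (intro continuous_on_diff continuous_on_add continuous_on_mult comp; simp add: cont)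
  have contx: "continuous_on (sphere 0 1) (W l)" if "\<bar>l\<bar> < M" for l
  proof -
    have "continuous_on (sphere 0 1) (\<lambda>x. (l, x))" by (intro continuous_intros)
    moreover have "(\<lambda>x. (l, x)) ` sphere 0 1 \<subseteq> {-M<..<M} \<times> sphere 0 1" using that by auto
    ultimately have "continuous_on (sphere 0 1) (\<lambda>x. W (fst (l, x)) (snd (l, x)))"
      by (rule continuous_on_compose2[OF contW])
    then show ?thesis by simp
  qed
  define \<phi> where "\<phi> l = (LINT x|\<mu>. l * W l x)" for l
  have der: "(\<phi> has_real_derivative 0) (at l)" if l: "0 < l" "l < M" for l
  proof -
    have "(\<phi> has_real_derivative (LINT x|\<mu>. W' l x)) (at l)"
      unfolding \<phi>_def
    proof (rule surface_DERIV[where T="{0<..<M}"])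
      fix l' x assume l': "l' \<in> {0<..<M}" and x: "norm (x :: real^3) = 1"
      have i: "(l' * s) *\<^sub>R x \<in> ball 0 R1" "(l' * t) *\<^sub>R x \<in> ball 0 R2"
        using in1[of l' x] l' x by auto
      have d: "((\<lambda>l. l * r) has_real_derivative r) (at l')" for r
        by (auto intro!: derivative_eq_intros)
      have "((\<lambda>l. F ((l * r) *\<^sub>R x)) has_real_derivative euler F ((l' * r) *\<^sub>R x) / l') (at l')"
        if "F differentiable (at ((l' * r) *\<^sub>R x))" "r > 0" for F r
        using DERIV_dilation[of F "\<lambda>l. l * r", OF that(1) d] that(2) l' by simp
      note D = this[OF C1_onD(1)[OF Ca(2) i(1)] s(1)] this[OF C1_onD(1)[OF Cb(2) i(2)] t(1)]
        this[OF C1_onD(1)[OF Ca(3) i(1)] s(1)] this[OF C1_onD(1)[OF Cb(3) i(2)] t(1)]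
      show "((\<lambda>l. l * W l x) has_real_derivative W' l' x) (at l')"
        unfolding W_def
        by (rule DERIV_cong[OF DERIV_mult[OF DERIV_ident DERIV_diff[OF DERIV_mult[OF D(3,2)] DERIV_mult[OF D(1,4)]]]])
          (use l' in \<open>simp add: W'_def field_simps\<close>)
    next
      show "continuous_on (sphere 0 1) (\<lambda>x. l * W l x)" if "l \<in> {0<..<M}" for l
        using contx[of l] that by (intro continuous_intros) auto
      show "continuous_on ({0<..<M} \<times> sphere 0 1) (\<lambda>(t, x). W' t x)"
        unfolding case_prod_beta by (rule continuous_on_subset[OF contW']) (use M in auto)
    qed (use l in auto)
    also have "(LINT x|\<mu>. W' l x) = 0"
    proof -
      have m: "\<And>x::real^3. norm x = 1 \<Longrightarrow> (l * s) *\<^sub>R x \<in> ball 0 R1"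
        by (intro in1(1)) (use l in auto)
      have m2: "\<And>x::real^3. norm x = 1 \<Longrightarrow> (l * t) *\<^sub>R x \<in> ball 0 R2"
        by (intro in1(2)) (use l in auto)
      have c: "continuous_on (sphere 0 1) (\<lambda>x. F ((l * r) *\<^sub>R x))"
        if "continuous_on (ball 0 R1) F \<and> r = s \<or> continuous_on (ball 0 R2) F \<and> r = t" for F :: "real^3 \<Rightarrow> real" and r
        using that sphere_scaled[OF _ m] sphere_scaled[OF _ m2] by blast
      have "integrable \<mu> (\<lambda>x. (euler (euler a) ((l * s) *\<^sub>R x) + euler a ((l * s) *\<^sub>R x)) * b ((l * t) *\<^sub>R x))"
        "integrable \<mu> (\<lambda>x. a ((l * s) *\<^sub>R x) * (euler (euler b) ((l * t) *\<^sub>R x) + euler b ((l * t) *\<^sub>R x)))"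
        by (intro surface_integrable continuous_on_add continuous_on_mult c; simp add: cont)+
      then show ?thesis
        using laplace_beltrami_selfadjoint[OF open_ball m a open_ball m2 b] by (simp add: W'_def)
    qed
    finally show ?thesis .
  qed
  have const: "\<phi> l = \<phi> 1" if "0 < l" "l < M" for l
    by (rule DERIV_isconst3[of 0 M l 1 \<phi>]) (use that M der in auto)
  \<comment> \<open>Here regularity at the origin enters. \<open>E\<^sup>2 + E\<close> takes the
    same value \<open>n * (n + 1)\<close> on degrees \<open>n\<close> and \<open>- n - 1\<close>, so
    self-adjointness alone cannot determine \<open>E\<close>; boundedness near \<open>l = 0\<close>
    excludes the singular branch.\<close>
  have "bounded ((\<lambda>z. W (fst z) (snd z)) ` ({0..1} \<times> sphere 0 1))"
    by (intro compact_imp_bounded compact_continuous_image compact_Times continuous_on_subset[OF contW])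
      (use M in auto)
  then obtain B where B: "\<And>l x. 0 \<le> l \<Longrightarrow> l \<le> 1 \<Longrightarrow> norm x = 1 \<Longrightarrow> \<bar>W l x\<bar> \<le> B"
    unfolding bounded_iff by fastforce
  have "\<bar>\<phi> 1\<bar> \<le> l * (B * area)" if "0 < l" "l < 1" for l
  proof -
    have "\<bar>\<phi> l\<bar> \<le> (l * B) * area"
      unfolding \<phi>_def by (rule surface_integral_bound) (use B that in \<open>auto simp: abs_mult intro!: mult_left_mono\<close>)
    then show ?thesis using const[of l] that M by simp
  qed
  then have "\<forall>\<^sub>F l in at_right 0. \<bar>\<phi> 1\<bar> \<le> l * (B * area)"
    unfolding eventually_at_right_field by (intro exI[of _ 1]) auto
  moreover have "((\<lambda>l. l * (B * area)) \<longlongrightarrow> 0 * (B * area)) (at_right 0)"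
    by (intro tendsto_intros)
  ultimately have "\<bar>\<phi> 1\<bar> \<le> 0"
    using tendsto_lowerbound[of _ _ "at_right (0::real)"] by fastforce
  then have "(LINT x|\<mu>. W 1 x) = 0" by (simp add: \<phi>_def)
  moreover have c: "continuous_on (sphere 0 1) (\<lambda>x. F (r *\<^sub>R x))"
    if "continuous_on (ball 0 R1) F \<and> r = s \<or> continuous_on (ball 0 R2) F \<and> r = t" for F :: "real^3 \<Rightarrow> real" and r
    using that sphere_scaled[of "ball 0 R1" F s] sphere_scaled[of "ball 0 R2" F t] s t by auto
  have "integrable \<mu> (\<lambda>x. euler a (s *\<^sub>R x) * b (t *\<^sub>R x))" "integrable \<mu> (\<lambda>x. a (s *\<^sub>R x) * euler b (t *\<^sub>R x))"
    by (intro surface_integrable continuous_on_mult c; simp add: cont)+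
  ultimately show ?thesis
    by (simp add: W_def)
qed

text \<open>In degree \<open>n\<close> both sides carry \<open>(s t)\<^sup>n\<close>. In general,
  keep the product fixed and vary the first radius: the derivative is, up to a factor, the
  difference of the two sides of \<open>euler_symmetric\<close>.\<close>

lemma pairing_depends_on_product:
  assumes a: "harmonic_on (ball 0 R1) a" and b: "harmonic_on (ball 0 R2) b"
    and s: "0 < s" "s < R1" and t: "0 < t" "t < R2" and s': "0 < s'" "s' < R1" and t': "0 < t'" "t' < R2"
    and eq: "s * t = s' * t'"
  shows "(LINT x|\<mu>. a (s *\<^sub>R x) * b (t *\<^sub>R x)) = (LINT x|\<mu>. a (s' *\<^sub>R x) * b (t' *\<^sub>R x))"
proof -
  define p where "p = s * t"
  \<comment> \<open>The first radii \<open>k\<close> for which \<open>k < R1\<close> and the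
    complementary radius \<open>p / k\<close> stays below \<open>R2\<close>.\<close>
  define T where "T = {p / R2<..<R1}"
  have p: "p > 0" "t = p / s" using s t by (simp_all add: p_def)
  have p': "t' = p / s'" using s' by (simp add: p_def eq)
  have T: "k > 0" "k < R1" "p / k < R2" "p / k > 0" if "k \<in> T" for k
  proof -
    have "p / R2 > 0" using p t by simp
    then show k: "k > 0" using that by (simp add: T_def)
    show "k < R1" "p / k < R2" "p / k > 0"
      using that k t p by (auto simp: T_def divide_less_eq mult.commute)
  qed
  note Ca = harmonic_onD[OF a] and Cb = harmonic_onD[OF b]
  define \<phi> where "\<phi> k = (LINT x|\<mu>. a (k *\<^sub>R x) * b ((p / k) *\<^sub>R x))" for k
  have der: "(\<phi> has_real_derivative 0) (at k)" if k: "k \<in> T" for k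
  proof -
    let ?f' = "\<lambda>k x. (euler a (k *\<^sub>R x) * b ((p / k) *\<^sub>R x) - a (k *\<^sub>R x) * euler b ((p / k) *\<^sub>R x)) / k"
    have "(\<phi> has_real_derivative (LINT x|\<mu>. ?f' k x)) (at k)"
      unfolding \<phi>_def
    proof (rule surface_DERIV[where T=T])
      show "open T" by (simp add: T_def)
      fix k x assume k: "k \<in> T" and x: "norm (x :: real^3) = 1"
      have i: "k *\<^sub>R x \<in> ball 0 R1" "(p / k) *\<^sub>R x \<in> ball 0 R2" using T[OF k] x p by auto
      have d: "((\<lambda>k. p / k) has_real_derivative - p / k\<^sup>2) (at k)"
        using T[OF k] by (auto intro!: derivative_eq_intros simp: power2_eq_square)
      note D = DERIV_dilation[OF C1_onD(1)[OF Ca(2) i(1)] DERIV_ident]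
        DERIV_dilation[of b "\<lambda>k. p / k", OF C1_onD(1)[OF Cb(2) i(2)] d]
      show "((\<lambda>k. a (k *\<^sub>R x) * b ((p / k) *\<^sub>R x)) has_real_derivative ?f' k x) (at k)"
        by (rule DERIV_cong[OF DERIV_mult[OF D]])
          (use T[OF k] p in \<open>simp_all add: field_simps power2_eq_square\<close>)
    next
      show "continuous_on (sphere 0 1) (\<lambda>x. a (k *\<^sub>R x) * b ((p / k) *\<^sub>R x))" if "k \<in> T" for k
        using T[OF that] p
        by (intro continuous_on_mult sphere_scaled[OF C1_onD(3)[OF Ca(2)]]
            sphere_scaled[OF C1_onD(3)[OF Cb(2)]]) auto
      have 3: "fst z \<noteq> 0" if "z \<in> T \<times> sphere 0 1" for z :: "real \<times> (real^3)"
      proof -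
        have "fst z \<in> T" using that by auto
        then show ?thesis using T(1) by force
      qed
      have 1: "continuous_on (T \<times> sphere 0 1) (\<lambda>z. F (fst z *\<^sub>R snd z))"
        if "continuous_on (ball 0 R1) F" for F :: "real^3 \<Rightarrow> real"
        by (rule continuous_on_compose2[OF that]) (use T(1,2) in \<open>auto intro!: continuous_intros simp: abs_of_pos\<close>)
      have 2: "continuous_on (T \<times> sphere 0 1) (\<lambda>z. F ((p / fst z) *\<^sub>R snd z))"
        if "continuous_on (ball 0 R2) F" for F :: "real^3 \<Rightarrow> real"
      proof (rule continuous_on_compose2[OF that])
        show "continuous_on (T \<times> sphere (0::real^3) 1) (\<lambda>z. (p / fst z) *\<^sub>R snd z)"
          by (intro continuous_intros ballI 3)
        show "(\<lambda>z. (p / fst z) *\<^sub>R snd z) ` (T \<times> sphere (0::real^3) 1) \<subseteq> ball 0 R2"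
        proof
          fix y assume "y \<in> (\<lambda>z. (p / fst z) *\<^sub>R snd z) ` (T \<times> sphere (0::real^3) 1)"
          then obtain k x where "k \<in> T" "norm x = 1" "y = (p / k) *\<^sub>R x" by auto
          then show "y \<in> ball 0 R2" using T(1)[of k] T(3)[of k] p by simp
        qed
      qed
      show "continuous_on (T \<times> sphere 0 1) (\<lambda>(k, x). ?f' k x)"
        unfolding case_prod_beta
        by (intro continuous_on_divide continuous_on_diff continuous_on_mult 1 2 C1_onD(3)[OF Ca(2)] C1_onD(3)[OF Cb(2)]
            C1_onD(3)[OF Ca(3)] C1_onD(3)[OF Cb(3)] continuous_intros ballI 3)
    qed (use k in auto)
    also have "(LINT x|\<mu>. ?f' k x) = 0"
    proof -
      have "integrable \<mu> (\<lambda>x. euler a (k *\<^sub>R x) * b ((p / k) *\<^sub>R x))"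
        "integrable \<mu> (\<lambda>x. a (k *\<^sub>R x) * euler b ((p / k) *\<^sub>R x))"
        by (intro surface_integrable continuous_on_mult
            sphere_scaled[OF C1_onD(3)[OF Ca(2)]] sphere_scaled[OF C1_onD(3)[OF Ca(3)]]
            sphere_scaled[OF C1_onD(3)[OF Cb(2)]] sphere_scaled[OF C1_onD(3)[OF Cb(3)]];
            use T[OF k] p in simp)+
      then show ?thesis
        using euler_symmetric[OF a b T(1,2)[OF k] T(4,3)[OF k]] by simp
    qed
    finally show ?thesis .
  qed
  have mem: "s \<in> T" "s' \<in> T"
    using s s' t t' by (simp_all add: T_def divide_less_eq p_def mult.commute) (simp add: eq mult.commute)
  have "\<phi> s = \<phi> s'"
  proof (rule DERIV_isconst3[of "p / R2" R1 s s' \<phi>])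
    show "p / R2 < R1" using mem by (simp add: T_def)
    show "s \<in> {p / R2<..<R1}" "s' \<in> {p / R2<..<R1}" using mem by (simp_all add: T_def)
    show "(\<phi> has_real_derivative 0) (at x)" if "x \<in> {p / R2<..<R1}" for x
      using der that by (simp add: T_def)
  qed
  then show ?thesis
    unfolding \<phi>_def using p p' by simp
qed

text \<open>\<open>euler a\<close> is only known to be continuously differentiable, so it cannot be
  substituted for the harmonic function in \<open>pairing_depends_on_product\<close>. Instead that
  identity is differentiated in the first radius, the ratio \<open>k\<close> being held
  fixed.\<close>

lemma euler_pairing_depends_on_product:
  assumes a: "harmonic_on (ball 0 R1) a" and b: "harmonic_on (ball 0 R2) b"
    and s: "0 < s" "s < R1" and t: "0 < t" "t < R2" and s': "0 < s'" "s' < R1" and t': "0 < t'" "t' < R2"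
    and eq: "s * t = s' * t'"
  shows "(LINT x|\<mu>. euler a (s *\<^sub>R x) * b (t *\<^sub>R x)) = (LINT x|\<mu>. euler a (s' *\<^sub>R x) * b (t' *\<^sub>R x))"
proof -
  define k where "k = s' / s"
  have k: "k > 0" "s' = k * s" using s s' by (auto simp: k_def)
  note Ca = harmonic_onD[OF a] and Cb = harmonic_onD[OF b]
  have cb: "continuous_on (sphere 0 1) (\<lambda>x. b (r *\<^sub>R x))" if "0 < r" "r < R2" for r
    by (rule sphere_scaled[OF C1_onD(3)[OF Cb(2)]]) (use that in auto)
  have d1: "((\<lambda>s. LINT x|\<mu>. a (s *\<^sub>R x) * b (t *\<^sub>R x)) has_real_derivative
      (LINT x|\<mu>. euler a (s *\<^sub>R x) * b (t *\<^sub>R x)) / s) (at s)"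
    by (rule pairing_DERIV[OF Ca(2) s cb[OF t]])
  have "((\<lambda>s. LINT x|\<mu>. a (s *\<^sub>R x) * b (t' *\<^sub>R x)) has_real_derivative
      (LINT x|\<mu>. euler a (s' *\<^sub>R x) * b (t' *\<^sub>R x)) / s') (at (k * s))"
    using pairing_DERIV[OF Ca(2) s' cb[OF t']] k by simp
  from DERIV_chain2[where g="\<lambda>r. k * r" and x=s and Db=k, OF this]
  have d2: "((\<lambda>r. LINT x|\<mu>. a ((k * r) *\<^sub>R x) * b (t' *\<^sub>R x)) has_real_derivative
      (LINT x|\<mu>. euler a (s' *\<^sub>R x) * b (t' *\<^sub>R x)) / s' * k) (at s)"
    by (auto intro!: derivative_eq_intros)
  have op: "open {r. 0 < r \<and> r < R1 \<and> k * r < R1}"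
    by (intro open_Collect_conj open_Collect_less continuous_intros)
  have "((\<lambda>s. LINT x|\<mu>. a (s *\<^sub>R x) * b (t *\<^sub>R x)) has_real_derivative
      (LINT x|\<mu>. euler a (s' *\<^sub>R x) * b (t' *\<^sub>R x)) / s' * k) (at s)"
  proof (rule has_field_derivative_transform_within_open[OF d2 op])
    show "s \<in> {r. 0 < r \<and> r < R1 \<and> k * r < R1}" using s s' k by auto
    fix r assume "r \<in> {r. 0 < r \<and> r < R1 \<and> k * r < R1}"
    then have r: "0 < r" "r < R1" "0 < k * r" "k * r < R1" using k by auto
    have "t = k * t'" using eq k s by simp
    then show "(LINT x|\<mu>. a ((k * r) *\<^sub>R x) * b (t' *\<^sub>R x)) = (LINT x|\<mu>. a (r *\<^sub>R x) * b (t *\<^sub>R x))"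
      by (intro pairing_depends_on_product[OF a b r(3,4) t' r(1,2) t]) simp
  qed
  from DERIV_unique[OF d1 this] show ?thesis
    using k s by (simp add: field_simps)
qed

section \<open>The Newtonian and Poisson kernels\<close>

definition newton :: "real^3 \<Rightarrow> real^3 \<Rightarrow> real" where
  "newton y x = 1 / norm (x - y)"

definition newton_grad :: "real^3 \<Rightarrow> real^3 \<Rightarrow> real^3" where
  "newton_grad y x = (1 / norm (x - y) ^ 3) *\<^sub>R (y - x)"

lemma has_derivative_inverse_dist_power:
  assumes "x \<noteq> (y :: real^3)" "k > 0"
  shows "((\<lambda>x. 1 / norm (x - y) ^ k) has_derivative
    (\<lambda>h. h \<bullet> ((real k / norm (x - y) ^ (k + 2)) *\<^sub>R (y - x)))) (at x)"
proof -
  define r where "r = norm (x - y)"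
  have r: "r > 0" using assms by (simp add: r_def)
  have "GDERIV (\<lambda>x. norm (x - y)) x :> sgn (x - y)"
    unfolding gderiv_def
    by (rule has_derivative_eq_rhs[OF has_derivative_compose[where g=norm and g'="\<lambda>h. h \<bullet> sgn (x - y)" and f="\<lambda>x. x - y" and f'="\<lambda>h. h"]])
      (use assms GDERIV_norm[of "x - y"] in \<open>auto simp: gderiv_def intro!: derivative_eq_intros\<close>)
  moreover have "((\<lambda>r. 1 / r ^ k) has_real_derivative - (real k / r ^ (k + 1))) (at (norm (x - y)))"
    using r assms(2) unfolding r_def[symmetric]
    by (auto intro!: derivative_eq_intros simp: field_simps simp flip: power_add power_Suc)
  ultimately have "GDERIV (\<lambda>x. 1 / norm (x - y) ^ k) x :> (- (real k / r ^ (k + 1))) *\<^sub>R sgn (x - y)"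
    by (rule GDERIV_DERIV_compose)
  also have "(- (real k / r ^ (k + 1))) *\<^sub>R sgn (x - y) = (real k / r ^ (k + 2)) *\<^sub>R (y - x)"
    using r by (simp add: sgn_div_norm r_def[symmetric] field_simps vec_eq_iff)
  finally show ?thesis
    by (simp add: gderiv_def r_def)
qed

lemma newton_has_derivative:
  "x \<noteq> y \<Longrightarrow> (newton y has_derivative (\<lambda>h. h \<bullet> newton_grad y x)) (at x)"
  using has_derivative_inverse_dist_power[of x y 1]
  by (simp add: newton_def[abs_def] newton_grad_def numeral_3_eq_3)

lemma grad_newton: "x \<noteq> y \<Longrightarrow> grad (newton y) x = newton_grad y x"
  by (rule grad_eqI[OF newton_has_derivative])

lemma continuous_newton_grad: "continuous_on (- {y}) (newton_grad y)"
  unfolding newton_grad_def by (intro continuous_intros) auto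

lemma C1_newton: "C1_on (- {y}) (newton y)"
  by (rule C1_onI, rule newton_has_derivative) (use continuous_newton_grad in auto)

lemma harmonic_newton: "harmonic_on (- {y}) (newton y)"
proof -
  \<comment> \<open>Row \<open>i\<close> of the Hessian of \<open>newton y\<close>.\<close>
  define H where "H i x = (- (1 / norm (x - y) ^ 3)) *\<^sub>R axis i 1
      + ((y - x) $ i * (3 / norm (x - y) ^ 5)) *\<^sub>R (y - x)" for i :: 3 and x
  have der: "((\<lambda>x. grad (newton y) x $ i) has_derivative (\<lambda>h. h \<bullet> H i x)) (at x)" if "x \<noteq> y" for x i
  proof -
    have "((\<lambda>x. (y - x) $ i) has_derivative (\<lambda>h. - (h $ i))) (at x)"
      by (auto intro!: derivative_eq_intros bounded_linear_imp_has_derivative bounded_linear_vec_nth)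
    from has_derivative_mult[OF has_derivative_inverse_dist_power[OF that, of 3] this]
    have "((\<lambda>x. 1 / norm (x - y) ^ 3 * (y - x) $ i) has_derivative (\<lambda>h. h \<bullet> H i x)) (at x)"
      by (simp add: H_def inner_add_right inner_diff_right inner_axis algebra_simps)
    then have "((\<lambda>x. newton_grad y x $ i) has_derivative (\<lambda>h. h \<bullet> H i x)) (at x)"
      by (simp add: newton_grad_def)
    then show ?thesis
      by (rule has_derivative_transform_within_open[where s="- {y}"]) (use that in \<open>auto simp: grad_newton\<close>)
  qed
  have gr: "grad (\<lambda>x. grad (newton y) x $ i) x = H i x" if "x \<noteq> y" for x i
    by (rule grad_eqI[OF der[OF that]])
  have contH: "continuous_on (- {y}) (\<lambda>x. grad (\<lambda>x. grad (newton y) x $ i) x $ j)" for i j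
  proof -
    have "continuous_on (- {y}) (\<lambda>x. H i x $ j)"
      unfolding H_def by (intro continuous_intros) auto
    then show ?thesis
      by (rule continuous_on_eq) (simp add: gr)
  qed
  have lap: "laplacian (newton y) x = 0" if "x \<noteq> y" for x
  proof -
    define r where "r = norm (x - y)"
    have r: "r > 0" using that by (simp add: r_def)
    have "laplacian (newton y) x = (\<Sum>i\<in>UNIV. H i x $ i)"
      using gr[OF that] by (simp add: laplacian_def)
    also have "\<dots> = - 3 / r ^ 3 + 3 / r ^ 5 * ((y - x) \<bullet> (y - x))"
    proof -
      have "(\<Sum>i\<in>UNIV. ((- (1 / r ^ 3)) *\<^sub>R axis i 1 + (z $ i * c) *\<^sub>R z) $ i) = - 3 / r ^ 3 + c * (z \<bullet> z)"
        for z :: "real^3" and c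
        by (simp add: axis_def inner_vec_def sum_3 algebra_simps)
      then show ?thesis by (simp only: H_def r_def)
    qed
    also have "(y - x) \<bullet> (y - x) = r\<^sup>2"
      by (simp add: r_def dot_square_norm norm_minus_commute)
    also have "- 3 / r ^ 3 + 3 / r ^ 5 * r\<^sup>2 = 0"
      using r by (simp add: field_simps eval_nat_numeral)
    finally show ?thesis .
  qed
  have d: "f differentiable (at x)" if "(f has_derivative f') (at x)" for f :: "real^3 \<Rightarrow> real" and f' x
    using that by (auto simp: differentiable_def)
  show ?thesis
    using d[OF newton_has_derivative] d[OF der] contH lap
    by (auto simp: harmonic_on_def eval_nat_numeral)
qed

lemma harmonic_newton_ball:
  assumes "norm y = 1"
  shows "harmonic_on (ball 0 1) (newton y)"
  by (rule harmonic_on_subset[OF harmonic_newton]) (use assms in auto)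

lemma euler_newton: "x \<noteq> y \<Longrightarrow> euler (newton y) x = x \<bullet> newton_grad y x"
  by (simp add: euler_def grad_newton)

section \<open>Constants and the Poisson kernel of the ball\<close>

lemma harmonic_const: "harmonic_on S (\<lambda>x. c)"
proof -
  have g: "grad (\<lambda>x. k) = (\<lambda>x. 0)" for k
    by (rule ext, rule grad_eqI) simp
  show ?thesis
    by (simp add: harmonic_on_def eval_nat_numeral g laplacian_def)
qed

lemma euler_const [simp]: "euler (\<lambda>x. c) z = 0"
  by (simp add: euler_def grad_eqI[of "\<lambda>x. c" 0])

text \<open>The Poisson kernel of the unit ball at the inner point \<open>t *\<^sub>R y\<close>,
  without the factor \<open>1 / area\<close>. Putting the dilation on \<open>x\<close> uses
  \<open>|t x - y| = |x - t y|\<close> for unit vectors and makes it a pairing partner in the sense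
  of the previous section.\<close>

definition poisson :: "real^3 \<Rightarrow> real \<Rightarrow> real^3 \<Rightarrow> real" where
  "poisson y t x = (1 - t\<^sup>2) / norm (t *\<^sub>R x - y) ^ 3"

lemma scaled_neq_unit:
  fixes x y :: "real^3"
  assumes "norm x = 1" "norm y = 1" "\<bar>t\<bar> < 1"
  shows "t *\<^sub>R x \<noteq> y"
  using assms by auto

lemma norm_scaled_diff_squared:
  fixes x y :: "real^3"
  assumes "norm x = 1" "norm y = 1"
  shows "(norm (t *\<^sub>R x - y))\<^sup>2 = t\<^sup>2 - 2 * t * (x \<bullet> y) + 1"
proof -
  have "x \<bullet> x = 1" "y \<bullet> y = 1" using assms by (simp_all add: dot_square_norm)
  then show ?thesis
    unfolding power2_norm_eq_inner
    by (simp add: inner_diff_left inner_diff_right inner_commute[of y x] power2_eq_square algebra_simps)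
qed

text \<open>In degree \<open>n\<close> the operator \<open>2 E + 1\<close> multiplies by
  \<open>2 n + 1\<close>, which is the ratio of the expansions of the two kernels.\<close>

lemma poisson_eq_euler_newton:
  assumes x: "norm x = 1" and y: "norm y = 1" and t: "\<bar>t\<bar> < 1"
  shows "poisson y t x = 2 * euler (newton y) (t *\<^sub>R x) + newton y (t *\<^sub>R x)"
proof -
  define r where "r = norm (t *\<^sub>R x - y)"
  have ne: "t *\<^sub>R x \<noteq> y" by (rule scaled_neq_unit[OF x y t])
  have r: "r > 0" using ne by (simp add: r_def)
  have xx: "x \<bullet> x = 1" "y \<bullet> y = 1" using x y by (simp_all add: dot_square_norm)
  have r2: "r\<^sup>2 = t\<^sup>2 - 2 * t * (x \<bullet> y) + 1"
    unfolding r_def by (rule norm_scaled_diff_squared[OF x y])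
  have "2 * euler (newton y) (t *\<^sub>R x) + newton y (t *\<^sub>R x) = (2 * (t * (x \<bullet> y) - t\<^sup>2) + r\<^sup>2) / r ^ 3"
    using r unfolding euler_newton[OF ne] newton_grad_def newton_def r_def[symmetric]
    by (simp add: inner_diff_right xx field_simps power2_eq_square power3_eq_cube)
  also have "2 * (t * (x \<bullet> y) - t\<^sup>2) + r\<^sup>2 = 1 - t\<^sup>2"
    by (simp add: r2)
  finally show ?thesis by (simp add: poisson_def r_def)
qed

lemma newton_scaled:
  assumes "norm y = 1" "\<bar>t\<bar> < 1"
  shows "continuous_on (sphere 0 1) (\<lambda>x. newton y (t *\<^sub>R x))"
    and "continuous_on (sphere 0 1) (\<lambda>x. euler (newton y) (t *\<^sub>R x))"
    and "continuous_on (sphere 0 1) (poisson y t)"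
proof -
  have m: "t *\<^sub>R x \<in> - {y}" if "norm x = 1" for x
    using scaled_neq_unit[OF that assms] by simp
  show "continuous_on (sphere 0 1) (\<lambda>x. newton y (t *\<^sub>R x))"
    by (rule sphere_scaled[OF C1_onD(3)[OF C1_newton] m])
  show "continuous_on (sphere 0 1) (\<lambda>x. euler (newton y) (t *\<^sub>R x))"
    by (rule sphere_scaled[OF continuous_euler[OF C1_newton] m])
  show "continuous_on (sphere 0 1) (poisson y t)"
    unfolding poisson_def by (intro continuous_intros) (use m in auto)
qed

text \<open>\<open>euler_symmetric\<close> moves \<open>2 E + 1\<close> from the kernel to
  \<open>u\<close>. What remains are pairings with the harmonic function \<open>newton y\<close>,
  which depend on the product of the radii only.\<close>

lemma poisson_integral_by_newton:
  assumes u: "harmonic_on (ball 0 R) u" and s: "0 < s" "s < R" and y: "norm y = 1" and t: "0 < t" "t < 1"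
  shows "(LINT x|\<mu>. u (s *\<^sub>R x) * poisson y t x)
    = (LINT x|\<mu>. (2 * euler u (s *\<^sub>R x) + u (s *\<^sub>R x)) * newton y (t *\<^sub>R x))"
proof -
  have t': "\<bar>t\<bar> < 1" using t by simp
  have m: "s *\<^sub>R x \<in> ball 0 R" if "norm x = 1" for x :: "real^3"
    using s that by simp
  note c = newton_scaled[OF y t'] sphere_scaled[OF C1_onD(3)[OF harmonic_onD(2)[OF u]] m]
    sphere_scaled[OF C1_onD(3)[OF harmonic_onD(3)[OF u]] m]
  note i = surface_integrable[OF continuous_on_mult[OF c(4) c(2)]]
    surface_integrable[OF continuous_on_mult[OF c(4) c(1)]]
    surface_integrable[OF continuous_on_mult[OF c(5) c(1)]]
  have "(LINT x|\<mu>. u (s *\<^sub>R x) * poisson y t x)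
      = (LINT x|\<mu>. 2 * (u (s *\<^sub>R x) * euler (newton y) (t *\<^sub>R x)) + u (s *\<^sub>R x) * newton y (t *\<^sub>R x))"
    by (rule lint_cong) (simp_all add: poisson_eq_euler_newton[OF _ y t'] algebra_simps)
  also have "\<dots> = 2 * (LINT x|\<mu>. u (s *\<^sub>R x) * euler (newton y) (t *\<^sub>R x)) + (LINT x|\<mu>. u (s *\<^sub>R x) * newton y (t *\<^sub>R x))"
    using i by simp
  also have "(LINT x|\<mu>. u (s *\<^sub>R x) * euler (newton y) (t *\<^sub>R x)) = (LINT x|\<mu>. euler u (s *\<^sub>R x) * newton y (t *\<^sub>R x))"
    by (rule euler_symmetric[OF u harmonic_newton_ball[OF y] s t, symmetric])
  also have "2 * \<dots> + (LINT x|\<mu>. u (s *\<^sub>R x) * newton y (t *\<^sub>R x))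
      = (LINT x|\<mu>. 2 * (euler u (s *\<^sub>R x) * newton y (t *\<^sub>R x)) + u (s *\<^sub>R x) * newton y (t *\<^sub>R x))"
    using i by simp
  finally show ?thesis by (simp add: distrib_right mult.assoc)
qed

text \<open>Pairing with the constant \<open>1\<close> in \<open>euler_symmetric\<close> shows that
  the integral of \<open>newton y (t *\<^sub>R x)\<close> does not vary with \<open>t\<close>; at
  \<open>t = 0\<close> the integrand is \<open>1\<close>.\<close>

lemma poisson_integral_one:
  assumes y: "norm y = 1" and t: "0 < t" "t < 1"
  shows "(LINT x|\<mu>. poisson y t x) = area"
proof -
  define \<phi> where "\<phi> t = (LINT x|\<mu>. newton y (t *\<^sub>R x))" for t
  have der: "(\<phi> has_real_derivative (LINT x|\<mu>. x \<bullet> newton_grad y (r *\<^sub>R x))) (at r)" if "\<bar>r\<bar> < 1" for r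
    unfolding \<phi>_def
  proof (rule surface_DERIV[where T="{-1<..<1}"])
    fix r x assume r: "r \<in> {- 1<..<1::real}" and x: "norm (x :: real^3) = 1"
    have ne: "r *\<^sub>R x \<noteq> y" by (rule scaled_neq_unit[OF x y]) (use r in auto)
    have "((\<lambda>s. s *\<^sub>R x) has_vector_derivative x) (at r)"
      using has_vector_derivative_scaleR[OF DERIV_ident has_vector_derivative_const[of x]] by simp
    from DERIV_along_curve[OF this C1_onD(1)[OF C1_newton[of y]]] ne
    show "((\<lambda>s. newton y (s *\<^sub>R x)) has_real_derivative x \<bullet> newton_grad y (r *\<^sub>R x)) (at r)"
      by (simp add: grad_newton)
  next
    show "continuous_on (sphere 0 1) (\<lambda>x. newton y (r *\<^sub>R x))" if "r \<in> {-1<..<1}" for r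
      by (rule newton_scaled[OF y]) (use that in auto)
    have "continuous_on ({-1<..<1} \<times> sphere 0 1) (\<lambda>z. newton_grad y (fst z *\<^sub>R snd z))"
    proof (rule continuous_on_compose2[OF continuous_newton_grad])
      show "(\<lambda>z. fst z *\<^sub>R snd z) ` ({-1<..<1} \<times> sphere 0 1) \<subseteq> - {y}"
        using scaled_neq_unit[OF _ y] by force
    qed (intro continuous_intros)
    then show "continuous_on ({-1<..<1} \<times> sphere 0 1) (\<lambda>(r, x). x \<bullet> newton_grad y (r *\<^sub>R x))"
      unfolding case_prod_beta by (intro continuous_intros)
  qed (use that in auto)
  have der0: "(\<phi> has_real_derivative 0) (at r)" if r: "0 < r" "r < 1" for r
  proof -
    have "(LINT x|\<mu>. x \<bullet> newton_grad y (r *\<^sub>R x)) = (LINT x|\<mu>. 1 * euler (newton y) (r *\<^sub>R x)) / r"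
      unfolding integral_divide_zero[symmetric]
      by (rule lint_cong)
        (use r in \<open>simp_all add: euler_newton[OF scaled_neq_unit[OF _ y]]\<close>)
    also have "\<dots> = 0"
      \<comment> \<open>The radius \<open>1/2\<close> assigned to the constant factor is
        arbitrary.\<close>
      using euler_symmetric[OF harmonic_const harmonic_newton_ball[OF y], of "1/2" 1 r 1] r by simp
    finally show ?thesis using der[of r] r by simp
  qed
  have "\<phi> t = \<phi> 0"
  proof (rule DERIV_isconst2[of 0 t \<phi> t])
    show "continuous_on {0..t} \<phi>"
      by (intro continuous_at_imp_continuous_on ballI DERIV_isCont[OF der]) (use t in auto)
  qed (use t der0 in auto)
  also have "\<phi> 0 = area"
    using y by (simp add: \<phi>_def newton_def area_def)
  finally show ?thesis
    using poisson_integral_by_newton[OF harmonic_const[of "ball 0 1" 1], of "1/2" y t] y t by (simp add: \<phi>_def)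
qed

text \<open>The left-hand side depends on \<open>s * t\<close> only, so it can be evaluated as \<open>t\<close> tends to \<open>1\<close>,
  where the Poisson kernel concentrates at \<open>y\<close>.\<close>

lemma poisson_formula:
  assumes u: "harmonic_on (ball 0 R) u" and s: "0 < s" "s < R" and y: "norm y = 1" and t: "0 < t" "t < 1"
  shows "(LINT x|\<mu>. u (s *\<^sub>R x) * poisson y t x) = area * u ((s * t) *\<^sub>R y)"
proof -
  define m where "m = s * t"
  have m: "0 < m" "m < s" using s t by (auto simp: m_def)
  define q where "q = (LINT x|\<mu>. u (s *\<^sub>R x) * poisson y t x)"
  have uc: "continuous_on (ball 0 R) u" by (rule C1_onD(3)[OF harmonic_onD(2)[OF u]])
  have ec: "continuous_on (ball 0 R) (euler u)" by (rule C1_onD(3)[OF harmonic_onD(3)[OF u]])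
  have iu: "continuous_on (sphere 0 1) (\<lambda>x. F (r *\<^sub>R x))" if "continuous_on (ball 0 R) F" "0 < r" "r < R"
    for r and F :: "real^3 \<Rightarrow> real"
    by (rule sphere_scaled[OF that(1)]) (use that in auto)
  \<comment> \<open>The radii \<open>(s, t)\<close> are traded for \<open>(m / r, r)\<close> with
    the same product, so that \<open>r\<close> can tend to \<open>1\<close>.\<close>
  have qt: "q = (LINT x|\<mu>. u ((m / r) *\<^sub>R x) * poisson y r x)" if r: "m / R < r" "r < 1" for r
  proof -
    have "0 < m / R" using m s by simp
    then have r0: "0 < r" using r by simp
    have mr: "0 < m / r" "m / r < R"
      using m r r0 s by (auto simp: divide_less_eq mult.commute)
    have split: "(LINT x|\<mu>. u (a *\<^sub>R x) * poisson y b x)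
        = 2 * (LINT x|\<mu>. euler u (a *\<^sub>R x) * newton y (b *\<^sub>R x)) + (LINT x|\<mu>. u (a *\<^sub>R x) * newton y (b *\<^sub>R x))"
      if a: "0 < a" "a < R" and b: "0 < b" "b < 1" for a b
    proof -
      have b': "\<bar>b\<bar> < 1" using b by simp
      have "integrable \<mu> (\<lambda>x. euler u (a *\<^sub>R x) * newton y (b *\<^sub>R x))"
        "integrable \<mu> (\<lambda>x. u (a *\<^sub>R x) * newton y (b *\<^sub>R x))"
        by (intro surface_integrable continuous_on_mult iu[OF uc a] iu[OF ec a] newton_scaled(1)[OF y b'])+
      then show ?thesis
        by (simp add: poisson_integral_by_newton[OF u a y b] distrib_right mult.assoc)
    qed
    have eq: "s * t = m / r * r" using r0 by (simp add: m_def)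
    note N = harmonic_newton_ball[OF y]
    show ?thesis
      unfolding q_def split[OF s t] split[OF mr r0 r(2)]
      using pairing_depends_on_product[OF u N s t mr r0 r(2) eq] euler_pairing_depends_on_product[OF u N s t mr r0 r(2) eq]
      by simp
  qed
  have bd: "bounded (u ` cball 0 s)"
    by (intro compact_imp_bounded compact_continuous_image continuous_on_subset[OF uc]) (use s in auto)
  then obtain C where C: "\<And>z. norm z \<le> s \<Longrightarrow> \<bar>u z\<bar> \<le> C"
    unfolding bounded_iff by force
  have C0: "C \<ge> 0" using C[of 0] s by simp
  have "\<bar>q - area * u (m *\<^sub>R y)\<bar> \<le> e * area" if e: "e > 0" for e
  proof -
    have "isCont u (m *\<^sub>R y)"
      using uc m s y by (simp add: continuous_on_eq_continuous_at)
    then obtain d1 where d1: "d1 > 0" "\<And>z. dist z (m *\<^sub>R y) < d1 \<Longrightarrow> dist (u z) (u (m *\<^sub>R y)) < e"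
      unfolding continuous_at_eps_delta using e by metis
    \<comment> \<open>Half of the tolerance \<open>d1\<close> is spent on the angular displacement
      \<open>m * |x - y|\<close>, the other half on the radial displacement
      \<open>m / r - m\<close>.\<close>
    define d where "d = d1 / (2 * m)"
    have d: "d > 0" "m * d = d1 / 2" using d1 m by (auto simp: d_def)
    \<comment> \<open>The first term bounds the part of the integral near \<open>y\<close>, the
      second the part with \<open>|x - y| \<ge> d\<close>, where
      \<open>|r x - y| \<ge> d - (1 - r)\<close>. The second tends to \<open>0\<close> as
      \<open>r\<close> tends to \<open>1\<close>.\<close>
    define b where "b r = e * area + 2 * C * ((1 - r\<^sup>2) / (d - (1 - r)) ^ 3) * area" for r :: real
    have "(b \<longlongrightarrow> e * area + 2 * C * ((1 - 1\<^sup>2) / (d - (1 - 1)) ^ 3) * area) (at_left 1)"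
      unfolding b_def by (intro tendsto_intros) (use d in auto)
    then have blim: "(b \<longlongrightarrow> e * area) (at_left 1)" by simp
    \<comment> \<open>Beyond these thresholds, in order: \<open>m / r\<close> stays at most
      \<open>s\<close>, the denominator \<open>d - (1 - r)\<close> is positive, and
      \<open>m / r - m < d1 / 2\<close>.\<close>
    define r0 where "r0 = max (m / s) (max (1 - d) (1 / (1 + d1 / (2 * m))))"
    have "d1 / (2 * m) > 0" using d1 m by simp
    then have "1 / (1 + d1 / (2 * m)) < 1" by (subst divide_less_eq_1) auto
    then have r0: "r0 < 1" using m d by (simp add: r0_def)
    have bound: "\<bar>q - area * u (m *\<^sub>R y)\<bar> \<le> b r" if r: "r0 < r" "r < 1" for r
    proof -
      have r': "m / s < r" "1 - d < r" "1 / (1 + d1 / (2 * m)) < r" using r by (auto simp: r0_def)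
      have rp: "r > 0" using order_less_trans[OF divide_pos_pos[OF m(1) s(1)] r'(1)] .
      have r'': "\<bar>r\<bar> < 1" using r rp by simp
      have mr: "m / r \<le> s" using r'(1) rp s by (simp add: field_simps)
      have mrm: "m / r - m < d1 / 2"
      proof -
        have "1 < r * (1 + d1 / (2 * m))"
          using r'(3) d1 m by (simp add: divide_less_eq add_pos_pos)
        then have "1 / r < 1 + d1 / (2 * m)" using rp by (simp add: divide_less_eq mult.commute)
        from mult_strict_left_mono[OF this m(1)]
        have "m * (1 / r) < m * (1 + d1 / (2 * m))" .
        also have "\<dots> = m + d1 / 2" using m by (simp add: distrib_left)
        finally have "m / r < m + d1 / 2" by simp
        then show ?thesis by linarith
      qed
      have mrpos: "m / r - m > 0" using rp r m by (simp add: field_simps)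
      have P0: "poisson y r x \<ge> 0" for x
        using r rp by (simp add: poisson_def power_le_one)
      have ptw: "\<bar>(u ((m / r) *\<^sub>R x) - u (m *\<^sub>R y)) * poisson y r x\<bar>
          \<le> e * poisson y r x + 2 * C * ((1 - r\<^sup>2) / (d - (1 - r)) ^ 3)" if x: "norm x = 1" for x
      proof (cases "norm (x - y) < d")
        case True
        have "(m / r) *\<^sub>R x - m *\<^sub>R y = (m / r - m) *\<^sub>R x + m *\<^sub>R (x - y)"
          by (simp add: algebra_simps)
        then have "norm ((m / r) *\<^sub>R x - m *\<^sub>R y) \<le> (m / r - m) + m * norm (x - y)"
          using norm_triangle_ineq[of "(m / r - m) *\<^sub>R x" "m *\<^sub>R (x - y)"] x mrpos m by simp
        also have "\<dots> < d1 / 2 + m * d"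
          using mrm mult_strict_left_mono[OF True m(1)] by linarith
        finally have "dist ((m / r) *\<^sub>R x) (m *\<^sub>R y) < d1"
          by (simp add: dist_norm d)
        from d1(2)[OF this] have "\<bar>u ((m / r) *\<^sub>R x) - u (m *\<^sub>R y)\<bar> \<le> e"
          by (simp add: dist_real_def)
        then have "\<bar>u ((m / r) *\<^sub>R x) - u (m *\<^sub>R y)\<bar> * poisson y r x \<le> e * poisson y r x"
          by (rule mult_right_mono) (rule P0)
        moreover have "0 \<le> 2 * C * ((1 - r\<^sup>2) / (d - (1 - r)) ^ 3)"
          using C0 r r'(2) rp by (simp add: power_le_one)
        ultimately show ?thesis
          using P0[of x] by (simp add: abs_mult)
      next
        case False
        have "\<bar>u ((m / r) *\<^sub>R x) - u (m *\<^sub>R y)\<bar> \<le> C + C"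
          using C[of "(m / r) *\<^sub>R x"] C[of "m *\<^sub>R y"] mr m rp x y abs_triangle_ineq4[of "u ((m / r) *\<^sub>R x)" "u (m *\<^sub>R y)"]
          by simp
        moreover have "poisson y r x \<le> (1 - r\<^sup>2) / (d - (1 - r)) ^ 3"
        proof -
          have e: "(r *\<^sub>R x - y) + (1 - r) *\<^sub>R x = x - y" by (simp add: algebra_simps)
          have "norm (x - y) \<le> norm (r *\<^sub>R x - y) + (1 - r)"
            using norm_triangle_ineq[of "r *\<^sub>R x - y" "(1 - r) *\<^sub>R x"] x r unfolding e by simp
          then have "d - (1 - r) \<le> norm (r *\<^sub>R x - y)" using False by simp
          then have "(d - (1 - r)) ^ 3 \<le> norm (r *\<^sub>R x - y) ^ 3"
            by (rule power_mono) (use r' in auto)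
          then show ?thesis
            unfolding poisson_def using r r' rp by (intro divide_left_mono) (auto simp: power_le_one zero_less_mult_iff
              intro!: mult_pos_pos zero_less_power order_less_le_trans[of 0 "(d - (1 - r)) ^ 3"])
        qed
        ultimately have "\<bar>u ((m / r) *\<^sub>R x) - u (m *\<^sub>R y)\<bar> * poisson y r x
            \<le> (C + C) * ((1 - r\<^sup>2) / (d - (1 - r)) ^ 3)"
          by (intro mult_mono) (use P0 C0 in auto)
        moreover have "0 \<le> e * poisson y r x" using e P0 by simp
        ultimately show ?thesis
          using P0[of x] by (simp add: abs_mult)
      qed
      have mR: "0 < m / r" "m / r < R" using mr m rp s by auto
      have "m / R < r" using mR rp s by (simp add: field_simps)
      have i1: "integrable \<mu> (poisson y r)"
        by (rule surface_integrable[OF newton_scaled(3)[OF y r'']])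
      have i2: "integrable \<mu> (\<lambda>x. u ((m / r) *\<^sub>R x) * poisson y r x)"
        by (intro surface_integrable continuous_on_mult iu[OF uc mR] newton_scaled(3)[OF y r''])
      have "q - area * u (m *\<^sub>R y) = (LINT x|\<mu>. u ((m / r) *\<^sub>R x) * poisson y r x) - u (m *\<^sub>R y) * (LINT x|\<mu>. poisson y r x)"
        by (simp add: qt[OF \<open>m / R < r\<close> r(2)] poisson_integral_one[OF y rp r(2)])
      also have "\<dots> = (LINT x|\<mu>. (u ((m / r) *\<^sub>R x) - u (m *\<^sub>R y)) * poisson y r x)"
        using i1 i2 by (simp add: left_diff_distrib)
      finally have "\<bar>q - area * u (m *\<^sub>R y)\<bar> \<le> (LINT x|\<mu>. \<bar>(u ((m / r) *\<^sub>R x) - u (m *\<^sub>R y)) * poisson y r x\<bar>)"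
        by (metis integral_abs_bound)
      also have "\<dots> \<le> (LINT x|\<mu>. e * poisson y r x + 2 * C * ((1 - r\<^sup>2) / (d - (1 - r)) ^ 3))"
        by (rule integral_mono) (use ptw i1 i2 in \<open>auto simp: left_diff_distrib\<close>)
      also have "\<dots> = b r"
        using i1 by (simp add: poisson_integral_one[OF y rp r(2)] b_def area_def)
      finally show ?thesis .
    qed
    have "\<forall>\<^sub>F r in at_left 1. \<bar>q - area * u (m *\<^sub>R y)\<bar> \<le> b r"
      using bound r0 unfolding eventually_at_left_field by blast
    then show ?thesis
      by (rule tendsto_lowerbound[OF blim]) simp
  qed
  then have "\<bar>q - area * u (m *\<^sub>R y)\<bar> \<le> e" if "e > 0" for e
    using that area_pos by (metis divide_pos_pos nonzero_eq_divide_eq less_irrefl)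
  then have "q - area * u (m *\<^sub>R y) = 0"
    by (metis abs_le_zero_iff field_le_epsilon add_0)
  then show ?thesis
    by (simp add: q_def m_def)
qed

section \<open>Potentials of vector fields on the sphere\<close>

lemma harmonic_sphere:
  assumes "harmonic_on (ball 0 R) u" "1 < R"
  shows "continuous_on (sphere 0 1) u" "continuous_on (sphere 0 1) (euler u)"
    "continuous_on (sphere 0 1) (euler (euler u))" "continuous_on (sphere 0 1) (grad u)"
  using C1_onD(2,3)[OF harmonic_onD(2)[OF assms(1)]] C1_onD(3)[OF harmonic_onD(3)[OF assms(1)]]
    continuous_euler[OF harmonic_onD(3)[OF assms(1)]] assms(2)
  by (auto elim!: continuous_on_subset)

text \<open>Both come from differentiating the Poisson formula for \<open>u\<close> in the radius at
  \<open>s = 1\<close>, once in its Poisson form and once in its Newtonian form. This demands no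
  second derivatives of \<open>euler u\<close>.\<close>

lemma poisson_formula_euler:
  assumes u: "harmonic_on (ball 0 R) u" and R: "1 < R" and y: "norm y = 1" and t: "0 < t" "t < 1"
  shows "(LINT x|\<mu>. euler u x * poisson y t x) = area * euler u (t *\<^sub>R y)"
    and "(LINT x|\<mu>. (2 * euler (euler u) x + euler u x) * newton y (t *\<^sub>R x)) = area * euler u (t *\<^sub>R y)"
proof -
  have t': "\<bar>t\<bar> < 1" and s1: "0 < (1::real)" using t by auto
  note C = harmonic_onD[OF u]
  have ty: "(1 * t) *\<^sub>R y \<in> ball 0 R" using t R y by simp
  have d: "((\<lambda>s. s * t) has_real_derivative t) (at 1)"
    by (auto intro!: derivative_eq_intros)
  have rhs: "((\<lambda>s. area * u ((s * t) *\<^sub>R y)) has_real_derivative area * euler u (t *\<^sub>R y)) (at 1)"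
    using DERIV_cmult[OF DERIV_dilation[of u "\<lambda>s. s * t", OF C1_onD(1)[OF C(2) ty] d], of area] t by simp
  have op: "(1::real) \<in> {0<..<R}" using R by simp
  have "((\<lambda>s. LINT x|\<mu>. u (s *\<^sub>R x) * poisson y t x) has_real_derivative
      (LINT x|\<mu>. euler u (1 *\<^sub>R x) * poisson y t x) / 1) (at 1)"
    by (rule pairing_DERIV[OF C(2) s1 R newton_scaled(3)[OF y t']])
  moreover have "((\<lambda>s. LINT x|\<mu>. u (s *\<^sub>R x) * poisson y t x) has_real_derivative area * euler u (t *\<^sub>R y)) (at 1)"
    by (rule has_field_derivative_transform_within_open[OF rhs open_greaterThanLessThan op])
      (simp add: poisson_formula[OF u _ _ y t])
  ultimately show "(LINT x|\<mu>. euler u x * poisson y t x) = area * euler u (t *\<^sub>R y)"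
    using DERIV_unique by fastforce
  \<comment> \<open>\<open>v\<close> is \<open>(2 E + 1) u\<close>, the density in
    \<open>poisson_integral_by_newton\<close>.\<close>
  define v where "v x = 2 * euler u x + u x" for x
  have v: "C1_on (ball 0 R) v" and ev: "\<And>x. x \<in> ball 0 R \<Longrightarrow> euler v x = 2 * euler (euler u) x + euler u x"
  proof -
    have der: "(v has_derivative (\<lambda>h. h \<bullet> (2 *\<^sub>R grad (euler u) x + grad u x))) (at x)" if "x \<in> ball 0 R" for x
      unfolding v_def
      using has_derivative_add[OF has_derivative_scaleR_right[OF has_derivative_grad[OF C1_onD(1)[OF C(3) that]], of 2]
          has_derivative_grad[OF C1_onD(1)[OF C(2) that]]]
      by (simp add: inner_add_right)
    show "C1_on (ball 0 R) v"
      by (rule C1_onI, rule der) (auto intro!: continuous_intros C1_onD(2) C)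
    show "euler v x = 2 * euler (euler u) x + euler u x" if "x \<in> ball 0 R" for x
      by (simp add: euler_def[of v] grad_eqI[OF der[OF that]] inner_add_right euler_def[of "euler u"] euler_def[of u])
  qed
  have "((\<lambda>s. LINT x|\<mu>. v (s *\<^sub>R x) * newton y (t *\<^sub>R x)) has_real_derivative
      (LINT x|\<mu>. euler v (1 *\<^sub>R x) * newton y (t *\<^sub>R x)) / 1) (at 1)"
    by (rule pairing_DERIV[OF v s1 R newton_scaled(1)[OF y t']])
  moreover have "((\<lambda>s. LINT x|\<mu>. v (s *\<^sub>R x) * newton y (t *\<^sub>R x)) has_real_derivative area * euler u (t *\<^sub>R y)) (at 1)"
    by (rule has_field_derivative_transform_within_open[OF rhs open_greaterThanLessThan op])
      (simp add: v_def poisson_integral_by_newton[OF u _ _ y t, symmetric] poisson_formula[OF u _ _ y t])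
  ultimately have "(LINT x|\<mu>. euler v x * newton y (t *\<^sub>R x)) = area * euler u (t *\<^sub>R y)"
    using DERIV_unique by fastforce
  moreover have "(LINT x|\<mu>. euler v x * newton y (t *\<^sub>R x))
      = (LINT x|\<mu>. (2 * euler (euler u) x + euler u x) * newton y (t *\<^sub>R x))"
    by (rule lint_cong) (use R in \<open>simp_all add: ev\<close>)
  ultimately show "(LINT x|\<mu>. (2 * euler (euler u) x + euler u x) * newton y (t *\<^sub>R x)) = area * euler u (t *\<^sub>R y)"
    by simp
qed

text \<open>The potential of a vector field on the sphere. Its kernel is the gradient in \<open>x\<close> of
  \<open>1 / norm (x - y)\<close>; hence it annihilates one Hardy space on each side of the sphere, and it is
  singular only on the support of the field.\<close>

definition potential :: "(real^3 \<Rightarrow> real^3) \<Rightarrow> real^3 \<Rightarrow> real" where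
  "potential f y = (LINT x|\<mu>. f x \<bullet> newton_grad y x)"

lemma norm_diff_scaled:
  fixes x y :: "real^3"
  assumes "norm x = 1" "norm y = 1"
  shows "norm (x - t *\<^sub>R y) = norm (t *\<^sub>R x - y)"
proof (rule power2_eq_imp_eq)
  show "(norm (x - t *\<^sub>R y))\<^sup>2 = (norm (t *\<^sub>R x - y))\<^sup>2"
    using norm_scaled_diff_squared[OF assms(2,1), of t] norm_scaled_diff_squared[OF assms, of t]
    by (simp add: norm_minus_commute[of x] inner_commute[of y])
qed auto

text \<open>Expresses boundary value and normal derivative of a Newtonian kernel with inner pole by
  the kernels \<open>N\<close> and \<open>P\<close> with pole on the sphere. As \<open>P\<close>
  acts like \<open>(2 n + 1) N\<close> in degree \<open>n\<close>, \<open>- (N + P) / 2\<close> is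
  the factor \<open>- (n + 1)\<close> of an exterior harmonic.\<close>

lemma newton_inside:
  assumes x: "norm x = 1" and y: "norm y = 1" and t: "0 < t" "t < 1"
  shows "newton (t *\<^sub>R y) x = newton y (t *\<^sub>R x)"
    and "euler (newton (t *\<^sub>R y)) x = - (newton y (t *\<^sub>R x) + poisson y t x) / 2"
proof -
  define r where "r = norm (t *\<^sub>R x - y)"
  have r: "norm (x - t *\<^sub>R y) = r" by (simp add: r_def norm_diff_scaled[OF x y])
  have "\<bar>t\<bar> < 1" using t by simp
  from scaled_neq_unit[OF x y this] have r0: "r > 0" by (simp add: r_def)
  have r2: "r\<^sup>2 = t\<^sup>2 - 2 * t * (x \<bullet> y) + 1"
    unfolding r_def by (rule norm_scaled_diff_squared[OF x y])
  show "newton (t *\<^sub>R y) x = newton y (t *\<^sub>R x)"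
    by (simp add: newton_def r r_def[symmetric])
  have ne: "x \<noteq> t *\<^sub>R y" using r r0 by auto
  have "euler (newton (t *\<^sub>R y)) x = (t * (x \<bullet> y) - 1) / r ^ 3"
    using x by (simp add: euler_newton[OF ne] newton_grad_def r inner_diff_right dot_square_norm)
  also have "\<dots> = - (r\<^sup>2 + (1 - t\<^sup>2)) / r ^ 3 / 2"
    using r0 by (simp add: r2 field_simps)
  also have "\<dots> = - (newton y (t *\<^sub>R x) + poisson y t x) / 2"
    using r0 by (simp add: newton_def poisson_def r_def[symmetric] field_simps power2_eq_square power3_eq_cube)
  finally show "euler (newton (t *\<^sub>R y)) x = - (newton y (t *\<^sub>R x) + poisson y t x) / 2" .
qed

text \<open>The counterpart for an outer pole: \<open>(P - N) / 2\<close> is the factor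
  \<open>n\<close> of an interior harmonic, and the extra \<open>t\<close> is the Kelvin
  factor.\<close>

lemma newton_outside:
  assumes x: "norm x = 1" and y: "norm y = 1" and t: "0 < t" "t < 1"
  shows "newton ((1 / t) *\<^sub>R y) x = t * newton y (t *\<^sub>R x)"
    and "euler (newton ((1 / t) *\<^sub>R y)) x = t * (poisson y t x - newton y (t *\<^sub>R x)) / 2"
proof -
  define r where "r = norm (t *\<^sub>R x - y)"
  have "x - (1 / t) *\<^sub>R y = (1 / t) *\<^sub>R (t *\<^sub>R x - y)"
    using t by (simp add: algebra_simps)
  then have r: "norm (x - (1 / t) *\<^sub>R y) = r / t" using t by (simp add: r_def)
  have "\<bar>t\<bar> < 1" using t by simp
  from scaled_neq_unit[OF x y this] have r0: "r > 0" by (simp add: r_def)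
  have r2: "r\<^sup>2 = t\<^sup>2 - 2 * t * (x \<bullet> y) + 1"
    unfolding r_def by (rule norm_scaled_diff_squared[OF x y])
  show "newton ((1 / t) *\<^sub>R y) x = t * newton y (t *\<^sub>R x)"
    by (simp add: newton_def r r_def[symmetric])
  have ne: "x \<noteq> (1 / t) *\<^sub>R y" using r r0 t by auto
  have "euler (newton ((1 / t) *\<^sub>R y)) x = ((x \<bullet> y) / t - 1) * t ^ 3 / r ^ 3"
    using x by (simp add: euler_newton[OF ne] newton_grad_def r inner_diff_right dot_square_norm power_divide)
  also have "\<dots> = t * (2 * t * (x \<bullet> y) - 2 * t\<^sup>2) / r ^ 3 / 2"
    using t r0 by (simp add: field_simps power2_eq_square power3_eq_cube)
  also have "2 * t * (x \<bullet> y) - 2 * t\<^sup>2 = (1 - t\<^sup>2) - r\<^sup>2"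
    by (simp add: r2)
  also have "t * ((1 - t\<^sup>2) - r\<^sup>2) / r ^ 3 / 2 = t * (poisson y t x - newton y (t *\<^sub>R x)) / 2"
    using r0 by (simp add: newton_def poisson_def r_def[symmetric] field_simps power2_eq_square power3_eq_cube)
  finally show "euler (newton ((1 / t) *\<^sub>R y)) x = t * (poisson y t x - newton y (t *\<^sub>R x)) / 2" .
qed

lemma potential_grad_eq:
  assumes u: "harmonic_on (ball 0 R) u" and R: "1 < R" and y: "norm y \<noteq> 1"
  shows "potential (grad u) y
    = (LINT x|\<mu>. euler u x * euler (newton y) x + (euler (euler u) x + euler u x) * newton y x)"
proof -
  have S: "sphere 0 1 \<subseteq> ball (0::real^3) R" "sphere 0 1 \<subseteq> - {y}" using R y by auto
  have "potential (grad u) y = (LINT x|\<mu>. grad u x \<bullet> grad (newton y) x)"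
    unfolding potential_def by (rule lint_cong) (use y in \<open>auto intro!: arg_cong[of _ _ "(\<bullet>) _"] grad_newton[symmetric]\<close>)
  also have "\<dots> = (LINT x|\<mu>. euler u x * euler (newton y) x + (euler (euler u) x + euler u x) * newton y x)"
    by (rule integral_grad_inner_grad[OF open_ball S(1) u _ S(2) C1_newton]) auto
  finally show ?thesis .
qed

text \<open>Let \<open>A\<close> and \<open>B\<close> be the two integrals of
  \<open>poisson_formula_euler\<close>. The potential is \<open>(A - B) / 2\<close> inside and
  \<open>t * (A + B) / 2\<close> outside, while both integrals equal
  \<open>area * euler u (t *\<^sub>R y)\<close>: they cancel inside and add up outside.\<close>

lemma potential_grad:
  assumes u: "harmonic_on (ball 0 R) u" and R: "1 < R" and y: "norm y = 1" and t: "0 < t" "t < 1"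
  shows potential_grad_inside: "potential (grad u) (t *\<^sub>R y) = 0"
    and potential_grad_outside: "potential (grad u) ((1 / t) *\<^sub>R y) = t * area * euler u (t *\<^sub>R y)"
proof -
  have t': "\<bar>t\<bar> < 1" using t by simp
  let ?N = "\<lambda>x. newton y (t *\<^sub>R x)" and ?P = "poisson y t"
  let ?A = "\<lambda>x. (2 * euler (euler u) x + euler u x) * ?N x" and ?B = "\<lambda>x. euler u x * ?P x"
  have i: "integrable \<mu> ?A" "integrable \<mu> ?B"
    by (intro surface_integrable continuous_intros harmonic_sphere[OF u R]
        newton_scaled[OF y t'])+
  note AB = poisson_formula_euler[OF u R y t]
  have "potential (grad u) (t *\<^sub>R y) = (LINT x|\<mu>. (?A x - ?B x) / 2)"
  proof (subst potential_grad_eq[OF u R])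
    show "norm (t *\<^sub>R y) \<noteq> 1" using t y by simp
    show "(LINT x|\<mu>. euler u x * euler (newton (t *\<^sub>R y)) x + (euler (euler u) x + euler u x) * newton (t *\<^sub>R y) x)
      = (LINT x|\<mu>. (?A x - ?B x) / 2)"
      by (rule lint_cong) (simp_all add: newton_inside[OF _ y t] field_simps)
  qed
  then show "potential (grad u) (t *\<^sub>R y) = 0"
    using i AB by simp
  have "potential (grad u) ((1 / t) *\<^sub>R y) = (LINT x|\<mu>. t * ((?A x + ?B x) / 2))"
  proof (subst potential_grad_eq[OF u R])
    show "norm ((1 / t) *\<^sub>R y) \<noteq> 1" using t y by simp
    show "(LINT x|\<mu>. euler u x * euler (newton ((1 / t) *\<^sub>R y)) x + (euler (euler u) x + euler u x) * newton ((1 / t) *\<^sub>R y) x)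
      = (LINT x|\<mu>. t * ((?A x + ?B x) / 2))"
      by (rule lint_cong) (simp_all add: newton_outside[OF _ y t] field_simps)
  qed
  also have "\<dots> = t * (((LINT x|\<mu>. ?A x) + (LINT x|\<mu>. ?B x)) / 2)"
    using i by simp
  finally show "potential (grad u) ((1 / t) *\<^sub>R y) = t * area * euler u (t *\<^sub>R y)"
    by (simp add: AB)
qed

text \<open>On the sphere this field is the gradient of the Kelvin transform of \<open>p\<close>.\<close>

definition exterior_field :: "nat \<Rightarrow> (real^3 \<Rightarrow> real) \<Rightarrow> real^3 \<Rightarrow> real^3" where
  "exterior_field n p x = grad p x - ((2 * real n + 1) * p x) *\<^sub>R x"

lemma homogeneous_euler:
  assumes p: "harmonic_on UNIV p" and hom: "\<And>t x. p (t *\<^sub>R x) = t ^ n * p x"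
  shows "euler p x = real n * p x" "euler (euler p) x = (real n)\<^sup>2 * p x"
proof -
  have d: "p differentiable (at x)" for x
    using C1_onD(1)[OF harmonic_onD(2)[OF p]] by simp
  have e: "euler p x = real n * p x" for x
  proof -
    have "((\<lambda>t. p (t *\<^sub>R x)) has_real_derivative euler p x) (at 1)"
      using DERIV_dilation[OF d DERIV_ident, of 1 x] by simp
    moreover have "((\<lambda>t. p (t *\<^sub>R x)) has_real_derivative real n * p x) (at 1)"
      unfolding hom by (auto intro!: derivative_eq_intros)
    ultimately show ?thesis by (rule DERIV_unique)
  qed
  show "euler p x = real n * p x" by (rule e)
  have "((\<lambda>x. real n * p x) has_derivative (\<lambda>h. h \<bullet> (real n *\<^sub>R grad p x))) (at x)"
    using has_derivative_mult_right[OF has_derivative_grad[OF d[of x]], of "real n"] by simp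
  then have "grad (euler p) x = real n *\<^sub>R grad p x"
    unfolding e by (rule grad_eqI)
  then show "euler (euler p) x = (real n)\<^sup>2 * p x"
    using e[of x] by (simp add: euler_def[of "euler p"] euler_def[of p, symmetric] power2_eq_square)
qed

text \<open>The gradient part is covered by \<open>potential_grad\<close>. The radial part pairs
  \<open>p\<close> with the normal derivative of the Newtonian kernel, which the two Poisson
  integrals evaluate: \<open>area * p (t *\<^sub>R y)\<close> is the pairing of \<open>p\<close>
  with \<open>P\<close> and also \<open>2 n + 1\<close> times its pairing with
  \<open>N\<close>.\<close>

lemma potential_exterior_field:
  assumes p: "harmonic_on UNIV p" and hom: "\<And>t x. p (t *\<^sub>R x) = t ^ n * p x"
    and y: "norm y = 1" and t: "0 < t" "t < 1"
  shows potential_exterior_field_inside: "potential (exterior_field n p) (t *\<^sub>R y) = (real n + 1) * area * p (t *\<^sub>R y)"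
    and potential_exterior_field_outside: "potential (exterior_field n p) ((1 / t) *\<^sub>R y) = 0"
proof -
  have t': "\<bar>t\<bar> < 1" using t by simp
  have u: "harmonic_on (ball 0 2) p" by (rule harmonic_on_subset[OF p]) simp
  have R: "1 < (2::real)" by simp
  note E = homogeneous_euler[OF p hom]
  let ?N = "\<lambda>x. newton y (t *\<^sub>R x)" and ?P = "poisson y t"
  have P: "(LINT x|\<mu>. p x * ?P x) = area * p (t *\<^sub>R y)"
    using poisson_formula[OF u zero_less_one R y t] by simp
  have "(LINT x|\<mu>. p x * ?P x) = (LINT x|\<mu>. (2 * real n + 1) * (p x * ?N x))"
    using poisson_integral_by_newton[OF u zero_less_one R y t] by (simp add: E algebra_simps)
  then have N: "(2 * real n + 1) * (LINT x|\<mu>. p x * ?N x) = area * p (t *\<^sub>R y)"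
    by (simp add: P)
  have i: "integrable \<mu> (\<lambda>x. p x * ?N x)" "integrable \<mu> (\<lambda>x. p x * ?P x)"
    by (intro surface_integrable continuous_intros harmonic_sphere[OF u R]
        newton_scaled[OF y t'])+
  have split: "potential (exterior_field n p) z
      = potential (grad p) z - (2 * real n + 1) * (LINT x|\<mu>. p x * euler (newton z) x)"
    if z: "norm z \<noteq> 1" for z
  proof -
    have S: "sphere 0 1 \<subseteq> - {z}" using z by auto
    have c: "continuous_on (sphere 0 1) (newton_grad z)" "continuous_on (sphere 0 1) (euler (newton z))"
      by (rule continuous_on_subset[OF continuous_newton_grad S],
          rule continuous_on_subset[OF continuous_euler[OF C1_newton] S])
    have i: "integrable \<mu> (\<lambda>x. grad p x \<bullet> newton_grad z x)" "integrable \<mu> (\<lambda>x. p x * euler (newton z) x)"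
      by (intro surface_integrable continuous_intros harmonic_sphere[OF u R] c)+
    have "potential (exterior_field n p) z
        = (LINT x|\<mu>. grad p x \<bullet> newton_grad z x - (2 * real n + 1) * (p x * euler (newton z) x))"
      unfolding potential_def
    proof (rule lint_cong)
      fix x assume "x \<in> space \<mu>"
      then have "x \<noteq> z" using S by auto
      then show "exterior_field n p x \<bullet> newton_grad z x
          = grad p x \<bullet> newton_grad z x - (2 * real n + 1) * (p x * euler (newton z) x)"
        by (simp add: exterior_field_def inner_diff_left euler_newton)
    qed simp
    then show ?thesis using i by (simp add: potential_def)
  qed
  have "(LINT x|\<mu>. p x * euler (newton (t *\<^sub>R y)) x) = (LINT x|\<mu>. - (p x * ?N x + p x * ?P x) / 2)"
    by (rule lint_cong) (simp_all add: newton_inside[OF _ y t] algebra_simps)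
  also have "\<dots> = - ((LINT x|\<mu>. p x * ?N x) + area * p (t *\<^sub>R y)) / 2"
    using i P by simp
  finally have in1: "(LINT x|\<mu>. p x * euler (newton (t *\<^sub>R y)) x) = - ((LINT x|\<mu>. p x * ?N x) + area * p (t *\<^sub>R y)) / 2" .
  have "potential (exterior_field n p) (t *\<^sub>R y)
      = ((2 * real n + 1) * (LINT x|\<mu>. p x * ?N x) + (2 * real n + 1) * (area * p (t *\<^sub>R y))) / 2"
    using split[of "t *\<^sub>R y"] t y by (simp add: potential_grad_inside[OF u R y t] in1 field_simps)
  also have "\<dots> = (real n + 1) * area * p (t *\<^sub>R y)"
    unfolding N by (simp add: algebra_simps)
  finally show "potential (exterior_field n p) (t *\<^sub>R y) = (real n + 1) * area * p (t *\<^sub>R y)" .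
  have "(LINT x|\<mu>. p x * euler (newton ((1 / t) *\<^sub>R y)) x) = (LINT x|\<mu>. t * ((p x * ?P x - p x * ?N x) / 2))"
    by (rule lint_cong) (simp_all add: newton_outside[OF _ y t] algebra_simps)
  also have "\<dots> = t * ((area * p (t *\<^sub>R y) - (LINT x|\<mu>. p x * ?N x)) / 2)"
    using i P by simp
  finally have out1: "(LINT x|\<mu>. p x * euler (newton ((1 / t) *\<^sub>R y)) x) = t * ((area * p (t *\<^sub>R y) - (LINT x|\<mu>. p x * ?N x)) / 2)" .
  have "potential (exterior_field n p) ((1 / t) *\<^sub>R y)
      = t * area * (real n * p (t *\<^sub>R y))
        - t * ((2 * real n + 1) * (area * p (t *\<^sub>R y)) - (2 * real n + 1) * (LINT x|\<mu>. p x * ?N x)) / 2"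
    using split[of "(1 / t) *\<^sub>R y"] t y by (simp add: potential_grad_outside[OF u R y t] out1 E algebra_simps)
  also have "\<dots> = 0"
    unfolding N by (simp add: algebra_simps)
  finally show "potential (exterior_field n p) ((1 / t) *\<^sub>R y) = 0" .
qed

section \<open>Complex continuation along lines\<close>

text \<open>\<open>line_sq x y e\<close> extends \<open>t \<mapsto> (norm (x - (y + t *\<^sub>R e)))\<^sup>2\<close> to complex \<open>t\<close>, so that
  potentials can be continued analytically along lines.\<close>

definition line_sq :: "real^3 \<Rightarrow> real^3 \<Rightarrow> real^3 \<Rightarrow> complex \<Rightarrow> complex" where
  "line_sq x y e z = of_real ((x - y) \<bullet> (x - y)) - 2 * of_real ((x - y) \<bullet> e) * z + of_real (e \<bullet> e) * z\<^sup>2"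

text \<open>The principal branch of the power \<open>- 3/2\<close> of \<open>line_sq\<close>; it
  continues \<open>1 / |x - (y + t e)|\<^sup>3\<close> as long as \<open>line_sq\<close> avoids the
  nonpositive reals. This is the branch condition carried by the holomorphy lemmas below.\<close>

definition line_kernel :: "real^3 \<Rightarrow> real^3 \<Rightarrow> real^3 \<Rightarrow> complex \<Rightarrow> complex" where
  "line_kernel x y e z = exp (- (3 / 2) * Ln (line_sq x y e z))"

definition line_integral :: "(real^3 \<Rightarrow> real) \<Rightarrow> real^3 \<Rightarrow> real^3 \<Rightarrow> complex \<Rightarrow> complex" where
  "line_integral h y e z = (LINT x|\<mu>. h x *\<^sub>R line_kernel x y e z)"

lemma line_sq_of_real: "line_sq x y e (of_real t) = of_real ((norm (x - (y + t *\<^sub>R e)))\<^sup>2)"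
proof -
  have "(norm (x - (y + t *\<^sub>R e)))\<^sup>2 = (x - y) \<bullet> (x - y) - 2 * ((x - y) \<bullet> e) * t + e \<bullet> e * t\<^sup>2"
    unfolding power2_norm_eq_inner
    by (simp add: inner_diff_left inner_diff_right inner_add_left inner_add_right inner_commute power2_eq_square algebra_simps)
  then show ?thesis by (simp add: line_sq_def)
qed

text \<open>Gives a geometric form of the branch condition: the real part is positive while
  \<open>|Im z| |e|\<close> is less than the distance from \<open>x\<close> to the real point
  \<open>y + Re z e\<close>.\<close>

lemma Re_line_sq: "Re (line_sq x y e z) = (norm (x - (y + Re z *\<^sub>R e)))\<^sup>2 - (Im z)\<^sup>2 * (norm e)\<^sup>2"
proof -
  have "Re (line_sq x y e z) = Re (line_sq x y e (of_real (Re z))) - (Im z)\<^sup>2 * (norm e)\<^sup>2"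
    using power2_norm_eq_inner[of e] by (simp add: line_sq_def power2_eq_square algebra_simps)
  then show ?thesis by (simp add: line_sq_of_real)
qed

lemma line_kernel_of_real:
  assumes "x \<noteq> y + t *\<^sub>R e"
  shows "line_kernel x y e (of_real t) = of_real (1 / norm (x - (y + t *\<^sub>R e)) ^ 3)"
proof -
  define r where "r = norm (x - (y + t *\<^sub>R e))"
  have r: "r > 0" using assms by (simp add: r_def)
  have "line_kernel x y e (of_real t) = exp (- (3 / 2) * of_real (ln (r\<^sup>2)))"
    using r by (simp add: line_kernel_def line_sq_of_real r_def[symmetric] Ln_of_real del: of_real_power)
  also have "\<dots> = of_real (exp (- (3 / 2) * ln (r\<^sup>2)))"
    by (simp add: exp_of_real[symmetric])
  also have "- (3 / 2) * ln (r\<^sup>2) = - (real 3 * ln r)"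
    using r by (simp add: ln_realpow)
  also have "exp (- (real 3 * ln r)) = 1 / r ^ 3"
    using r by (simp add: exp_minus exp_of_nat_mult inverse_eq_divide del: of_nat_numeral)
  finally show ?thesis by (simp add: r_def)
qed

lemma continuous_line_sq: "continuous_on S (\<lambda>w. line_sq (snd w) y e (fst w))"
  unfolding line_sq_def by (intro continuous_intros)

lemma line_integral_holomorphic:
  assumes V: "open V" and K: "compact K" "K \<subseteq> sphere 0 1"
    and h: "integrable \<mu> h" "\<And>x. x \<in> sphere 0 1 - K \<Longrightarrow> h x = 0"
    and ne: "\<And>x z. x \<in> K \<Longrightarrow> z \<in> V \<Longrightarrow> line_sq x y e z \<notin> \<real>\<^sub>\<le>\<^sub>0"
  shows "line_integral h y e holomorphic_on V"
  unfolding holomorphic_on_open[OF V]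
proof
  fix z assume z: "z \<in> V"
  let ?d = "\<lambda>z x. line_kernel x y e z
    * (- (3 / 2) * (inverse (line_sq x y e z) * (- 2 * of_real ((x - y) \<bullet> e) + 2 * of_real (e \<bullet> e) * z)))"
  have nz: "line_sq x y e z \<noteq> 0" if "x \<in> K" "z \<in> V" for x z
    using ne[OF that] by auto
  have "(line_integral h y e has_field_derivative (LINT x|\<mu>. h x *\<^sub>R ?d z x)) (at z)"
    unfolding line_integral_def[abs_def]
  proof (rule surface_has_field_derivative[OF V z K h])
    fix z x assume z: "z \<in> V" and x: "x \<in> K"
    have "((\<lambda>z. line_sq x y e z) has_field_derivative - 2 * of_real ((x - y) \<bullet> e) + 2 * of_real (e \<bullet> e) * z) (at z)"
      unfolding line_sq_def by (auto intro!: derivative_eq_intros)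
    from DERIV_chain2[OF has_field_derivative_Ln[OF ne[OF x z]] this]
    have "((\<lambda>z. - (3 / 2) * Ln (line_sq x y e z)) has_field_derivative
        - (3 / 2) * (inverse (line_sq x y e z) * (- 2 * of_real ((x - y) \<bullet> e) + 2 * of_real (e \<bullet> e) * z))) (at z)"
      by (rule DERIV_cmult)
    from DERIV_chain2[OF DERIV_exp this]
    show "((\<lambda>z. line_kernel x y e z) has_field_derivative ?d z x) (at z)"
      unfolding line_kernel_def .
  next
    note q = continuous_line_sq[of "V \<times> K" y e]
    have *: "continuous_on (V \<times> K) (\<lambda>w. line_kernel (snd w) y e (fst w))"
      unfolding line_kernel_def
      by (intro continuous_on_exp continuous_on_mult continuous_on_const continuous_on_Ln' q)
        (use ne in auto)
    show "continuous_on K (\<lambda>x. line_kernel x y e z)" if "z \<in> V" for z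
    proof -
      have "continuous_on K (\<lambda>x. (z, x))" by (intro continuous_intros)
      moreover have "(\<lambda>x. (z, x)) ` K \<subseteq> V \<times> K" using that by auto
      ultimately have "continuous_on K (\<lambda>x. line_kernel (snd (z, x)) y e (fst (z, x)))"
        by (rule continuous_on_compose2[OF *])
      then show ?thesis by simp
    qed
    have "continuous_on (V \<times> K) (\<lambda>w. - 2 * of_real ((snd w - y) \<bullet> e) + 2 * of_real (e \<bullet> e) * fst w :: complex)"
      by (intro continuous_intros)
    then have "continuous_on (V \<times> K) (\<lambda>w. ?d (fst w) (snd w))"
      by (intro continuous_on_mult continuous_on_inverse continuous_on_const * q) (use nz in auto)
    then show "continuous_on (V \<times> K) (\<lambda>(z, x). ?d z x)"
      unfolding case_prod_beta .
  qed
  then show "\<exists>f'. (line_integral h y e has_field_derivative f') (at z)" by blast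
qed

lemma line_integral_of_real:
  assumes ne: "\<And>x. x \<in> K \<Longrightarrow> x \<noteq> y + t *\<^sub>R e" and h: "\<And>x. x \<in> sphere 0 1 - K \<Longrightarrow> h x = 0"
  shows "line_integral h y e (of_real t) = of_real (LINT x|\<mu>. h x * (1 / norm (x - (y + t *\<^sub>R e)) ^ 3))"
proof -
  have "line_integral h y e (of_real t) = (LINT x|\<mu>. of_real (h x * (1 / norm (x - (y + t *\<^sub>R e)) ^ 3)))"
    unfolding line_integral_def
  proof (rule lint_cong)
    fix x assume "x \<in> space \<mu>"
    then show "h x *\<^sub>R line_kernel x y e (of_real t) = of_real (h x * (1 / norm (x - (y + t *\<^sub>R e)) ^ 3))"
      using h[of x] line_kernel_of_real[OF ne, of x] by (cases "x \<in> K") (auto simp: scaleR_conv_of_real)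
  qed simp
  then show ?thesis by (simp only: integral_complex_of_real)
qed

text \<open>Expands \<open>f x \<bullet> (p - x)\<close> at \<open>p = y + z e\<close> by
  coordinates, so that only the scalar kernel depends on \<open>z\<close> under the
  integrals.\<close>

definition line_potential :: "(real^3 \<Rightarrow> real^3) \<Rightarrow> real^3 \<Rightarrow> real^3 \<Rightarrow> complex \<Rightarrow> complex" where
  "line_potential f y e z = (\<Sum>i\<in>UNIV. (of_real (y $ i) + z * of_real (e $ i)) * line_integral (\<lambda>x. f x $ i) y e z)
     - line_integral (\<lambda>x. f x \<bullet> x) y e z"

lemma integrable_vec_nth:
  fixes f :: "'a \<Rightarrow> real^3"
  assumes "integrable M f"
  shows "integrable M (\<lambda>x. f x $ i)"
  by (rule integrable_bounded_linear[OF bounded_linear_vec_nth assms])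

lemma integrable_inner_self:
  assumes "integrable \<mu> (f :: real^3 \<Rightarrow> real^3)"
  shows "integrable \<mu> (\<lambda>x. f x \<bullet> x)"
proof (rule lint_bound[OF assms])
  have "(\<lambda>x. x) \<in> borel_measurable \<mu>"
    by (rule continuous_measurable_surface) (intro continuous_intros)
  then show "(\<lambda>x. f x \<bullet> x) \<in> borel_measurable \<mu>"
    using assms by measurable
  show "AE x in \<mu>. norm (f x \<bullet> x) \<le> norm (f x)"
    by (rule AE_I2) (metis Cauchy_Schwarz_ineq2 mem_sphere_0 mult.right_neutral real_norm_def space_surface)
qed

lemma line_potential_holomorphic:
  assumes V: "open V" and K: "compact K" "K \<subseteq> sphere 0 1"
    and f: "integrable \<mu> f" "\<And>x. x \<in> sphere 0 1 - K \<Longrightarrow> f x = 0"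
    and ne: "\<And>x z. x \<in> K \<Longrightarrow> z \<in> V \<Longrightarrow> line_sq x y e z \<notin> \<real>\<^sub>\<le>\<^sub>0"
  shows "line_potential f y e holomorphic_on V"
proof -
  have "line_integral (\<lambda>x. f x $ i) y e holomorphic_on V" for i
    by (rule line_integral_holomorphic[OF V K integrable_vec_nth[OF f(1)] _ ne]) (use f in auto)
  moreover have "line_integral (\<lambda>x. f x \<bullet> x) y e holomorphic_on V"
    by (rule line_integral_holomorphic[OF V K integrable_inner_self[OF f(1)] _ ne]) (use f in auto)
  ultimately show ?thesis
    unfolding line_potential_def[abs_def] by (intro holomorphic_intros)
qed

lemma line_potential_of_real:
  assumes K: "compact K" "K \<subseteq> sphere 0 1"
    and f: "integrable \<mu> f" "\<And>x. x \<in> sphere 0 1 - K \<Longrightarrow> f x = 0"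
    and ne: "\<And>x. x \<in> K \<Longrightarrow> x \<noteq> y + t *\<^sub>R e"
  shows "line_potential f y e (of_real t) = of_real (potential f (y + t *\<^sub>R e))"
proof -
  define p where "p = y + t *\<^sub>R e"
  define k where "k x = 1 / norm (x - p) ^ 3" for x
  have k: "continuous_on K k"
    unfolding k_def by (intro continuous_intros) (use ne in \<open>auto simp: p_def\<close>)
  have iw: "integrable \<mu> (\<lambda>x. h x * k x)"
    if "integrable \<mu> h" "\<And>x. x \<in> sphere 0 1 - K \<Longrightarrow> h x = 0" for h
    using surface_integrable_weighted[OF K that k] by (simp only: real_scaleR_def)
  have i1: "integrable \<mu> (\<lambda>x. f x $ i * k x)" for i
    by (rule iw[OF integrable_vec_nth[OF f(1)]]) (use f(2) in auto)
  have i2: "integrable \<mu> (\<lambda>x. (f x \<bullet> x) * k x)"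
    by (rule iw[OF integrable_inner_self[OF f(1)]]) (use f(2) in auto)
  have "potential f p = (LINT x|\<mu>. (\<Sum>i\<in>UNIV. p $ i * (f x $ i * k x)) - (f x \<bullet> x) * k x)"
    unfolding potential_def
  proof (rule lint_cong)
    fix x
    have "f x \<bullet> newton_grad p x = k x * (f x \<bullet> p) - (f x \<bullet> x) * k x"
      by (simp add: newton_grad_def k_def inner_diff_right right_diff_distrib)
    also have "k x * (f x \<bullet> p) = (\<Sum>i\<in>UNIV. p $ i * (f x $ i * k x))"
      by (simp add: inner_vec_def sum_distrib_left mult_ac)
    finally show "f x \<bullet> newton_grad p x = (\<Sum>i\<in>UNIV. p $ i * (f x $ i * k x)) - (f x \<bullet> x) * k x" .
  qed simp
  also have "\<dots> = (\<Sum>i\<in>UNIV. p $ i * (LINT x|\<mu>. f x $ i * k x)) - (LINT x|\<mu>. (f x \<bullet> x) * k x)"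
    using i1 i2 by (simp add: lint_sum)
  finally have *: "potential f p = (\<Sum>i\<in>UNIV. p $ i * (LINT x|\<mu>. f x $ i * k x)) - (LINT x|\<mu>. (f x \<bullet> x) * k x)" .
  have "line_integral (\<lambda>x. f x $ i) y e (of_real t) = of_real (LINT x|\<mu>. f x $ i * k x)" for i
    unfolding k_def p_def by (rule line_integral_of_real[OF ne]) (use f(2) in auto)
  moreover have "line_integral (\<lambda>x. f x \<bullet> x) y e (of_real t) = of_real (LINT x|\<mu>. (f x \<bullet> x) * k x)"
    unfolding k_def p_def by (rule line_integral_of_real[OF ne]) (use f(2) in auto)
  moreover have "of_real (y $ i) + of_real t * of_real (e $ i) = (of_real (p $ i) :: complex)" for i
    by (simp add: p_def)
  ultimately show ?thesis
    unfolding line_potential_def p_def[symmetric] * by simp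
qed

text \<open>The complexified Poisson integral: the analytic continuation of \<open>t \<mapsto> u (s *\<^sub>R (y + t *\<^sub>R e))\<close>.\<close>

definition line_poisson :: "(real^3 \<Rightarrow> real) \<Rightarrow> real \<Rightarrow> real^3 \<Rightarrow> real^3 \<Rightarrow> complex \<Rightarrow> complex" where
  "line_poisson u s y e z = (1 - line_sq 0 y e z) * line_integral (\<lambda>x. u (s *\<^sub>R x)) y e z / of_real area"

lemma line_poisson_holomorphic:
  assumes V: "open V" and u: "harmonic_on (ball 0 R) u" and s: "0 < s" "s < R"
    and ne: "\<And>x z. norm x = 1 \<Longrightarrow> z \<in> V \<Longrightarrow> line_sq x y e z \<notin> \<real>\<^sub>\<le>\<^sub>0"
  shows "line_poisson u s y e holomorphic_on V"
proof -
  have i: "integrable \<mu> (\<lambda>x. u (s *\<^sub>R x))"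
    by (rule surface_integrable[OF sphere_scaled[OF C1_onD(3)[OF harmonic_onD(2)[OF u]]]])
      (use s in auto)
  have "line_integral (\<lambda>x. u (s *\<^sub>R x)) y e holomorphic_on V"
    by (rule line_integral_holomorphic[OF V compact_sphere order_refl i]) (use ne in auto)
  then show ?thesis
    unfolding line_poisson_def[abs_def] line_sq_def using area_pos by (intro holomorphic_intros) auto
qed

text \<open>\<open>line_sq 0 y e\<close> continues \<open>|p|\<^sup>2\<close>, so the prefactor is
  the numerator of the Poisson kernel. From \<open>p \<noteq> 0\<close> comes the unit direction
  that \<open>poisson_formula\<close> asks for.\<close>

lemma line_poisson_of_real:
  assumes u: "harmonic_on (ball 0 R) u" and s: "0 < s" "s < R"
    and p: "p = y + t *\<^sub>R e" "p \<noteq> 0" "norm p < 1"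
  shows "line_poisson u s y e (of_real t) = of_real (u (s *\<^sub>R p))"
proof -
  define r where "r = norm p"
  define n where "n = (1 / r) *\<^sub>R p"
  have r: "0 < r" "r < 1" using p by (auto simp: r_def)
  have n: "norm n = 1" "p = r *\<^sub>R n" using r by (simp_all add: n_def r_def)
  have ne: "x \<noteq> y + t *\<^sub>R e" if "x \<in> sphere 0 1" for x
    using that p(3) unfolding p(1) by auto
  have "(1 - r\<^sup>2) * (LINT x|\<mu>. u (s *\<^sub>R x) * (1 / norm (x - p) ^ 3)) = (LINT x|\<mu>. (1 - r\<^sup>2) * (u (s *\<^sub>R x) * (1 / norm (x - p) ^ 3)))"
    by (rule integral_mult_right_zero[symmetric])
  also have "\<dots> = (LINT x|\<mu>. u (s *\<^sub>R x) * poisson n r x)"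
  proof (rule lint_cong)
    fix x assume "x \<in> space \<mu>"
    then have "norm (x - p) = norm (r *\<^sub>R x - n)"
      unfolding n(2) by (intro norm_diff_scaled n(1)) simp
    then show "(1 - r\<^sup>2) * (u (s *\<^sub>R x) * (1 / norm (x - p) ^ 3)) = u (s *\<^sub>R x) * poisson n r x"
      by (simp add: poisson_def)
  qed simp
  also have "\<dots> = area * u (s *\<^sub>R p)"
    unfolding n(2) using poisson_formula[OF u s n(1) r] by simp
  finally have *: "(1 - r\<^sup>2) * (LINT x|\<mu>. u (s *\<^sub>R x) * (1 / norm (x - p) ^ 3)) = area * u (s *\<^sub>R p)" .
  have "line_poisson u s y e (of_real t) = of_real ((1 - r\<^sup>2) * (LINT x|\<mu>. u (s *\<^sub>R x) * (1 / norm (x - p) ^ 3)) / area)"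
    unfolding line_poisson_def line_integral_of_real[OF ne, of "sphere 0 1" "\<lambda>x. u (s *\<^sub>R x)", simplified]
      line_sq_of_real p(1)[symmetric] by (simp add: r_def)
  then show ?thesis
    unfolding * using area_pos by simp
qed

text \<open>\<open>V\<close> consists of the \<open>z\<close> for which \<open>|Im z| |e|\<close> is
  less than the distance of the real point \<open>a + Re z e\<close> from the unit sphere;
  \<open>Re_line_sq\<close> then gives the branch condition, and convexity gives
  connectedness.\<close>

lemma segment_neighbourhood:
  fixes a b :: "real^3"
  assumes ab: "norm a < 1" "norm b < 1"
  obtains V where "open V" "connected V" "\<And>t. 0 \<le> t \<Longrightarrow> t \<le> 1 \<Longrightarrow> of_real t \<in> V"
    "\<And>x z. norm x = 1 \<Longrightarrow> z \<in> V \<Longrightarrow> line_sq x a (b - a) z \<notin> \<real>\<^sub>\<le>\<^sub>0"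
proof -
  define e where "e = b - a"
  define V where "V = {z. norm (a + Re z *\<^sub>R e) + \<bar>Im z\<bar> * norm e < 1}"
  have "open V"
    unfolding V_def by (intro open_Collect_less continuous_intros)
  moreover have "convex V"
  proof (rule convexI)
    fix z w and u v :: real
    assume z: "z \<in> V" and w: "w \<in> V" and uv: "0 \<le> u" "0 \<le> v" "u + v = 1"
    have "a + Re (u *\<^sub>R z + v *\<^sub>R w) *\<^sub>R e = u *\<^sub>R (a + Re z *\<^sub>R e) + v *\<^sub>R (a + Re w *\<^sub>R e)"
      using uv(3) by (simp add: scaleR_add_right scaleR_add_left algebra_simps flip: scaleR_add_left[of u v a])
    then have 1: "norm (a + Re (u *\<^sub>R z + v *\<^sub>R w) *\<^sub>R e) \<le> u * norm (a + Re z *\<^sub>R e) + v * norm (a + Re w *\<^sub>R e)"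
      using norm_triangle_ineq[of "u *\<^sub>R (a + Re z *\<^sub>R e)" "v *\<^sub>R (a + Re w *\<^sub>R e)"] uv by simp
    have "\<bar>Im (u *\<^sub>R z + v *\<^sub>R w)\<bar> \<le> u * \<bar>Im z\<bar> + v * \<bar>Im w\<bar>"
      using abs_triangle_ineq[of "u * Im z" "v * Im w"] uv by (simp add: abs_mult)
    then have 2: "\<bar>Im (u *\<^sub>R z + v *\<^sub>R w)\<bar> * norm e \<le> (u * \<bar>Im z\<bar> + v * \<bar>Im w\<bar>) * norm e"
      by (rule mult_right_mono) simp
    define A B where "A = norm (a + Re z *\<^sub>R e) + \<bar>Im z\<bar> * norm e" and "B = norm (a + Re w *\<^sub>R e) + \<bar>Im w\<bar> * norm e"
    have AB: "A < 1" "B < 1" using z w by (auto simp: V_def A_def B_def)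
    have "u * A + v * B < 1"
      using convex_bound_lt[OF AB uv] .
    then show "u *\<^sub>R z + v *\<^sub>R w \<in> V"
      using 1 2 unfolding V_def mem_Collect_eq A_def B_def by (simp add: algebra_simps)
  qed
  moreover have "of_real t \<in> V" if t: "0 \<le> t" "t \<le> 1" for t
  proof -
    have "a + t *\<^sub>R e = (1 - t) *\<^sub>R a + t *\<^sub>R b" by (simp add: e_def algebra_simps)
    also have "norm \<dots> \<le> (1 - t) * norm a + t * norm b"
      using norm_triangle_ineq[of "(1 - t) *\<^sub>R a" "t *\<^sub>R b"] t by simp
    also have "\<dots> < 1"
      using convex_bound_lt[OF ab, of "1 - t" t] t by simp
    finally show ?thesis by (simp add: V_def)
  qed
  moreover have "line_sq x a e z \<notin> \<real>\<^sub>\<le>\<^sub>0" if x: "norm x = 1" and z: "z \<in> V" for x z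
  proof -
    have "1 \<le> norm (x - (a + Re z *\<^sub>R e)) + norm (a + Re z *\<^sub>R e)"
      using norm_triangle_ineq[of "x - (a + Re z *\<^sub>R e)" "a + Re z *\<^sub>R e"] x by simp
    then have "\<bar>Im z\<bar> * norm e < norm (x - (a + Re z *\<^sub>R e))"
      using z by (simp add: V_def)
    then have "(\<bar>Im z\<bar> * norm e)\<^sup>2 < (norm (x - (a + Re z *\<^sub>R e)))\<^sup>2"
      by (rule power_strict_mono) auto
    then have "Re (line_sq x a e z) > 0"
      by (simp add: Re_line_sq power_mult_distrib)
    then show ?thesis by (auto simp: complex_nonpos_Reals_iff)
  qed
  ultimately show ?thesis
    using that convex_connected unfolding e_def by blast
qed

lemma holomorphic_zero_on_segment:
  assumes F: "F holomorphic_on V" and V: "open V" "connected V" "\<And>t. 0 \<le> t \<Longrightarrow> t \<le> 1 \<Longrightarrow> of_real t \<in> V"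
    and d: "d > 0" and z: "\<And>t. 0 < t \<Longrightarrow> t < d \<Longrightarrow> t < 1 \<Longrightarrow> F (of_real t) = 0"
  shows "F 1 = 0"
proof -
  define U where "U = (of_real :: real \<Rightarrow> complex) ` {0<..<min d 1}"
  show ?thesis
  proof (rule analytic_continuation[OF F V(1,2), of U 0 1])
    show "U \<subseteq> V" using V(3) by (auto simp: U_def)
    show "0 \<in> V" "1 \<in> V" using V(3)[of 0] V(3)[of 1] by simp_all
    show "0 islimpt U"
      unfolding islimpt_approachable
    proof (intro allI impI)
      fix r :: real assume "r > 0"
      then show "\<exists>x'\<in>U. x' \<noteq> 0 \<and> dist x' 0 < r"
        using d by (intro bexI[of _ "of_real (min (r / 2) (min d 1 / 2))"]) (auto simp: U_def dist_norm intro!: imageI)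
    qed
    show "F w = 0" if "w \<in> U" for w using z that by (auto simp: U_def)
  qed
qed

section \<open>Unique continuation from a patch\<close>

text \<open>For unit vectors the form is \<open>1 - 2 c z + z\<^sup>2\<close> with
  \<open>c = x \<bullet> w\<close>. Its real part may be negative in the disc, but where the
  imaginary part vanishes, either \<open>z\<close> is real or \<open>Re z = c\<close>, and then the
  real part is positive. Hence the whole disc is admissible on rays from the origin.\<close>

lemma line_sq_radial_nonneg:
  assumes x: "norm x = 1" and w: "norm w = 1" and z: "norm z < 1"
  shows "line_sq x 0 w z \<notin> \<real>\<^sub>\<le>\<^sub>0"
proof
  assume "line_sq x 0 w z \<in> \<real>\<^sub>\<le>\<^sub>0"
  then have R: "Re (line_sq x 0 w z) \<le> 0" and I: "Im (line_sq x 0 w z) = 0"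
    by (auto simp: complex_nonpos_Reals_iff)
  define a b c where "a = Re z" and "b = Im z" and "c = x \<bullet> w"
  have xx: "x \<bullet> x = 1" "w \<bullet> w = 1" using x w by (simp_all add: dot_square_norm)
  have R': "1 - 2 * c * a + a\<^sup>2 - b\<^sup>2 \<le> 0" and I': "b * (a - c) = 0"
    using R I by (simp_all add: line_sq_def xx a_def b_def c_def power2_eq_square algebra_simps)
  have ab: "a\<^sup>2 + b\<^sup>2 < 1"
    using z power_strict_mono[of "norm z" 1 2] by (simp add: cmod_power2 a_def b_def)
  have c1: "\<bar>c\<bar> \<le> 1"
    using Cauchy_Schwarz_ineq2[of x w] x w by (simp add: c_def)
  from I' consider "b = 0" | "c = a" by auto
  then show False
  proof cases
    case 1
    then have "\<bar>a\<bar> < 1" using ab by (simp add: abs_square_less_1)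
    then have "c * a \<le> \<bar>a\<bar>" and "0 < (1 - \<bar>a\<bar>)\<^sup>2"
      using mult_right_mono[OF c1, of "\<bar>a\<bar>"] abs_le_D1[of "c * a" "\<bar>c\<bar> * \<bar>a\<bar>"] by (auto simp: abs_mult)
    then show False using R' 1 by (simp add: power2_diff)
  next
    case 2
    then show False using R' ab by (simp add: power2_eq_square)
  qed
qed

lemma line_sq_near_one:
  assumes "d \<le> norm (x - w)" "norm w = 1" "dist 1 z < d / 2"
  shows "line_sq x 0 w z \<notin> \<real>\<^sub>\<le>\<^sub>0"
proof -
  \<comment> \<open>The distance \<open>d\<close> is shared evenly between the shift of the real
    part and the imaginary part.\<close>
  have a: "\<bar>Re z - 1\<bar> < d / 2" and b: "\<bar>Im z\<bar> < d / 2"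
    using assms(3) abs_Re_le_cmod[of "z - 1"] abs_Im_le_cmod[of "z - 1"] by (auto simp: dist_norm norm_minus_commute)
  have split: "(x - Re z *\<^sub>R w) + (Re z - 1) *\<^sub>R w = x - w" by (simp add: algebra_simps)
  have "norm (x - w) \<le> norm (x - Re z *\<^sub>R w) + \<bar>Re z - 1\<bar>"
    using norm_triangle_ineq[of "x - Re z *\<^sub>R w" "(Re z - 1) *\<^sub>R w"] assms(2) unfolding split by simp
  then have "\<bar>Im z\<bar> < norm (x - Re z *\<^sub>R w)"
    using a b assms(1) by linarith
  then have "\<bar>Im z\<bar>\<^sup>2 < (norm (x - Re z *\<^sub>R w))\<^sup>2"
    by (rule power_strict_mono) auto
  then have "Re (line_sq x 0 w z) > 0"
    using assms(2) by (simp add: Re_line_sq)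
  then show ?thesis by (auto simp: complex_nonpos_Reals_iff)
qed

lemma real_islimpt_complex:
  assumes "d > 0"
  shows "(1 :: complex) islimpt of_real ` {1<..<1 + d}"
  unfolding islimpt_approachable
proof (intro allI impI)
  fix r :: real assume "r > 0"
  define m where "m = min (r / 2) (d / 2)"
  have m: "0 < m" "m < r" "m < d" using assms \<open>r > 0\<close> by (auto simp: m_def)
  have "dist (of_real (1 + m)) (1::complex) < r" "of_real (1 + m) \<noteq> (1::complex)"
    using m by (auto simp: dist_norm)
  moreover have "(of_real (1 + m) :: complex) \<in> of_real ` {1<..<1 + d}"
    using m by (intro imageI) simp
  ultimately show "\<exists>x'\<in>of_real ` {1<..<1 + d}. x' \<noteq> 1 \<and> dist x' (1::complex) < r" by blast
qed

text \<open>The inside restriction of the potential and the Kelvin transform of \<open>euler u\<close>, restricted to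
  the ray through a point \<open>w\<close> off the support, glue to an entire function that vanishes at infinity.\<close>

lemma radial_continuation:
  assumes K: "compact K" "K \<subseteq> sphere 0 1"
    and f: "integrable \<mu> f" "\<And>x. x \<in> sphere 0 1 - K \<Longrightarrow> f x = 0"
    and w: "norm w = 1" and d: "d > 0" "\<And>x. x \<in> K \<Longrightarrow> d \<le> norm (x - w)"
    and u: "harmonic_on (ball 0 R) u" and s: "1 < s" "s < R"
    and out: "\<And>t. 0 < t \<Longrightarrow> t < 1 \<Longrightarrow> potential f ((1 / t) *\<^sub>R w) = t * area * euler u (t *\<^sub>R w)"
  shows "0 < t \<Longrightarrow> t < 1 \<Longrightarrow> potential f (t *\<^sub>R w) = 0"
    and "0 < t \<Longrightarrow> t < s \<Longrightarrow> euler u (t *\<^sub>R w) = 0"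
proof -
  have s0: "0 < s" using s by simp
  have w0: "w \<noteq> 0" using w by auto
  \<comment> \<open>Rescaled so that \<open>U\<close> continues
    \<open>t \<mapsto> u (t *\<^sub>R w)\<close> to the disc of radius \<open>s\<close>, which
    exceeds the unit disc.\<close>
  define U where "U z = line_poisson u s 0 w (z / of_real s)" for z
  have lp: "line_poisson u s 0 w holomorphic_on ball 0 1"
    by (rule line_poisson_holomorphic[OF open_ball u s0 s(2)]) (rule line_sq_radial_nonneg[OF _ w]; simp)
  have U: "U holomorphic_on ball 0 s"
    unfolding U_def[abs_def]
    by (rule holomorphic_on_compose_gen[OF _ lp, unfolded o_def])
      (use s0 in \<open>auto intro!: holomorphic_intros simp: norm_divide\<close>)
  \<comment> \<open>Continues \<open>euler u (t *\<^sub>R w) / t\<close>, the radial derivative of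
    \<open>u\<close>.\<close>
  define D where "D = deriv U"
  have D: "D holomorphic_on ball 0 s"
    unfolding D_def by (rule holomorphic_deriv[OF U open_ball])
  have D_real: "D (of_real t) = of_real (euler u (t *\<^sub>R w) / t)" if t: "0 < t" "t < s" for t
  proof -
    have "(U has_field_derivative D (of_real t)) (at (of_real t))"
      unfolding D_def by (rule holomorphic_derivI[OF U open_ball]) (use t in auto)
    then have 1: "((\<lambda>t. U (of_real t)) has_vector_derivative D (of_real t)) (at t)"
      by (rule has_vector_derivative_real_field)
    have "t *\<^sub>R w \<in> ball 0 R" using t s w by simp
    from DERIV_dilation[OF C1_onD(1)[OF harmonic_onD(2)[OF u] this] DERIV_ident]
    have "((\<lambda>t. u (t *\<^sub>R w)) has_real_derivative euler u (t *\<^sub>R w) / t) (at t)"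
      using t by simp
    then have "((\<lambda>t. u (t *\<^sub>R w)) has_vector_derivative euler u (t *\<^sub>R w) / t) (at t)"
      by (simp add: has_real_derivative_iff_has_vector_derivative)
    from bounded_linear.has_vector_derivative[OF bounded_linear_of_real this]
    have "((\<lambda>t. complex_of_real (u (t *\<^sub>R w))) has_vector_derivative of_real (euler u (t *\<^sub>R w) / t)) (at t)" .
    then have "((\<lambda>t. U (of_real t)) has_vector_derivative of_real (euler u (t *\<^sub>R w) / t)) (at t)"
    proof (rule has_vector_derivative_transform_within_open[OF _ open_greaterThanLessThan[of 0 s]])
      show "t \<in> {0<..<s}" using t by simp
      show "complex_of_real (u (t *\<^sub>R w)) = U (complex_of_real t)" if "t \<in> {0<..<s}" for t
        using line_poisson_of_real[OF u s0 s(2), of "(t / s) *\<^sub>R w" 0 "t / s" w] that w s0 w0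
        by (auto simp: U_def)
    qed
    from vector_derivative_unique_at[OF 1 this] show ?thesis .
  qed
  \<comment> \<open>The bound \<open>d / 2\<close> keeps the disc around \<open>1\<close> clear of
    the singularities from \<open>K\<close>; the bound \<open>1 - 1 / s\<close> keeps it inside the
    domain of the Kelvin transform.\<close>
  define \<delta> where "\<delta> = min (d / 2) (1 - 1 / s)"
  have \<delta>: "\<delta> > 0" using d s by (simp add: \<delta>_def)
  have \<delta>2: "\<delta> \<le> d / 2" "\<delta> \<le> 1 - 1 / s"
    unfolding \<delta>_def by (rule min.cobounded1, rule min.cobounded2)
  have "1 / s > 0" using s0 by simp
  define V where "V = ball 0 1 \<union> ball (1::complex) \<delta>"
  define E where "E = {z :: complex. 1 / s < norm z}"
  have V: "open V" by (simp add: V_def open_Un)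
  have E: "open E" unfolding E_def by (intro open_Collect_less continuous_intros)
  have E0: "z \<noteq> 0" "inverse z \<in> ball 0 s" if "z \<in> E" for z
  proof -
    have "norm z > 0" using that \<open>1 / s > 0\<close> unfolding E_def by (metis less_trans mem_Collect_eq)
    then show "z \<noteq> 0" by auto
    have "1 < s * norm z" using that s0 by (simp add: E_def divide_less_eq mult.commute)
    then have "inverse (norm z) < s" using \<open>norm z > 0\<close> by (simp add: field_simps)
    then show "inverse z \<in> ball 0 s" by (simp add: norm_inverse)
  qed
  define F1 where "F1 = line_potential f 0 w"
  \<comment> \<open>At \<open>z = 1 / t\<close> this is
    \<open>area * t\<^sup>2 * (euler u (t *\<^sub>R w) / t)\<close>, the right-hand side of
    \<open>out\<close>; the variable is inverted as in the Kelvin transform.\<close>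
  define F2 where "F2 z = of_real area * (inverse z)\<^sup>2 * D (inverse z)" for z
  have F1: "F1 holomorphic_on V"
    unfolding F1_def
  proof (rule line_potential_holomorphic[OF V K f])
    fix x z assume x: "x \<in> K" and z: "z \<in> V"
    have "norm x = 1" using K x by auto
    then show "line_sq x 0 w z \<notin> \<real>\<^sub>\<le>\<^sub>0"
      using z line_sq_radial_nonneg[OF _ w, of x z] line_sq_near_one[OF d(2)[OF x] w, of z] \<delta>2(1)
      by (auto simp: V_def)
  qed
  have F1_real: "F1 (of_real t) = of_real (potential f (t *\<^sub>R w))" if "0 < t" "t \<noteq> 1" for t
  proof -
    have "x \<noteq> 0 + t *\<^sub>R w" if "x \<in> K" for x
    proof
      assume "x = 0 + t *\<^sub>R w"
      moreover have "norm x = 1" using K that by auto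
      ultimately show False using \<open>0 < t\<close> \<open>t \<noteq> 1\<close> w by simp
    qed
    then show ?thesis
      using line_potential_of_real[OF K f, of 0 t w] by (simp add: F1_def)
  qed
  have F2: "F2 holomorphic_on E"
    unfolding F2_def[abs_def]
    by (intro holomorphic_intros holomorphic_on_compose_gen[OF _ D, unfolded o_def]) (use E0 in auto)
  have dist1: "dist (1::complex) (of_real a) = \<bar>1 - a\<bar>" for a
    using dist_of_real[of 1 a, where 'a=complex] by (simp add: dist_real_def)
  define W where "W = V \<inter> E"
  have W_eq: "W = {z. 1 / s < norm (z - 0) \<and> norm (z - 0) < 1} \<union> ball 1 \<delta>"
  proof -
    have "ball 1 \<delta> \<subseteq> E"
    proof
      fix z assume "z \<in> ball (1::complex) \<delta>"
      then have "norm (1 - z) < 1 - 1 / s" using \<delta>2(2) by (simp add: dist_norm)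
      moreover have "1 \<le> norm (1 - z) + norm z" using norm_triangle_ineq[of "1 - z" z] by simp
      ultimately show "z \<in> E" by (simp add: E_def)
    qed
    then show ?thesis by (auto simp: W_def V_def E_def)
  qed
  have "connected W"
    unfolding W_eq
  proof (rule connected_Un)
    show "connected {z::complex. 1 / s < norm (z - 0) \<and> norm (z - 0) < 1}"
      by (rule connected_annulus) simp
    define a where "a = 1 - \<delta> / 2"
    have "1 / s < a" "a < 1" "0 < a" "1 - a < \<delta>"
      using \<delta> \<delta>2(2) \<open>1 / s > 0\<close> unfolding a_def by linarith+
    then have "of_real a \<in> {z::complex. 1 / s < norm (z - 0) \<and> norm (z - 0) < 1} \<inter> ball 1 \<delta>"
      by (simp add: dist1)
    then show "{z::complex. 1 / s < norm (z - 0) \<and> norm (z - 0) < 1} \<inter> ball 1 \<delta> \<noteq> {}" by blast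
  qed simp
  \<comment> \<open>Equality is given at real points slightly larger than \<open>1\<close>. The disc
    around \<open>1\<close> is the gap through which it passes to the annulus
    \<open>1 / s < |z| < 1\<close> inside the unit disc.\<close>
  have eqW: "F1 z = F2 z" if z: "z \<in> W" for z
  proof -
    have "F1 z - F2 z = 0"
    proof (rule analytic_continuation[of "\<lambda>z. F1 z - F2 z" W "of_real ` {1<..<1 + \<delta>}" 1 z])
      show "(\<lambda>z. F1 z - F2 z) holomorphic_on W"
        unfolding W_def by (intro holomorphic_intros holomorphic_on_subset[OF F1] holomorphic_on_subset[OF F2]) auto
      show "open W" using V E by (simp add: W_def open_Int)
      show "connected W" by fact
      show "of_real ` {1<..<1 + \<delta>} \<subseteq> W" unfolding W_eq by (auto simp: dist1)
      show "1 \<in> W" using \<delta> by (simp add: W_eq)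
      show "1 islimpt (of_real ` {1<..<1 + \<delta>} :: complex set)" by (rule real_islimpt_complex[OF \<delta>])
      show "z \<in> W" by fact
      fix y :: complex assume "y \<in> of_real ` {1<..<1 + \<delta>}"
      then obtain r where r: "y = of_real r" "1 < r" by auto
      define t where "t = 1 / r"
      have t: "0 < t" "t < 1" "r = 1 / t" using r by (auto simp: t_def)
      have ts: "t < s" using t s by linarith
      have "F1 y = of_real (t * area * euler u (t *\<^sub>R w))"
        using F1_real[of r] r t out[OF t(1,2)] by simp
      also have "\<dots> = F2 y"
        unfolding F2_def r(1) t(3) using t(1) D_real[OF t(1) ts]
        by (simp add: field_simps power2_eq_square flip: of_real_inverse)
      finally show "F1 y - F2 y = 0" by simp
    qed
    then show ?thesis by simp
  qed
  define F where "F z = (if norm z < 1 then F1 z else F2 z)" for z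
  have FE: "F z = F2 z" if "z \<in> E" for z
    using eqW[of z] that by (auto simp: F_def W_def V_def)
  have "F holomorphic_on ball 0 1 \<union> E"
  proof (rule holomorphic_on_Un[OF _ _ open_ball E])
    show "F holomorphic_on ball 0 1"
      by (rule holomorphic_transform[OF holomorphic_on_subset[OF F1]]) (auto simp: F_def V_def)
    show "F holomorphic_on E"
      by (rule holomorphic_transform[OF F2]) (simp add: FE)
  qed
  moreover have "ball 0 1 \<union> E = UNIV"
  proof -
    have "1 / s < 1" using s by simp
    then show ?thesis by (auto simp: E_def not_less)
  qed
  ultimately have F: "F holomorphic_on UNIV" by simp
  \<comment> \<open>\<open>D (inverse z)\<close> tends to the finite value \<open>D 0\<close>, so
    the factor \<open>(inverse z)\<^sup>2\<close> forces the limit \<open>0\<close>.\<close>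
  have "(F \<longlongrightarrow> 0) at_infinity"
  proof (rule Lim_transform_eventually)
    have "isCont D 0"
      using holomorphic_on_imp_continuous_on[OF D] s0 by (simp add: continuous_on_eq_continuous_at)
    from isCont_tendsto_compose[OF this tendsto_inverse_0]
    have "((\<lambda>z. of_real area * (inverse z)\<^sup>2 * D (inverse z)) \<longlongrightarrow> of_real area * 0\<^sup>2 * D 0) at_infinity"
      by (intro tendsto_intros tendsto_inverse_0)
    then show "(F2 \<longlongrightarrow> 0) at_infinity" by (simp add: F2_def[abs_def])
    show "\<forall>\<^sub>F z in at_infinity. F2 z = F z"
      unfolding eventually_at_infinity by (rule exI[of _ 1]) (auto simp: F_def)
  qed
  then have zero: "F z = 0" for z by (rule Liouville_weak_0[OF F])
  show "potential f (t *\<^sub>R w) = 0" if "0 < t" "t < 1" for t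
    using zero[of "of_real t"] F1_real[of t] that by (simp add: F_def)
  show "euler u (t *\<^sub>R w) = 0" if t: "0 < t" "t < s" for t
  proof -
    have "of_real (1 / t) \<in> E" using t s0 by (simp add: E_def norm_divide field_simps)
    then have "F2 (of_real (1 / t)) = 0" using FE zero by metis
    then have "D (of_real t) = 0" using t area_pos by (simp add: F2_def)
    then show ?thesis using D_real[OF t] t by simp
  qed
qed

text \<open>The radial projection is continuous at the starting point
  \<open>(1 / 2) *\<^sub>R a\<close> and takes the value \<open>a\<close> there, so an initial piece
  of the segment towards \<open>b\<close> stays in the cone over \<open>U\<close>.\<close>

lemma open_patch_segment:
  fixes a b :: "real^3"
  assumes U: "openin (top_of_set (sphere 0 1)) U" and a: "a \<in> U"
  obtains e where "e > 0" "\<And>t. 0 < t \<Longrightarrow> t < e \<Longrightarrow>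
    (\<exists>r w. w \<in> U \<and> 0 < r \<and> r < 1 \<and> (1 / 2) *\<^sub>R a + t *\<^sub>R (b - (1 / 2) *\<^sub>R a) = r *\<^sub>R w)"
proof -
  define g where "g t = (1 / 2) *\<^sub>R a + t *\<^sub>R (b - (1 / 2) *\<^sub>R a)" for t :: real
  have na: "norm a = 1" using U a openin_imp_subset by fastforce
  obtain d where d: "d > 0" "\<And>y. y \<in> sphere 0 1 \<Longrightarrow> dist y a < d \<Longrightarrow> y \<in> U"
    using U a unfolding openin_euclidean_subtopology_iff by blast
  have g0: "norm (g 0) = 1 / 2" by (simp add: g_def na)
  have cg: "isCont g 0" unfolding g_def by (intro continuous_intros)
  have "isCont (\<lambda>t. (1 / norm (g t)) *\<^sub>R g t) 0"
    using g0 by (intro continuous_intros cg) auto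
  then have "\<forall>\<^sub>F t in at 0. dist ((1 / norm (g t)) *\<^sub>R g t) ((1 / norm (g 0)) *\<^sub>R g 0) < d"
    unfolding isCont_def using d(1) by (rule tendstoD)
  moreover have "(1 / norm (g 0)) *\<^sub>R g 0 = a" by (simp add: g0) (simp add: g_def)
  \<comment> \<open>As \<open>g 0\<close> has norm \<open>1 / 2\<close>, this keeps the norm of
    \<open>g t\<close> strictly between \<open>0\<close> and \<open>1\<close>.\<close>
  moreover have "\<forall>\<^sub>F t in at 0. dist (g t) (g 0) < 1 / 4"
    using cg unfolding isCont_def by (rule tendstoD) simp
  ultimately have "\<forall>\<^sub>F t in at 0. dist ((1 / norm (g t)) *\<^sub>R g t) a < d \<and> dist (g t) (g 0) < 1 / 4"
    by (simp add: eventually_conj)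
  then obtain e where e: "e > 0"
    "\<And>t. t \<noteq> 0 \<Longrightarrow> dist t 0 < e \<Longrightarrow> dist ((1 / norm (g t)) *\<^sub>R g t) a < d \<and> dist (g t) (g 0) < 1 / 4"
    unfolding eventually_at by auto
  show ?thesis
  proof (rule that[OF e(1)])
    fix t :: real assume t: "0 < t" "t < e"
    then have *: "dist ((1 / norm (g t)) *\<^sub>R g t) a < d" "dist (g t) (g 0) < 1 / 4"
      using e(2)[of t] by auto
    have "\<bar>norm (g t) - norm (g 0)\<bar> < 1 / 4"
      using *(2) norm_triangle_ineq3[of "g t" "g 0"] by (simp add: dist_norm)
    then have r: "0 < norm (g t)" "norm (g t) < 1" unfolding g0 by linarith+
    show "\<exists>r w. w \<in> U \<and> 0 < r \<and> r < 1 \<and> (1 / 2) *\<^sub>R a + t *\<^sub>R (b - (1 / 2) *\<^sub>R a) = r *\<^sub>R w"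
      unfolding g_def[symmetric]
      by (rule exI[of _ "norm (g t)"], rule exI[of _ "(1 / norm (g t)) *\<^sub>R g t"]) (use r d(2)[OF _ *(1)] in auto)
  qed
qed

text \<open>From the cone over an open patch to the whole ball: \<open>F y e\<close> continues \<open>\<phi>\<close> along the
  line through \<open>y\<close> with direction \<open>e\<close>.\<close>

lemma zero_from_patch:
  fixes F :: "real^3 \<Rightarrow> real^3 \<Rightarrow> complex \<Rightarrow> complex" and \<phi> :: "real^3 \<Rightarrow> real"
  assumes hol: "\<And>V y e. open V \<Longrightarrow> (\<And>x z. norm x = 1 \<Longrightarrow> z \<in> V \<Longrightarrow> line_sq x y e z \<notin> \<real>\<^sub>\<le>\<^sub>0) \<Longrightarrow> F y e holomorphic_on V"
    and real: "\<And>y e t. y + t *\<^sub>R e \<noteq> 0 \<Longrightarrow> norm (y + t *\<^sub>R e) < 1 \<Longrightarrow> F y e (of_real t) = of_real (\<phi> (y + t *\<^sub>R e))"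
    and U: "openin (top_of_set (sphere 0 1)) U" "U \<noteq> {}"
    and z: "\<And>w t. w \<in> U \<Longrightarrow> 0 < t \<Longrightarrow> t < 1 \<Longrightarrow> \<phi> (t *\<^sub>R w) = 0"
    and b: "norm b < 1" "b \<noteq> 0"
  shows "\<phi> b = 0"
proof -
  obtain a where a: "a \<in> U" using U by blast
  have unit: "norm w = 1" if "w \<in> U" for w using U(1) that openin_imp_subset by fastforce
  define y e where "y = (1 / 2) *\<^sub>R a" and "e = b - y"
  obtain V where V: "open V" "connected V" "\<And>t. 0 \<le> t \<Longrightarrow> t \<le> 1 \<Longrightarrow> of_real t \<in> V"
    "\<And>x z. norm x = 1 \<Longrightarrow> z \<in> V \<Longrightarrow> line_sq x y e z \<notin> \<real>\<^sub>\<le>\<^sub>0"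
    using segment_neighbourhood[of y b] unit[OF a] b(1) by (auto simp: y_def e_def)
  obtain d where d: "d > 0" "\<And>t. 0 < t \<Longrightarrow> t < d \<Longrightarrow> (\<exists>r w. w \<in> U \<and> 0 < r \<and> r < 1 \<and> y + t *\<^sub>R e = r *\<^sub>R w)"
    using open_patch_segment[OF U(1) a, of b] unfolding y_def e_def by metis
  have "F y e 1 = 0"
  proof (rule holomorphic_zero_on_segment[OF hol[OF V(1,4)] V(1-3) d(1)])
    fix t :: real assume t: "0 < t" "t < d"
    from d(2)[OF t] obtain r w where rw: "w \<in> U" "0 < r" "r < 1" "y + t *\<^sub>R e = r *\<^sub>R w" by blast
    have "r *\<^sub>R w \<noteq> 0" "norm (r *\<^sub>R w) < 1" using rw unit[OF rw(1)] by auto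
    then show "F y e (of_real t) = 0"
      using real[of y t e] z[OF rw(1-3)] by (simp add: rw(4))
  qed
  then show ?thesis using real[of y 1 e] b by (simp add: e_def)
qed

lemma potential_zero_from_patch:
  assumes K: "compact K" "K \<subseteq> sphere 0 1"
    and f: "integrable \<mu> f" "\<And>x. x \<in> sphere 0 1 - K \<Longrightarrow> f x = 0"
    and U: "openin (top_of_set (sphere 0 1)) U" "U \<noteq> {}"
    and z: "\<And>w t. w \<in> U \<Longrightarrow> 0 < t \<Longrightarrow> t < 1 \<Longrightarrow> potential f (t *\<^sub>R w) = 0"
    and b: "norm b < 1" "b \<noteq> 0"
  shows "potential f b = 0"
proof (rule zero_from_patch[of "line_potential f" "potential f", OF _ _ U z b])
  show "line_potential f y e holomorphic_on V"
    if "open V" "\<And>x z. norm x = 1 \<Longrightarrow> z \<in> V \<Longrightarrow> line_sq x y e z \<notin> \<real>\<^sub>\<le>\<^sub>0" for V y e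
    by (rule line_potential_holomorphic[OF that(1) K f]) (use that(2) K in auto)
  show "line_potential f y e (of_real t) = of_real (potential f (y + t *\<^sub>R e))"
    if "norm (y + t *\<^sub>R e) < 1" for y e t
    by (rule line_potential_of_real[OF K f]) (use that K in auto)
qed

text \<open>The continuation along lines is supplied by the Poisson integral of \<open>u\<close>
  over the sphere of radius \<open>s\<close>, after rescaling to the unit ball.\<close>

lemma harmonic_constant_from_patch:
  assumes u: "harmonic_on (ball 0 R) u" and s: "0 < s" "s < R"
    and U: "openin (top_of_set (sphere 0 1)) U" "U \<noteq> {}"
    and c: "\<And>w t. w \<in> U \<Longrightarrow> 0 < t \<Longrightarrow> t < s \<Longrightarrow> u (t *\<^sub>R w) = c"
    and y: "norm y < s" "y \<noteq> 0"
  shows "u y = c"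
proof -
  have "u (s *\<^sub>R ((1 / s) *\<^sub>R y)) - c = 0"
  proof (rule zero_from_patch[of "\<lambda>y e z. line_poisson u s y e z - of_real c" "\<lambda>p. u (s *\<^sub>R p) - c", OF _ _ U])
    show "(\<lambda>z. line_poisson u s y e z - of_real c) holomorphic_on V"
      if "open V" "\<And>x z. norm x = 1 \<Longrightarrow> z \<in> V \<Longrightarrow> line_sq x y e z \<notin> \<real>\<^sub>\<le>\<^sub>0" for V y e
      by (intro holomorphic_intros line_poisson_holomorphic[OF that(1) u s that(2)])
    show "line_poisson u s y e (of_real t) - of_real c = of_real (u (s *\<^sub>R (y + t *\<^sub>R e)) - c)"
      if "y + t *\<^sub>R e \<noteq> 0" "norm (y + t *\<^sub>R e) < 1" for y e t
      using line_poisson_of_real[OF u s refl that] by simp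
    show "u (s *\<^sub>R t *\<^sub>R w) - c = 0" if "w \<in> U" "0 < t" "t < 1" for w t
      using c[OF that(1), of "s * t"] that s by simp
  qed (use y s in auto)
  then show ?thesis using s by simp
qed

section \<open>Square-integrable fields\<close>

lemma L2_surface_integrable:
  fixes f :: "real^3 \<Rightarrow> real^3"
  assumes "f \<in> L2_fun \<mu>"
  shows "integrable \<mu> f" "integrable \<mu> (\<lambda>x. (norm (f x))\<^sup>2)" "f \<in> borel_measurable \<mu>"
proof -
  show m: "f \<in> borel_measurable \<mu>" and i: "integrable \<mu> (\<lambda>x. (norm (f x))\<^sup>2)"
    using assms by (auto simp: L2_fun_def)
  show "integrable \<mu> f"
  proof (rule lint_bound[OF _ m])
    show "integrable \<mu> (\<lambda>x. 1 + (norm (f x))\<^sup>2)" using i by simp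
    show "AE x in \<mu>. norm (f x) \<le> norm (1 + (norm (f x))\<^sup>2)"
    proof (rule AE_I2)
      fix x
      show "norm (f x) \<le> norm (1 + (norm (f x))\<^sup>2)"
        using sum_squares_ge_zero[of "1 - norm (f x)" "norm (f x)"]
        by (simp add: power2_eq_square algebra_simps)
    qed
  qed
qed

lemma L2_surface_diff:
  fixes f g :: "real^3 \<Rightarrow> real^3"
  assumes "f \<in> L2_fun \<mu>" "continuous_on (sphere 0 1) g"
  shows "(\<lambda>x. f x - g x) \<in> L2_fun \<mu>" "integrable \<mu> (\<lambda>x. f x \<bullet> g x)"
proof -
  note F = L2_surface_integrable[OF assms(1)]
  obtain B where B: "\<And>x. norm x = 1 \<Longrightarrow> norm (g x) \<le> B"
    using compact_imp_bounded[OF compact_continuous_image[OF assms(2) compact_sphere]]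
    unfolding bounded_iff by force
  show i: "integrable \<mu> (\<lambda>x. f x \<bullet> g x)"
  proof (rule lint_bound[where f="\<lambda>x. B *\<^sub>R f x"])
    show "integrable \<mu> (\<lambda>x. B *\<^sub>R f x)" using F by simp
    show "(\<lambda>x. f x \<bullet> g x) \<in> borel_measurable \<mu>"
      using F(3) continuous_measurable_surface[OF assms(2)] by measurable
    show "AE x in \<mu>. norm (f x \<bullet> g x) \<le> norm (B *\<^sub>R f x)"
    proof (rule AE_I2)
      fix x assume "x \<in> space \<mu>"
      then have "norm (g x) \<le> \<bar>B\<bar>" using B[of x] by simp
      then show "norm (f x \<bullet> g x) \<le> norm (B *\<^sub>R f x)"
        using Cauchy_Schwarz_ineq2[of "f x" "g x"] mult_left_mono[of "norm (g x)" "\<bar>B\<bar>" "norm (f x)"]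
        by (simp add: mult.commute)
    qed
  qed
  have "(norm (f x - g x))\<^sup>2 = (norm (f x))\<^sup>2 - 2 * (f x \<bullet> g x) + (norm (g x))\<^sup>2" for x
    by (simp add: power2_norm_eq_inner inner_diff_left inner_diff_right inner_commute)
  moreover have "integrable \<mu> (\<lambda>x. (norm (g x))\<^sup>2)"
    by (intro surface_integrable continuous_intros assms)
  ultimately show "(\<lambda>x. f x - g x) \<in> L2_fun \<mu>"
    using F i continuous_measurable_surface[OF assms(2)] by (simp add: L2_fun_def)
qed

text \<open>Instead of the Cauchy-Schwarz inequality: \<open>2 * n \<le> n\<^sup>2 / e + e\<close>.\<close>

lemma L1_norm_le_L2_norm:
  fixes h :: "real^3 \<Rightarrow> real^3"
  assumes h: "h \<in> L2_fun \<mu>" and e: "e > 0" "L2_norm \<mu> h < e"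
  shows "(LINT x|\<mu>. norm (h x)) \<le> e * (1 + area) / 2"
proof -
  note H = L2_surface_integrable[OF h]
  have "norm (h x) \<le> ((norm (h x))\<^sup>2 / e + e) / 2" for x
  proof -
    have "0 \<le> (norm (h x) - e)\<^sup>2 / e" using e by simp
    also have "\<dots> = (norm (h x))\<^sup>2 / e + e - 2 * norm (h x)"
      using e by (simp add: field_simps power2_eq_square)
    finally show ?thesis by simp
  qed
  then have "(LINT x|\<mu>. norm (h x)) \<le> (LINT x|\<mu>. ((norm (h x))\<^sup>2 / e + e) / 2)"
    by (intro integral_mono) (use H in auto)
  also have "\<dots> = ((LINT x|\<mu>. (norm (h x))\<^sup>2) / e + e * area) / 2"
    using H by (simp add: area_def)
  also have "(LINT x|\<mu>. (norm (h x))\<^sup>2) / e \<le> e"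
  proof -
    have "0 \<le> (LINT x|\<mu>. (norm (h x))\<^sup>2)" by simp
    then have "(LINT x|\<mu>. (norm (h x))\<^sup>2) \<le> e\<^sup>2"
      using e power_strict_mono[of "L2_norm \<mu> h" e 2] by (simp add: L2_norm_def)
    then show ?thesis using e by (simp add: divide_le_eq power2_eq_square)
  qed
  finally show ?thesis by (simp add: algebra_simps)
qed

lemma integral_inner_bound:
  fixes h k :: "real^3 \<Rightarrow> real^3"
  assumes h: "h \<in> L2_fun \<mu>" and e: "e > 0" "L2_norm \<mu> h < e"
    and k: "continuous_on (sphere 0 1) k" "\<And>x. norm x = 1 \<Longrightarrow> norm (k x) \<le> B"
  shows "\<bar>LINT x|\<mu>. h x \<bullet> k x\<bar> \<le> B * (e * (1 + area) / 2)"
proof -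
  have B: "B \<ge> 0" using order_trans[OF norm_ge_zero k(2)[of "axis 1 1"]] by simp
  have "\<bar>LINT x|\<mu>. h x \<bullet> k x\<bar> \<le> (LINT x|\<mu>. \<bar>h x \<bullet> k x\<bar>)"
    by (rule integral_abs_bound)
  also have "\<dots> \<le> (LINT x|\<mu>. B * norm (h x))"
  proof (rule integral_mono)
    show "integrable \<mu> (\<lambda>x. \<bar>h x \<bullet> k x\<bar>)"
      using L2_surface_diff(2)[OF h k(1)] by simp
    show "integrable \<mu> (\<lambda>x. B * norm (h x))"
      using L2_surface_integrable(1)[OF h] by simp
    fix x assume "x \<in> space \<mu>"
    then show "\<bar>h x \<bullet> k x\<bar> \<le> B * norm (h x)"
      using Cauchy_Schwarz_ineq2[of "h x" "k x"] mult_left_mono[OF k(2)[of x], of "norm (h x)"]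
      by (simp add: mult.commute)
  qed
  also have "\<dots> = B * (LINT x|\<mu>. norm (h x))" by simp
  also have "\<dots> \<le> B * (e * (1 + area) / 2)"
    by (rule mult_left_mono[OF L1_norm_le_L2_norm[OF h e] B])
  finally show ?thesis .
qed

lemma real_zero_if_bounded_by_multiples:
  fixes a C :: real
  assumes "\<And>e. e > 0 \<Longrightarrow> \<bar>a\<bar> \<le> e * C"
  shows "a = 0"
proof (rule ccontr)
  assume a: "a \<noteq> 0"
  define e where "e = \<bar>a\<bar> / (2 * (\<bar>C\<bar> + 1))"
  have e: "e > 0" using a by (simp add: e_def)
  have "\<bar>a\<bar> \<le> e * (\<bar>C\<bar> + 1)"
    using assms[OF e] mult_left_mono[of C "\<bar>C\<bar> + 1" e] e by linarith
  also have "\<dots> = \<bar>a\<bar> / 2" by (simp add: e_def field_simps)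
  finally show False using a by simp
qed

text \<open>Pairing with a continuous field is continuous in the \<open>L\<^sup>2\<close> norm, so
  vanishing on the generators passes to the closure.\<close>

lemma L2_closed_span_annihilator:
  fixes G :: "'i \<Rightarrow> real^3 \<Rightarrow> real^3"
  assumes f: "f \<in> L2_closed_span \<mu> I G" and G: "\<And>i. i \<in> I \<Longrightarrow> continuous_on (sphere 0 1) (G i)"
    and k: "continuous_on (sphere 0 1) k" and z: "\<And>i. i \<in> I \<Longrightarrow> (LINT x|\<mu>. G i x \<bullet> k x) = 0"
  shows "(LINT x|\<mu>. f x \<bullet> k x) = 0"
proof -
  obtain B where B: "\<And>x. norm x = 1 \<Longrightarrow> norm (k x) \<le> B"
    using compact_imp_bounded[OF compact_continuous_image[OF k compact_sphere]]
    unfolding bounded_iff by force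
  have f2: "f \<in> L2_fun \<mu>" using f by (simp add: L2_closed_span_def)
  show ?thesis
  proof (rule real_zero_if_bounded_by_multiples)
    fix e :: real assume e: "e > 0"
    with f obtain F c where F: "finite F" "F \<subseteq> I" "L2_norm \<mu> (\<lambda>x. f x - (\<Sum>i\<in>F. c i *\<^sub>R G i x)) < e"
      unfolding L2_closed_span_def by blast
    have cS: "continuous_on (sphere 0 1) (\<lambda>x. \<Sum>i\<in>F. c i *\<^sub>R G i x)"
      using F G by (intro continuous_intros) auto
    have iG: "integrable \<mu> (\<lambda>x. G i x \<bullet> k x)" if "i \<in> F" for i
      using that F G by (intro surface_integrable continuous_intros k) auto
    have "(LINT x|\<mu>. (\<Sum>i\<in>F. c i *\<^sub>R G i x) \<bullet> k x) = (\<Sum>i\<in>F. c i * (LINT x|\<mu>. G i x \<bullet> k x))"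
      using iG by (simp add: inner_sum_left lint_sum)
    also have "\<dots> = 0" using z F by (intro sum.neutral) auto
    finally have "(LINT x|\<mu>. f x \<bullet> k x) = (LINT x|\<mu>. (f x - (\<Sum>i\<in>F. c i *\<^sub>R G i x)) \<bullet> k x)"
      using L2_surface_diff(2)[OF f2 k] surface_integrable[OF continuous_on_inner[OF cS k]]
      by (simp add: inner_diff_left)
    also have "\<bar>\<dots>\<bar> \<le> B * (e * (1 + area) / 2)"
      by (rule integral_inner_bound[OF L2_surface_diff(1)[OF f2 cS] e F(3) k B])
    finally show "\<bar>LINT x|\<mu>. f x \<bullet> k x\<bar> \<le> e * (B * (1 + area) / 2)"
      by (simp add: algebra_simps)
  qed
qed

text \<open>Every approximant \<open>S\<close> is orthogonal to \<open>f\<close>, so Pythagoras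
  bounds the norm of \<open>f\<close> by that of \<open>f - S\<close>, which is arbitrarily
  small.\<close>

lemma L2_closed_span_orthogonal_zero:
  fixes G :: "'i \<Rightarrow> real^3 \<Rightarrow> real^3"
  assumes f: "f \<in> L2_closed_span \<mu> I G" and G: "\<And>i. i \<in> I \<Longrightarrow> continuous_on (sphere 0 1) (G i)"
    and z: "\<And>i. i \<in> I \<Longrightarrow> (LINT x|\<mu>. f x \<bullet> G i x) = 0"
  shows "AE x in \<mu>. f x = 0"
proof -
  have f2: "f \<in> L2_fun \<mu>" using f by (simp add: L2_closed_span_def)
  note F2 = L2_surface_integrable[OF f2]
  have "(LINT x|\<mu>. (norm (f x))\<^sup>2) \<le> e\<^sup>2" if e: "e > 0" for e
  proof -
    from f e obtain F c where F: "finite F" "F \<subseteq> I" "L2_norm \<mu> (\<lambda>x. f x - (\<Sum>i\<in>F. c i *\<^sub>R G i x)) < e"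
      unfolding L2_closed_span_def by blast
    define S where "S x = (\<Sum>i\<in>F. c i *\<^sub>R G i x)" for x
    have cS: "continuous_on (sphere 0 1) S"
      unfolding S_def using F G by (intro continuous_intros) auto
    note D = L2_surface_diff[OF f2 cS]
    have iG: "integrable \<mu> (\<lambda>x. f x \<bullet> G i x)" if "i \<in> F" for i
      using that F G by (intro L2_surface_diff(2)[OF f2]) auto
    have fS: "(LINT x|\<mu>. f x \<bullet> S x) = 0"
    proof -
      have "(LINT x|\<mu>. f x \<bullet> S x) = (\<Sum>i\<in>F. c i * (LINT x|\<mu>. f x \<bullet> G i x))"
        unfolding S_def using iG by (simp add: inner_sum_right lint_sum)
      also have "\<dots> = 0" using z F by (intro sum.neutral) auto
      finally show ?thesis .
    qed
    have iS: "integrable \<mu> (\<lambda>x. (norm (S x))\<^sup>2)"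
      by (intro surface_integrable continuous_intros cS)
    have "(norm (f x - S x))\<^sup>2 = (norm (f x))\<^sup>2 - 2 * (f x \<bullet> S x) + (norm (S x))\<^sup>2" for x
      by (simp add: power2_norm_eq_inner inner_diff_left inner_diff_right inner_commute)
    then have "(LINT x|\<mu>. (norm (f x - S x))\<^sup>2) = (LINT x|\<mu>. (norm (f x))\<^sup>2) + (LINT x|\<mu>. (norm (S x))\<^sup>2)"
      using F2 D(2) iS fS by simp
    moreover have "(LINT x|\<mu>. (norm (f x - S x))\<^sup>2) \<le> e\<^sup>2"
    proof -
      have n: "0 \<le> (LINT x|\<mu>. (norm (f x - S x))\<^sup>2)" by simp
      have "L2_norm \<mu> (\<lambda>x. f x - S x) \<le> e" using F(3) by (simp add: S_def)
      then have "(L2_norm \<mu> (\<lambda>x. f x - S x))\<^sup>2 \<le> e\<^sup>2"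
        by (intro power_mono) (auto simp: L2_norm_def n)
      then show ?thesis using n by (simp add: L2_norm_def)
    qed
    moreover have "0 \<le> (LINT x|\<mu>. (norm (S x))\<^sup>2)" by simp
    ultimately show ?thesis by linarith
  qed
  then have "(LINT x|\<mu>. (norm (f x))\<^sup>2) \<le> e" if "e > 0" for e :: real
    using that real_sqrt_gt_zero[of e] real_sqrt_pow2[of e] by (metis less_imp_le)
  then have "(LINT x|\<mu>. (norm (f x))\<^sup>2) \<le> 0"
    by (metis add_0 field_le_epsilon)
  moreover have "0 \<le> (LINT x|\<mu>. (norm (f x))\<^sup>2)" by simp
  ultimately have "(LINT x|\<mu>. (norm (f x))\<^sup>2) = 0" by linarith
  then have "AE x in \<mu>. (norm (f x))\<^sup>2 = 0"
    using F2 by (subst (asm) integral_nonneg_eq_0_iff_AE) auto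
  then show ?thesis by simp
qed

lemma L2_class_eqI:
  assumes "f \<in> L2_fun M" "g \<in> L2_fun M" "AE x in M. f x = g x"
  shows "L2_class M f = L2_class M g"
proof -
  have "(AE x in M. f x = h x) \<longleftrightarrow> (AE x in M. g x = h x)" for h
    using assms(3) by (auto elim: AE_mp)
  then show ?thesis
    using assms by (auto simp: L2_class_def L2_eq_def)
qed

lemma mem_L2_class: "g \<in> L2_class M f \<longleftrightarrow> f \<in> L2_fun M \<and> g \<in> L2_fun M \<and> (AE x in M. f x = g x)"
  by (auto simp: L2_class_def L2_eq_def)

lemma continuous_L2_surface:
  fixes f :: "real^3 \<Rightarrow> real^3"
  assumes "continuous_on (sphere 0 1) f"
  shows "f \<in> L2_fun \<mu>"
proof -
  have "integrable \<mu> (\<lambda>x. (norm (f x))\<^sup>2)"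
    by (intro surface_integrable continuous_intros assms)
  then show ?thesis
    using continuous_measurable_surface[OF assms] by (simp add: L2_fun_def)
qed

lemma zero_L2_fun [simp]: "(\<lambda>x. 0) \<in> L2_fun M"
  by (simp add: L2_fun_def)

section \<open>The exterior Hardy space\<close>

lemma spherical_harmonic_extension:
  assumes "spherical_harmonic n f"
  obtains p where "harmonic_on UNIV p" "\<And>t x. p (t *\<^sub>R x) = t ^ n * p x" "\<And>x. norm x = 1 \<Longrightarrow> f x = p x"
  using assms unfolding spherical_harmonic_def by auto

text \<open>Away from \<open>0\<close> the radial extension of \<open>f\<close> is
  \<open>p y / |y|\<^sup>n\<close>; the subtracted term comes from differentiating the
  denominator.\<close>

lemma surface_grad_homogeneous:
  assumes p: "harmonic_on UNIV p" and hom: "\<And>t x. p (t *\<^sub>R x) = t ^ n * p x"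
    and f: "\<And>x. norm x = 1 \<Longrightarrow> f x = p x" and x: "norm x = 1"
  shows "surface_grad 1 f x = grad p x - (real n * p x) *\<^sub>R x"
proof -
  have x0: "x \<noteq> 0" using x by auto
  have dp: "(p has_derivative (\<lambda>h. h \<bullet> grad p x)) (at x)"
    by (rule has_derivative_grad[OF C1_onD(1)[OF harmonic_onD(2)[OF p]]]) simp
  have dn: "((\<lambda>x. 1 / norm x ^ n) has_derivative (\<lambda>h. h \<bullet> ((- real n) *\<^sub>R x))) (at x)"
  proof (cases "n = 0")
    case False
    then show ?thesis
      using has_derivative_inverse_dist_power[OF x0, of n] x by simp
  qed simp
  have "((\<lambda>y. 1 / norm y ^ n * p y) has_derivative (\<lambda>h. h \<bullet> (grad p x - (real n * p x) *\<^sub>R x))) (at x)"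
    using has_derivative_mult[OF dn dp] x by (simp add: inner_diff_right algebra_simps)
  then have "(radial_ext 1 f has_derivative (\<lambda>h. h \<bullet> (grad p x - (real n * p x) *\<^sub>R x))) (at x)"
  proof (rule has_derivative_transform_within_open[where s="- {0}"])
    fix y :: "real^3" assume "y \<in> - {0}"
    then show "1 / norm y ^ n * p y = radial_ext 1 f y"
      using f[of "(1 / norm y) *\<^sub>R y"] by (simp add: radial_ext_def hom power_one_over)
  qed (use x0 in auto)
  then show ?thesis
    unfolding surface_grad_def by (rule grad_eqI)
qed

text \<open>The polynomial factor covers arbitrary degrees; for \<open>n = m\<close> it equals
  \<open>(n + 1) * (2 n + 1)\<close>, and for two different basis elements the integral on the right
  vanishes.\<close>

lemma integral_exterior_field_inner:
  assumes p: "harmonic_on UNIV p" "\<And>t x. p (t *\<^sub>R x) = t ^ n * p x"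
    and q: "harmonic_on UNIV q" "\<And>t x. q (t *\<^sub>R x) = t ^ m * q x"
  shows "(LINT x|\<mu>. exterior_field n p x \<bullet> exterior_field m q x)
    = (real n * real m + (real n)\<^sup>2 + real n - (2 * real m + 1) * real n - (2 * real n + 1) * real m
        + (2 * real n + 1) * (2 * real m + 1)) * (LINT x|\<mu>. p x * q x)"
proof -
  have R: "1 < (2::real)" by simp
  have hp: "harmonic_on (ball 0 2) p" and hq: "harmonic_on (ball 0 2) q"
    using harmonic_on_subset p q by auto
  note c = harmonic_sphere[OF hp R] harmonic_sphere[OF hq R]
  note E = homogeneous_euler[OF p] homogeneous_euler[OF q]
  define A where "A = real n * real m + (real n)\<^sup>2 + real n"
  define B where "B = (2 * real n + 1) * (2 * real m + 1) - (2 * real m + 1) * real n - (2 * real n + 1) * real m"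
  have i: "integrable \<mu> (\<lambda>x. p x * q x)" "integrable \<mu> (\<lambda>x. grad p x \<bullet> grad q x)"
    by (intro surface_integrable continuous_intros c)+
  have "(LINT x|\<mu>. grad p x \<bullet> grad q x)
      = (LINT x|\<mu>. euler p x * euler q x + (euler (euler p) x + euler p x) * q x)"
    by (rule integral_grad_inner_grad[OF open_UNIV _ p(1) open_UNIV]) (use harmonic_onD(2)[OF q(1)] in auto)
  also have "\<dots> = (LINT x|\<mu>. A * (p x * q x))"
    by (rule lint_cong) (simp_all add: E A_def algebra_simps)
  finally have g: "(LINT x|\<mu>. grad p x \<bullet> grad q x) = A * (LINT x|\<mu>. p x * q x)" by simp
  have "exterior_field n p x \<bullet> exterior_field m q x = grad p x \<bullet> grad q x + B * (p x * q x)" if x: "norm x = 1" for x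
  proof -
    have xx: "x \<bullet> x = 1" using x by (simp add: dot_square_norm)
    have e: "grad p x \<bullet> x = real n * p x" "x \<bullet> grad q x = real m * q x"
      using E(1)[of x] E(3)[of x] by (simp_all add: euler_def inner_commute)
    show ?thesis
      by (simp add: exterior_field_def inner_diff_left inner_diff_right xx e B_def algebra_simps)
  qed
  then have "(LINT x|\<mu>. exterior_field n p x \<bullet> exterior_field m q x)
      = (LINT x|\<mu>. grad p x \<bullet> grad q x + B * (p x * q x))"
    by (intro lint_cong) auto
  also have "\<dots> = (A + B) * (LINT x|\<mu>. p x * q x)"
    using i g by (simp add: distrib_right)
  finally show ?thesis by (simp add: A_def B_def algebra_simps)
qed

text \<open>The kernel has norm \<open>1 / |x - y|\<^sup>2\<close>, and a point of norm
  \<open>1 / 2\<close> has distance at least \<open>1 / 2\<close> from the sphere.\<close>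

lemma newton_grad_bound:
  assumes x: "norm x = 1" and w: "norm w = 1"
  shows "norm (newton_grad ((1 / 2) *\<^sub>R w) x) \<le> 4"
proof -
  define y where "y = (1 / 2) *\<^sub>R w"
  define r where "r = norm (x - y)"
  have r: "1 / 2 \<le> r"
    using norm_triangle_ineq2[of x y] x w by (simp add: r_def y_def)
  have "norm (newton_grad y x) = 1 / r ^ 3 * r"
    by (simp add: newton_grad_def r_def norm_minus_commute)
  also have "\<dots> = (1 / r)\<^sup>2"
    using r by (simp add: power2_eq_square power3_eq_cube)
  also have "\<dots> \<le> 2\<^sup>2"
    using r by (intro power_mono) (auto simp: field_simps)
  finally show ?thesis by (simp add: y_def)
qed

text \<open>The \<open>Y n k\<close> are prescribed on the sphere only; the homogeneous extensions
  \<open>P\<close> provide functions with Euclidean gradients and a known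
  \<open>euler\<close>.\<close>

locale harmonic_basis =
  fixes Y :: "nat \<Rightarrow> int \<Rightarrow> real^3 \<Rightarrow> real" and P :: "nat \<times> int \<Rightarrow> real^3 \<Rightarrow> real"
  assumes P: "i \<in> sh_index \<Longrightarrow> harmonic_on UNIV (P i)"
    and P_hom: "i \<in> sh_index \<Longrightarrow> P i (t *\<^sub>R x) = t ^ fst i * P i x"
    and P_eq: "i \<in> sh_index \<Longrightarrow> norm x = 1 \<Longrightarrow> Y (fst i) (snd i) x = P i x"
    and P_orth: "i \<in> sh_index \<Longrightarrow> j \<in> sh_index \<Longrightarrow> (LINT x|\<mu>. P i x * P j x) = (if i = j then 1 else 0)"
begin

definition G :: "nat \<times> int \<Rightarrow> real^3 \<Rightarrow> real^3" where
  "G = (\<lambda>(n, k). G_int Y n k)"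

text \<open>The surface gradient removes \<open>n * P i x\<close> in the normal direction and
  \<open>G_int\<close> a further \<open>(n + 1) * P i x\<close>; together they make the coefficient
  \<open>2 n + 1\<close> of \<open>exterior_field\<close>.\<close>

lemma G_eq:
  assumes i: "i \<in> sh_index" and x: "norm x = 1"
  shows "G i x = exterior_field (fst i) (P i) x"
proof -
  define m where "m = real (fst i)"
  have "v - (m * a) *\<^sub>R x - ((m + 1) * a) *\<^sub>R x = v - ((2 * m + 1) * a) *\<^sub>R x" for v a
    unfolding diff_diff_eq scaleR_add_left[symmetric] by (simp add: algebra_simps)
  then show ?thesis
    using surface_grad_homogeneous[OF P[OF i] P_hom[OF i] P_eq[OF i] x] P_eq[OF i x]
    by (simp add: G_def case_prod_beta G_int_def exterior_field_def m_def)
qed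

lemma continuous_P: "i \<in> sh_index \<Longrightarrow> continuous_on (sphere 0 1) (P i)"
  using continuous_on_subset[OF C1_onD(3)[OF harmonic_onD(2)[OF P]]] by blast

lemma continuous_G:
  assumes i: "i \<in> sh_index"
  shows "continuous_on (sphere 0 1) (G i)"
proof -
  have "continuous_on (sphere 0 1) (exterior_field (fst i) (P i))"
    unfolding exterior_field_def
    by (intro continuous_intros continuous_P[OF i] continuous_on_subset[OF C1_onD(2)[OF harmonic_onD(2)[OF P[OF i]]]]) auto
  then show ?thesis
    by (rule continuous_on_eq) (simp add: G_eq[OF i])
qed

lemma potential_G:
  assumes i: "i \<in> sh_index"
  shows "potential (G i) y = potential (exterior_field (fst i) (P i)) y"
  unfolding potential_def by (rule lint_cong) (simp_all add: G_eq[OF i])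

lemma G_orthogonal:
  assumes i: "i \<in> sh_index" and j: "j \<in> sh_index"
  shows "(LINT x|\<mu>. G i x \<bullet> G j x) = (if i = j then (real (fst j) + 1) * (2 * real (fst j) + 1) else 0)"
proof -
  have "(LINT x|\<mu>. G i x \<bullet> G j x) = (LINT x|\<mu>. exterior_field (fst i) (P i) x \<bullet> exterior_field (fst j) (P j) x)"
    by (rule lint_cong) (simp_all add: G_eq[OF i] G_eq[OF j])
  then show ?thesis
    unfolding integral_exterior_field_inner[OF P[OF i] P_hom[OF i] P[OF j] P_hom[OF j]] P_orth[OF i j]
    by (simp add: power2_eq_square algebra_simps)
qed

lemma continuous_newton_grad_sphere:
  "norm y \<noteq> 1 \<Longrightarrow> continuous_on (sphere 0 1) (newton_grad y)"
  by (rule continuous_on_subset[OF continuous_newton_grad]) auto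

lemma potential_closed_span_outside:
  assumes f: "f \<in> L2_closed_span \<mu> sh_index G" and w: "norm w = 1" and t: "0 < t" "t < 1"
  shows "potential f ((1 / t) *\<^sub>R w) = 0"
  unfolding potential_def
proof (rule L2_closed_span_annihilator[OF f continuous_G])
  show "continuous_on (sphere 0 1) (newton_grad ((1 / t) *\<^sub>R w))"
    by (rule continuous_newton_grad_sphere) (use w t in auto)
  show "(LINT x|\<mu>. G i x \<bullet> newton_grad ((1 / t) *\<^sub>R w) x) = 0" if "i \<in> sh_index" for i
    using potential_G[OF that] potential_exterior_field_outside[OF P[OF that] P_hom[OF that] w t]
    by (simp add: potential_def)
qed

text \<open>On \<open>|y| = 1 / 2\<close> the potential determines the coefficients of \<open>f\<close>: for a finite
  combination \<open>\<Sum>i\<in>F. c i *\<^sub>R G i\<close> it equals \<open>\<Sum>i\<in>F. c i * (fst i + 1) * area * P i y\<close>.\<close>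

lemma closed_span_zero_if_potential_zero:
  assumes f: "f \<in> L2_closed_span \<mu> sh_index G"
    and z: "\<And>w. norm w = 1 \<Longrightarrow> potential f ((1 / 2) *\<^sub>R w) = 0"
  shows "AE x in \<mu>. f x = 0"
proof (rule L2_closed_span_orthogonal_zero[OF f continuous_G])
  fix j assume j: "j \<in> sh_index"
  have f2: "f \<in> L2_fun \<mu>" using f by (simp add: L2_closed_span_def)
  define n where "n = fst j"
  obtain B where B: "\<And>x. norm x = 1 \<Longrightarrow> norm (G j x) \<le> B"
    using compact_imp_bounded[OF compact_continuous_image[OF continuous_G[OF j] compact_sphere]]
    unfolding bounded_iff by force
  obtain B' where B': "\<And>x. norm x = 1 \<Longrightarrow> \<bar>P j x\<bar> \<le> B'"
    using compact_imp_bounded[OF compact_continuous_image[OF continuous_P[OF j] compact_sphere]]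
    unfolding bounded_iff by force
  \<comment> \<open>The factor with which \<open>P j\<close> enters the potential of
    \<open>G j\<close> on the sphere of radius \<open>1 / 2\<close>.\<close>
  define D where "D = (real n + 1) * area * (1 / 2) ^ n"
  have D: "D > 0" using area_pos by (simp add: D_def)
  define A where "A = (1 + area) / 2"
  define C where "C = B * A + (4 * A * B' * area / D) * ((real n + 1) * (2 * real n + 1))"
  show "(LINT x|\<mu>. f x \<bullet> G j x) = 0"
  proof (rule real_zero_if_bounded_by_multiples)
    fix e :: real assume e: "e > 0"
    with f obtain F c where F: "finite F" "F \<subseteq> sh_index" "L2_norm \<mu> (\<lambda>x. f x - (\<Sum>i\<in>F. c i *\<^sub>R G i x)) < e"
      unfolding L2_closed_span_def by blast
    have FI: "i \<in> sh_index" if "i \<in> F" for i using F(2) that by (rule subsetD)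
    define S where "S x = (\<Sum>i\<in>F. c i *\<^sub>R G i x)" for x
    define h where "h x = f x - S x" for x
    \<comment> \<open>The coefficient of \<open>G j\<close> in the approximant, which is
      \<open>0\<close> if \<open>j\<close> does not occur in it.\<close>
    define a where "a = (if j \<in> F then c j else 0)"
    have cS: "continuous_on (sphere 0 1) S"
      unfolding S_def by (intro continuous_on_sum continuous_on_scaleR continuous_on_const continuous_G FI)
    have h2: "h \<in> L2_fun \<mu>" unfolding h_def by (rule L2_surface_diff(1)[OF f2 cS])
    have he: "L2_norm \<mu> h < e" using F(3) by (simp add: h_def[abs_def] S_def)
    have inner_S: "(LINT x|\<mu>. S x \<bullet> k x) = (\<Sum>i\<in>F. c i * (LINT x|\<mu>. G i x \<bullet> k x))"
      and inner_f: "(LINT x|\<mu>. f x \<bullet> k x) = (LINT x|\<mu>. h x \<bullet> k x) + (LINT x|\<mu>. S x \<bullet> k x)"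
      if k: "continuous_on (sphere 0 1) k" for k
    proof -
      have iG: "integrable \<mu> (\<lambda>x. G i x \<bullet> k x)" if "i \<in> F" for i
        by (intro surface_integrable continuous_on_inner k continuous_G FI that)
      show "(LINT x|\<mu>. S x \<bullet> k x) = (\<Sum>i\<in>F. c i * (LINT x|\<mu>. G i x \<bullet> k x))"
        unfolding S_def using iG by (simp add: inner_sum_left lint_sum)
      show "(LINT x|\<mu>. f x \<bullet> k x) = (LINT x|\<mu>. h x \<bullet> k x) + (LINT x|\<mu>. S x \<bullet> k x)"
        using L2_surface_diff(2)[OF f2 k] surface_integrable[OF continuous_on_inner[OF cS k]]
        by (simp add: h_def inner_diff_left)
    qed
    \<comment> \<open>The potential of \<open>S\<close> at \<open>(1 / 2) *\<^sub>R w\<close>. As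
      the potential of \<open>f\<close> vanishes there, \<open>Q\<close> is minus the potential of
      the small remainder \<open>h\<close>.\<close>
    define Q where "Q w = (\<Sum>i\<in>F. c i * ((real (fst i) + 1) * area * (1 / 2) ^ fst i * P i w))" for w
    have Qb: "\<bar>Q w\<bar> \<le> 4 * (e * A)" if w: "norm w = 1" for w
    proof -
      have k: "continuous_on (sphere 0 1) (newton_grad ((1 / 2) *\<^sub>R w))"
        by (rule continuous_newton_grad_sphere) (use w in auto)
      have "Q w = (\<Sum>i\<in>F. c i * potential (G i) ((1 / 2) *\<^sub>R w))"
        unfolding Q_def
      proof (rule sum.cong)
        fix i assume "i \<in> F"
        then have i: "i \<in> sh_index" using F by auto
        show "c i * ((real (fst i) + 1) * area * (1 / 2) ^ fst i * P i w) = c i * potential (G i) ((1 / 2) *\<^sub>R w)"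
          unfolding potential_G[OF i] using potential_exterior_field_inside[OF P[OF i] P_hom[OF i] w, of "1 / 2"]
          by (simp add: P_hom[OF i])
      qed simp
      also have "\<dots> = (LINT x|\<mu>. S x \<bullet> newton_grad ((1 / 2) *\<^sub>R w) x)"
        unfolding inner_S[OF k] by (simp add: potential_def)
      also have "\<dots> = - (LINT x|\<mu>. h x \<bullet> newton_grad ((1 / 2) *\<^sub>R w) x)"
        using z[OF w] inner_f[OF k] by (simp add: potential_def)
      also have "\<bar>\<dots>\<bar> \<le> 4 * (e * (1 + area) / 2)"
        unfolding abs_minus_cancel
        by (rule integral_inner_bound[OF h2 e he k newton_grad_bound[OF _ w]])
      finally show ?thesis by (simp add: A_def)
    qed
    \<comment> \<open>Testing \<open>Q\<close> against \<open>P j\<close> isolates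
      \<open>a * D\<close>, so the smallness of \<open>Q\<close> makes the coefficient
      \<open>a\<close> small; then both contributions to the pairing of \<open>f\<close> with
      \<open>G j\<close> are of order \<open>e\<close>.\<close>
    have "(LINT w|\<mu>. Q w * P j w) = (\<Sum>i\<in>F. c i * ((real (fst i) + 1) * area * (1 / 2) ^ fst i) * (LINT w|\<mu>. P i w * P j w))"
    proof -
      have "integrable \<mu> (\<lambda>w. P i w * P j w)" if "i \<in> F" for i
        by (intro surface_integrable continuous_on_mult continuous_P j FI that)
      then show ?thesis
        unfolding Q_def by (simp add: sum_distrib_right lint_sum mult.assoc)
    qed
    also have "\<dots> = (\<Sum>i\<in>F. if i = j then c j * D else 0)"
      by (rule sum.cong) (use F P_orth[OF _ j] in \<open>auto simp: D_def n_def\<close>)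
    also have "\<dots> = a * D" using F(1) by (simp add: a_def)
    finally have "\<bar>a * D\<bar> = \<bar>LINT w|\<mu>. Q w * P j w\<bar>" by simp
    also have "\<dots> \<le> (4 * (e * A) * B') * area"
    proof (rule surface_integral_bound)
      show "\<bar>Q x * P j x\<bar> \<le> 4 * (e * A) * B'" if x: "norm x = 1" for x
        unfolding abs_mult using Qb[OF x] B'[OF x] order_trans[OF abs_ge_zero Qb[OF x]] by (intro mult_mono) auto
    qed
    finally have "\<bar>a\<bar> * D \<le> 4 * (e * A) * B' * area" using D by (simp add: abs_mult)
    then have a: "\<bar>a\<bar> \<le> e * (4 * A * B' * area / D)" using D by (simp add: field_simps)
    have "(LINT x|\<mu>. S x \<bullet> G j x) = (\<Sum>i\<in>F. if i = j then c j * ((real n + 1) * (2 * real n + 1)) else 0)"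
      unfolding inner_S[OF continuous_G[OF j]]
      by (rule sum.cong) (use F G_orthogonal[OF _ j] in \<open>auto simp: n_def\<close>)
    also have "\<dots> = a * ((real n + 1) * (2 * real n + 1))" using F(1) by (simp add: a_def)
    finally have Sj: "(LINT x|\<mu>. S x \<bullet> G j x) = a * ((real n + 1) * (2 * real n + 1))" .
    have tri: "\<bar>X + a * k\<bar> \<le> \<bar>X\<bar> + \<bar>a\<bar> * k" if "k \<ge> 0" for X k
      using abs_triangle_ineq[of X "a * k"] that by (simp add: abs_mult)
    have "\<bar>LINT x|\<mu>. f x \<bullet> G j x\<bar> \<le> \<bar>LINT x|\<mu>. h x \<bullet> G j x\<bar> + \<bar>a\<bar> * ((real n + 1) * (2 * real n + 1))"
      unfolding inner_f[OF continuous_G[OF j]] Sj by (rule tri) simp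
    also have "\<dots> \<le> B * (e * (1 + area) / 2) + (e * (4 * A * B' * area / D)) * ((real n + 1) * (2 * real n + 1))"
      by (intro add_mono mult_right_mono a integral_inner_bound[OF h2 e he continuous_G[OF j] B]) auto
    also have "\<dots> = e * C"
      by (simp add: C_def A_def algebra_simps)
    finally show "\<bar>LINT x|\<mu>. f x \<bullet> G j x\<bar> \<le> e * C" .
  qed
qed

end

lemma harmonic_basis_exists:
  assumes "sh_orthonormal_basis Y"
  obtains P where "harmonic_basis Y P"
proof -
  have "\<exists>p. harmonic_on UNIV p \<and> (\<forall>t x. p (t *\<^sub>R x) = t ^ fst i * p x)
      \<and> (\<forall>x. norm x = 1 \<longrightarrow> Y (fst i) (snd i) x = p x)" if "i \<in> sh_index" for i
  proof -
    have "spherical_harmonic (fst i) (Y (fst i) (snd i))"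
      using assms that by (force simp: sh_orthonormal_basis_def)
    then show ?thesis by (elim spherical_harmonic_extension) blast
  qed
  then obtain P where P: "\<And>i. i \<in> sh_index \<Longrightarrow> harmonic_on UNIV (P i)"
    "\<And>i t x. i \<in> sh_index \<Longrightarrow> P i (t *\<^sub>R x) = t ^ fst i * P i x"
    "\<And>i x. i \<in> sh_index \<Longrightarrow> norm x = 1 \<Longrightarrow> Y (fst i) (snd i) x = P i x"
    by metis
  have "(LINT x|\<mu>. P i x * P j x) = (if i = j then 1 else 0)" if ij: "i \<in> sh_index" "j \<in> sh_index" for i j
  proof -
    have "(LINT x|\<mu>. P i x * P j x) = (LINT x|\<mu>. Y (fst i) (snd i) x * Y (fst j) (snd j) x)"
      by (rule lint_cong) (simp_all add: P(3) ij)
    also have "\<dots> = (if i = j then 1 else 0)"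
      using assms ij unfolding sh_orthonormal_basis_def by (cases i, cases j) fastforce
    finally show ?thesis .
  qed
  then have "harmonic_basis Y P" using P by unfold_locales auto
  then show ?thesis by (rule that)
qed

section \<open>The kernel of the restriction operator\<close>

lemma grad_zero_fun [simp]: "grad (\<lambda>x. c) = (\<lambda>x. 0)"
  by (rule ext, rule grad_eqI) simp

section \<open>The zero pair belongs to the kernel\<close>

lemma zero_in_altitude_class: "L2_class \<mu> (\<lambda>x. 0) \<in> altitude_class \<alpha> r"
proof -
  have Ck: "Ck_on k S (\<lambda>x. 0)" for k S
    by (induction k) simp_all
  have ext: "radial_ext r (\<lambda>x. 0) = (\<lambda>x. 0)"
    by (rule ext) (simp add: radial_ext_def)
  have sm: "smooth_on_sphere r (\<lambda>x. 0)"
    unfolding smooth_on_sphere_def ext by (simp add: Ck)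
  have "(\<lambda>x. 0) \<in> H1_sphere r"
    unfolding H1_sphere_def
  proof (intro CollectI conjI exI[of _ "\<lambda>j x. 0"] exI[of _ "\<lambda>x. 0"] allI)
    show "(\<lambda>j. L2_norm (surface_measure r) (\<lambda>x. surface_grad r (\<lambda>x. 0) x - 0)) \<longlonglongrightarrow> 0"
      by (simp add: surface_grad_def ext L2_norm_def)
  qed (simp_all add: sm L2_norm_def)
  moreover have "has_nt_trace \<alpha> r (\<lambda>x. 0) (\<lambda>x. 0)"
    by (simp add: has_nt_trace_def)
  moreover have "nt_maximal \<alpha> r (\<lambda>x. 0) y = 0" for y
    \<comment> \<open>The supremum over an empty region is \<open>bot\<close>, which is
      \<open>0\<close> in \<open>ennreal\<close>.\<close>
    unfolding nt_maximal_def by (cases "nt_region \<alpha> r y = {}") (simp_all add: bot_ennreal)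
  ultimately show ?thesis
    unfolding altitude_class_def
    by (intro CollectI exI[of _ "\<lambda>x. 0"]) (auto simp: harmonic_const)
qed

lemma zero_in_hardy_minus: "L2_class \<mu> (\<lambda>x. 0) \<in> hardy_minus Y"
  unfolding hardy_minus_def L2_closed_span_def
  by (intro imageI CollectI conjI allI impI exI[of _ "{}"]) (auto simp: L2_norm_def)

lemma open_patch_measurable:
  assumes "openin (top_of_set (sphere 0 1)) U"
  shows "U \<in> sets \<mu>"
  using assms unfolding openin_open sets_surface sets_restrict_space by auto

lemma AE_restrict_patch:
  assumes U: "U \<in> sets \<mu>"
  shows "(AE x in restrict_space \<mu> U. Q x) \<longleftrightarrow> (AE x in \<mu>. x \<in> U \<longrightarrow> Q x)"
  by (rule AE_restrict_space_iff) (use U sets.sets_into_space[OF U] in \<open>auto simp: Int_absorb2\<close>)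

lemma L2_fun_restrict:
  fixes f :: "real^3 \<Rightarrow> real^3"
  assumes U: "U \<in> sets \<mu>" and f: "f \<in> L2_fun \<mu>"
  shows "f \<in> L2_fun (restrict_space \<mu> U)"
proof -
  have "integrable \<mu> (\<lambda>x. indicator U x *\<^sub>R (norm (f x))\<^sup>2)"
    using f U by (intro integrable_mult_indicator) (auto simp: L2_fun_def)
  then have "integrable (restrict_space \<mu> U) (\<lambda>x. (norm (f x))\<^sup>2)"
    using U sets.sets_into_space[OF U] by (subst integrable_restrict_space) (auto simp: Int_absorb2)
  then show ?thesis
    using f by (auto simp: L2_fun_def intro: measurable_restrict_space1)
qed

lemma L2_fun_add:
  fixes f g :: "real^3 \<Rightarrow> real^3"
  assumes "f \<in> L2_fun \<mu>" "g \<in> L2_fun \<mu>"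
  shows "(\<lambda>x. f x + g x) \<in> L2_fun \<mu>"
proof -
  have m: "(\<lambda>x. f x + g x) \<in> borel_measurable \<mu>"
    using assms by (auto simp: L2_fun_def)
  have "integrable \<mu> (\<lambda>x. (norm (f x + g x))\<^sup>2)"
  proof (rule lint_bound)
    show "integrable \<mu> (\<lambda>x. 2 * (norm (f x))\<^sup>2 + 2 * (norm (g x))\<^sup>2)"
      using assms by (auto simp: L2_fun_def)
    show "(\<lambda>x. (norm (f x + g x))\<^sup>2) \<in> borel_measurable \<mu>" using m by measurable
    show "AE x in \<mu>. norm ((norm (f x + g x))\<^sup>2) \<le> norm (2 * (norm (f x))\<^sup>2 + 2 * (norm (g x))\<^sup>2)"
    proof (rule AE_I2)
      fix x
      have "(norm (f x + g x))\<^sup>2 + (norm (f x - g x))\<^sup>2 = 2 * (norm (f x))\<^sup>2 + 2 * (norm (g x))\<^sup>2"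
        by (simp add: power2_norm_eq_inner inner_add_left inner_add_right inner_diff_left inner_diff_right inner_commute)
      then have "(norm (f x + g x))\<^sup>2 \<le> 2 * (norm (f x))\<^sup>2 + 2 * (norm (g x))\<^sup>2"
        using zero_le_power2[of "norm (f x - g x)"] by linarith
      then show "norm ((norm (f x + g x))\<^sup>2) \<le> norm (2 * (norm (f x))\<^sup>2 + 2 * (norm (g x))\<^sup>2)" by simp
    qed
  qed
  with m show ?thesis by (simp add: L2_fun_def)
qed

text \<open>Any two representatives of zero have a sum vanishing almost everywhere, so all members
  of the union in \<open>A_op\<close> are the same class.\<close>

lemma zero_in_kernel:
  assumes U: "U \<in> sets \<mu>"
  shows "(L2_class \<mu> (\<lambda>x. 0), L2_class \<mu> (\<lambda>x. 0)) \<in> A_kernel Y \<alpha> r U"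
proof -
  let ?Z = "L2_class \<mu> (\<lambda>x. 0 :: real^3)"
  let ?N = "restrict_space \<mu> U"
  have "L2_class ?N (\<lambda>x. f x + g x) = L2_class ?N (\<lambda>x. 0)" if "f \<in> ?Z" "g \<in> ?Z" for f g
  proof (rule L2_class_eqI)
    have fg: "f \<in> L2_fun \<mu>" "g \<in> L2_fun \<mu>" "AE x in \<mu>. 0 = f x" "AE x in \<mu>. 0 = g x"
      using that by (auto simp: mem_L2_class)
    show "(\<lambda>x. f x + g x) \<in> L2_fun ?N"
      by (rule L2_fun_restrict[OF U L2_fun_add[OF fg(1,2)]])
    show "AE x in ?N. f x + g x = 0"
      unfolding AE_restrict_patch[OF U] using fg(3,4) by eventually_elim simp
  qed simp
  moreover have "(\<lambda>x. 0) \<in> ?Z" by (simp add: mem_L2_class)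
  ultimately have "A_op U (?Z, ?Z) = L2_class ?N (\<lambda>x. 0)"
    unfolding A_op_def by auto
  then show ?thesis
    unfolding A_kernel_def using zero_in_altitude_class zero_in_hardy_minus by auto
qed

lemma grad_zero_if_constant:
  assumes "open S" "x \<in> S" "\<And>y. y \<in> S \<Longrightarrow> u y = c"
  shows "grad u x = 0"
proof (rule grad_eqI)
  show "(u has_derivative (\<lambda>h. h \<bullet> 0)) (at x)"
    by (rule has_derivative_transform_within_open[OF _ assms(1,2), of "\<lambda>x. c"]) (use assms in auto)
qed

theorem theorem5:
  fixes U :: "(real^3) set" and r \<alpha> :: real and Y :: "nat \<Rightarrow> int \<Rightarrow> real^3 \<Rightarrow> real"
  assumes "patch U"
    and "r > 1"
    and "\<alpha> > 0"
    and "sh_orthonormal_basis Y"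
  shows "A_kernel Y \<alpha> r U =
    {(L2_class (surface_measure 1) (\<lambda>x. 0), L2_class (surface_measure 1) (\<lambda>x. 0))}"
proof -
  have U: "openin (top_of_set (sphere 0 1)) U" "U \<noteq> {}"
    using assms(1) by (auto simp: patch_def)
  have Um: "U \<in> sets \<mu>" by (rule open_patch_measurable[OF U(1)])
  have US: "U \<subseteq> sphere 0 1" using U(1) by (rule openin_imp_subset)
  let ?N = "restrict_space \<mu> U"
  obtain P where "harmonic_basis Y P" using harmonic_basis_exists[OF assms(4)] .
  then interpret harmonic_basis Y P .
  have ker: "Fp = L2_class \<mu> (\<lambda>x. 0) \<and> Fm = L2_class \<mu> (\<lambda>x. 0)"
    if k: "(Fp, Fm) \<in> A_kernel Y \<alpha> r U" for Fp Fm
  proof -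
    from k obtain u fm where u: "harmonic_on (ball 0 r) u" "Fp = L2_class \<mu> (grad u)"
      and fm: "fm \<in> L2_closed_span \<mu> sh_index G" "Fm = L2_class \<mu> fm"
      and A: "A_op U (Fp, Fm) = L2_class ?N (\<lambda>x. 0)"
      unfolding A_kernel_def altitude_class_def hardy_minus_def G_def by auto
    have gu: "continuous_on (sphere 0 1) (grad u)"
      by (rule harmonic_sphere(4)[OF u(1) assms(2)])
    have gu2: "grad u \<in> L2_fun \<mu>" by (rule continuous_L2_surface[OF gu])
    have fm2: "fm \<in> L2_fun \<mu>" using fm(1) by (simp add: L2_closed_span_def)
    define f where "f x = grad u x + fm x" for x
    have f2: "f \<in> L2_fun \<mu>" unfolding f_def by (rule L2_fun_add[OF gu2 fm2])
    have "f \<in> L2_class ?N f"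
      using L2_fun_restrict[OF Um f2] by (simp add: mem_L2_class)
    moreover have "grad u \<in> Fp" "fm \<in> Fm"
      using gu2 fm2 by (simp_all add: u(2) fm(2) mem_L2_class)
    ultimately have "f \<in> A_op U (Fp, Fm)"
      unfolding A_op_def f_def by auto
    then have "AE x in ?N. 0 = f x"
      unfolding A by (simp add: mem_L2_class)
    then have AEU: "AE x in \<mu>. x \<in> U \<longrightarrow> 0 = f x"
      by (simp add: AE_restrict_patch[OF Um])
    \<comment> \<open>The support of the field after modification; it is compact because
      \<open>U\<close> is relatively open.\<close>
    define K where "K = sphere 0 1 - U"
    have "closedin (top_of_set (sphere 0 1)) K"
      unfolding closedin_def K_def using U(1) US by (simp add: double_diff)
    then have K: "compact K" "K \<subseteq> sphere 0 1"
      using closedin_compact[OF compact_sphere] by (auto simp: K_def)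
    \<comment> \<open>\<open>f\<close> vanishes on \<open>U\<close> only almost everywhere. Changing
      it on a null set makes it vanish everywhere off \<open>K\<close>, as the continuation lemmas
      require, and leaves its potential off the sphere unchanged.\<close>
    define g where "g x = indicator (- U) x *\<^sub>R f x" for x
    have AEg: "AE x in \<mu>. f x = g x"
      using AEU by eventually_elim (auto simp: g_def)
    have g_int: "integrable \<mu> g"
    proof -
      have "integrable \<mu> (\<lambda>x. indicator (space \<mu> - U) x *\<^sub>R f x)"
        using Um by (intro integrable_mult_indicator L2_surface_integrable(1)[OF f2]) auto
      then show ?thesis
        by (rule Bochner_Integration.integrable_cong[THEN iffD1, rotated 2]) (auto simp: g_def indicator_def)
    qed
    have g0: "g x = 0" if "x \<in> sphere 0 1 - K" for x
      using that by (auto simp: g_def K_def)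
    have pot: "potential g y = potential (grad u) y + potential fm y" if y: "norm y \<noteq> 1" for y
    proof -
      note c = continuous_newton_grad_sphere[OF y]
      note m = continuous_measurable_surface[OF c]
      have "(LINT x|\<mu>. g x \<bullet> newton_grad y x) = (LINT x|\<mu>. f x \<bullet> newton_grad y x)"
      proof (rule integral_cong_AE)
        show "(\<lambda>x. g x \<bullet> newton_grad y x) \<in> borel_measurable \<mu>" "(\<lambda>x. f x \<bullet> newton_grad y x) \<in> borel_measurable \<mu>"
          using m borel_measurable_integrable[OF g_int] L2_surface_integrable(3)[OF f2] by measurable
        show "AE x in \<mu>. g x \<bullet> newton_grad y x = f x \<bullet> newton_grad y x"
          using AEg by eventually_elim simp
      qed
      then show ?thesis
        using L2_surface_diff(2)[OF gu2 c] L2_surface_diff(2)[OF fm2 c]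
        by (simp add: potential_def f_def inner_add_left)
    qed
    \<comment> \<open>Any radius strictly between \<open>1\<close> and \<open>r\<close> would
      do.\<close>
    define s where "s = (1 + r) / 2"
    have s: "1 < s" "s < r" using assms(2) by (auto simp: s_def)
    have rad: "0 < t \<Longrightarrow> t < 1 \<Longrightarrow> potential g (t *\<^sub>R w) = 0" "0 < t \<Longrightarrow> t < s \<Longrightarrow> euler u (t *\<^sub>R w) = 0"
      if w: "w \<in> U" for w t
    proof -
      have nw: "norm w = 1" using US w by auto
      obtain d where d: "d > 0" "\<And>y. y \<in> sphere 0 1 \<Longrightarrow> dist y w < d \<Longrightarrow> y \<in> U"
        using U(1) w unfolding openin_euclidean_subtopology_iff by blast
      have dK: "d \<le> norm (x - w)" if "x \<in> K" for x
      proof (rule ccontr)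
        assume "\<not> d \<le> norm (x - w)"
        then have "x \<in> U" using d(2)[of x] that by (simp add: K_def dist_norm)
        then show False using that by (simp add: K_def)
      qed
      \<comment> \<open>Outside the ball \<open>fm\<close> contributes nothing, so only the Kelvin
        transform of \<open>euler u\<close> remains.\<close>
      have out: "potential g ((1 / t) *\<^sub>R w) = t * area * euler u (t *\<^sub>R w)" if t: "0 < t" "t < 1" for t
      proof -
        have "norm ((1 / t) *\<^sub>R w) \<noteq> 1" using t nw by simp
        from pot[OF this] show ?thesis
          by (simp only: potential_grad_outside[OF u(1) assms(2) nw t] potential_closed_span_outside[OF fm(1) nw t] add_0_right)
      qed
      show "potential g (t *\<^sub>R w) = 0" if "0 < t" "t < 1"
        by (rule radial_continuation(1)[OF K g_int g0 nw d(1) dK u(1) s out that])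
      show "euler u (t *\<^sub>R w) = 0" if "0 < t" "t < s"
        by (rule radial_continuation(2)[OF K g_int g0 nw d(1) dK u(1) s out that])
    qed
    have s0: "0 < s" using s by simp
    \<comment> \<open>The radial derivative vanishes along each ray over \<open>U\<close>, so
      \<open>u\<close> keeps its central value there. All rays share this constant, which lets
      unique continuation apply to \<open>u - u 0\<close>.\<close>
    have uw: "u (t *\<^sub>R w) = u 0" if w: "w \<in> U" and t: "0 < t" "t < s" for w t
    proof -
      have nw: "norm w = 1" using US w by auto
      have in_ball: "l *\<^sub>R w \<in> ball 0 r" if "0 \<le> l" "l \<le> t" for l
        using that t s nw by simp
      have "(\<lambda>l. u (l *\<^sub>R w)) t = (\<lambda>l. u (l *\<^sub>R w)) 0"
      proof (rule DERIV_isconst2[of 0 t "\<lambda>l. u (l *\<^sub>R w)" t])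
        show "continuous_on {0..t} (\<lambda>l. u (l *\<^sub>R w))"
          by (rule continuous_on_compose2[OF C1_onD(3)[OF harmonic_onD(2)[OF u(1)]]])
            (use in_ball in \<open>auto intro!: continuous_intros simp del: mem_ball\<close>)
        fix l assume l: "0 < l" "l < t"
        then have "l *\<^sub>R w \<in> ball 0 r" "euler u (l *\<^sub>R w) = 0"
          using in_ball[of l] rad(2)[OF w, of l] t by auto
        with DERIV_dilation[OF C1_onD(1)[OF harmonic_onD(2)[OF u(1)]] DERIV_ident, of l w] l
        show "((\<lambda>l. u (l *\<^sub>R w)) has_real_derivative 0) (at l)" by simp
      qed (use t in auto)
      then show ?thesis by simp
    qed
    have u_const: "u y = u 0" if "norm y < s" for y
    proof (cases "y = 0")
      case False
      show ?thesis
        by (rule harmonic_constant_from_patch[OF u(1) s0 s(2) U uw that False])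
    qed simp
    have grad0: "grad u x = 0" if "norm x = 1" for x
    proof (rule grad_zero_if_constant[OF open_ball])
      show "x \<in> ball 0 s" using that s by simp
      show "u y = u 0" if "y \<in> ball 0 s" for y using u_const[of y] that by simp
    qed
    \<comment> \<open>Inside the ball the potentials of \<open>g\<close> and of
      \<open>grad u\<close> both vanish, the former by continuation from the cone over
      \<open>U\<close>.\<close>
    have "potential fm ((1 / 2) *\<^sub>R w) = 0" if w: "norm w = 1" for w
    proof -
      have "potential g ((1 / 2) *\<^sub>R w) = 0"
        by (rule potential_zero_from_patch[OF K g_int g0 U rad(1)]) (use w in auto)
      moreover have "potential (grad u) ((1 / 2) *\<^sub>R w) = 0"
        by (rule potential_grad_inside[OF u(1) assms(2) w]) auto
      ultimately show ?thesis using pot[of "(1 / 2) *\<^sub>R w"] w by simp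
    qed
    then have "AE x in \<mu>. fm x = 0"
      by (rule closed_span_zero_if_potential_zero[OF fm(1)])
    then have "Fm = L2_class \<mu> (\<lambda>x. 0)"
      unfolding fm(2) by (intro L2_class_eqI fm2) auto
    moreover have "Fp = L2_class \<mu> (\<lambda>x. 0)"
      unfolding u(2) by (intro L2_class_eqI gu2 AE_I2) (auto simp: grad0)
    ultimately show ?thesis by simp
  qed
  show ?thesis
  proof (rule equalityI)
    show "A_kernel Y \<alpha> r U \<subseteq> {(L2_class \<mu> (\<lambda>x. 0), L2_class \<mu> (\<lambda>x. 0))}"
    proof (rule subrelI)
      fix Fp Fm assume "(Fp, Fm) \<in> A_kernel Y \<alpha> r U"
      from ker[OF this] show "(Fp, Fm) \<in> {(L2_class \<mu> (\<lambda>x. 0), L2_class \<mu> (\<lambda>x. 0))}"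
        by (simp only: insertI1)
    qed
    show "{(L2_class \<mu> (\<lambda>x. 0), L2_class \<mu> (\<lambda>x. 0))} \<subseteq> A_kernel Y \<alpha> r U"
      using zero_in_kernel[OF Um] by (simp only: insert_subset empty_subsetI)
  qed
qed

end
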